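(* Let $X$ be a finite nonempty set and suppose that $\mathcal N$ is a phylogenetic network on $X$ that displays two forests $\mathcal F$ and $\mathcal F'$ on $X$. Then there is a cherry picking sequence $\sigma$ for $\mathcal F$ and $\mathcal F'$ with $r(\mathcal N)\ge w(\sigma)$.
   Context: All graphs are finite multigraphs without loops. A leaf is a vertex of degree at most one. Suppressing a degree-two vertex $v$ with incident edges $\{u,v\},\{v,w\}$, $u\neq w$, means deleting $v$ and these edges and adding $\{u,w\}$. A phylogenetic network on a finite nonempty set $X$ is a simple connected graph $\mathcal N=(V,E)$ whose set of leaves is exactly $X$ and in which every non-leaf vertex has degree three; if $X=\{x\}$ the single vertex $x$ is a phylogenetic network. $r(\mathcal N)=|E|-(|V|-1)$. A phylogenetic tree on $X$ is a phylogenetic network on $X$ with no cycles. A forest on $X$ is a set of phylogenetic trees whose leaf sets are pairwise disjoint with union $X$. A phylogenetic tree $\mathcal T$ on $Y\subseteq X$ is displayed by $\mathcal N$ if $\mathcal T$ can be obtained from some subtree $\mathcal N[\mathcal T]$ of $\mathcal N$ by suppressing all its degree-two vertices; $\mathcal N$ displays a forest $\mathcal F$ on $X$ if every tree of $\mathcal F$ is displayed by $\mathcal N$ with the subtrees $\mathcal N[\mathcal T]$, $\mathcal T\in\mathcal F$, chosen pairwise vertex-disjoint. Forest notions: a cherry of a phylogenetic tree $\mathcal T$ is a pair $(x,y)$ of distinct leaves such that either $\mathcal T$ is the single edge $\{x,y\}$ or $x,y$ are adjacent to a common vertex; a cherry of a forest is a cherry of one of its trees. For a leaf $x$, $e_x$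 denotes the edge containing $x$. A phylogenetic tree $\mathcal S$ is a proper pendant subtree of a tree $\mathcal T$ if there is a cut-edge $e$ of $\mathcal T$ such that $\mathcal S$ equals one of the two components obtained by deleting $e$ and suppressing degree-two vertices; this edge is $e_{\mathcal S}$ (for $\mathcal S$ a single leaf $p$, $e_{\mathcal S}=e_p$). $((x,y),p)$ denotes a proper pendant subtree with leaf set $\{x,y,p\}$ in which $(x,y)$ is a cherry, and $((x,y),(p,q))$ one with leaf set $\{x,y,p,q\}$ in which $(x,y)$ and $(p,q)$ are cherries; $(p,q)$ also denotes the two-leaf pendant subtree on $\{p,q\}$. For an edge $e$ of a tree $\mathcal T_e$ in a forest $\mathcal F$, $\mathcal F-e$ replaces $\mathcal T_e$ by the trees obtained from $\mathcal T_e$ by deleting $e$ and suppressing degree-two vertices. For $x\in X$, $|X|\ge2$, with $\mathcal T_x$ the tree containing $x$, $\mathcal F-x$ removes $\mathcal T_x$ if it is the single vertex $x$ and otherwise replaces $\mathcal T_x$ by the tree obtained by deleting $x$ and $e_x$ and suppressing the resulting degree-two vertex. Cherry picking sequence: for forests $\mathcal F,\mathcal F'$ on $X$, a sequence $\sigma=(x_1,\dots,x_m)$ of elements of $X$, $m\ge|X|\ge1$, is a cherry picking sequence for $\mathcal F$ and $\mathcal F'$ if there are forests $\mathcal F[i],\mathcal F'[i]$, $1\le i\le m$, with $\mathcal F[1]=\mathcal F$, $\mathcal F'[1]=\mathcal F'$, $\mathcal F[m]=\mathcal F'[m]=\{x_m\}$, and for each $1\le i\le m-1$ precisely one of: (C1)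 $(x_i,y)$ is a cherry in both $\mathcal F[i]$ and $\mathcal F'[i]$ for some $y$, and $\mathcal F[i+1]=\mathcal F[i]-x_i$, $\mathcal F'[i+1]=\mathcal F'[i]-x_i$; (C2) $(x_i,y)$ is a cherry in $\mathcal F[i]$ for some $y$ and one of: (a) $(x_i,z)$ is a cherry in $\mathcal F'[i]$ with $z\ne y$, $\mathcal F'[i+1]=\mathcal F'[i]$, and either (i) $\mathcal F[i+1]$ is $\mathcal F[i]-e_{x_i}$ or $\mathcal F[i]-e_y$, or (ii) $((x_i,y),p)$ is a proper pendant subtree of a tree in $\mathcal F[i]$, $p\in X$, and $\mathcal F[i+1]=\mathcal F[i]-e_{\mathcal S}$ for some $\mathcal S\in\{p,((x_i,y),p)\}$, or (iii) $((x_i,y),(p,q))$ is a proper pendant subtree of a tree in $\mathcal F[i]$, $p\ne q\in X$, and $\mathcal F[i+1]=\mathcal F[i]-e_{\mathcal S}$ for some $\mathcal S\in\{p,q,(p,q)\}$; (b) $x_i,y$ are leaves of one tree $\mathcal T'\in\mathcal F'[i]$, neither in a cherry of $\mathcal T'$, and either (i) $\mathcal F'[i+1]=\mathcal F'[i]$ and $\mathcal F[i+1]$ is $\mathcal F[i]-e_{x_i}$ or $\mathcal F[i]-e_y$, or (ii) for $e$ the edge of $\mathcal T'$ containing the vertex adjacent to $x_i$ and not on the path between $x_i$ and $y$, $\mathcal F'[i+1]=\mathcal F'[i]-e$ and $\mathcal F[i+1]=\mathcal F[i]$; (c) $x_i,y$ lie in different trees of $\mathcal F'[i]$, neither is an isolated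 vertex or in a cherry of $\mathcal F'[i]$, $\mathcal F'[i+1]=\mathcal F'[i]$, and $\mathcal F[i+1]$ is $\mathcal F[i]-e_{x_i}$ or $\mathcal F[i]-e_y$; or the same with the roles of $\mathcal F$ and $\mathcal F'$ reversed; (C3) $x_i$ is a single-vertex component of $\mathcal F[i]$, $\mathcal F[i+1]=\mathcal F[i]-x_i$ and $\mathcal F'[i+1]=\mathcal F'[i]-x_i$, or the same with the roles of $\mathcal F$ and $\mathcal F'$ reversed. Weight: if $m\ge2$, $c(x_i)=0$ if (C1) or (C3) applies at step $i$ and $c(x_i)=1$ otherwise, and $w(\sigma)=\sum_{i=1}^{m-1}c(x_i)$; if $m=1$, $w(\sigma)=0$. *)

theory Defs
  imports Main
begin

section \<open>Graphs\<close>

text \<open>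
  Networks are simple, and all graphs derived from them below are trees or disjoint unions of
  trees, in which suppressing a degree-two vertex never creates a parallel edge. Edges can
  therefore be represented as two-element sets of vertices.
\<close>

record 'v graph =
  verts :: "'v set"
  edges :: "'v set set"

definition simple_graph :: "'v graph \<Rightarrow> bool" where
  "simple_graph G \<longleftrightarrow> finite (verts G) \<and> (\<forall>e \<in> edges G. e \<subseteq> verts G \<and> card e = 2)"

definition deg :: "'v graph \<Rightarrow> 'v \<Rightarrow> nat" where
  "deg G v = card {e \<in> edges G. v \<in> e}"

definition leaves :: "'v graph \<Rightarrow> 'v set" where
  "leaves G = {v \<in> verts G. deg G v \<le> 1}"

definition is_path :: "'v graph \<Rightarrow> 'v list \<Rightarrow> bool" where
  "is_path G p \<longleftrightarrow> p \<noteq> [] \<and> set p \<subseteq> verts G \<and> distinct p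
     \<and> successively (\<lambda>u v. {u, v} \<in> edges G) p"

definition path_between :: "'v graph \<Rightarrow> 'v \<Rightarrow> 'v list \<Rightarrow> 'v \<Rightarrow> bool" where
  "path_between G u p v \<longleftrightarrow> is_path G p \<and> hd p = u \<and> last p = v"

definition path_edges :: "'v list \<Rightarrow> 'v set set" where
  "path_edges p = {{p ! i, p ! Suc i} | i. Suc i < length p}"

definition connected_graph :: "'v graph \<Rightarrow> bool" where
  "connected_graph G \<longleftrightarrow> verts G \<noteq> {}
     \<and> (\<forall>u \<in> verts G. \<forall>v \<in> verts G. \<exists>p. path_between G u p v)"

definition acyclic_graph :: "'v graph \<Rightarrow> bool" where
  "acyclic_graph G \<longleftrightarrow> \<not> (\<exists>p. is_path G p \<and> 3 \<le> length p \<and> {last p, hd p} \<in> edges G)"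

definition tree_graph :: "'v graph \<Rightarrow> bool" where
  "tree_graph G \<longleftrightarrow> simple_graph G \<and> connected_graph G \<and> acyclic_graph G"

definition subtree_of :: "'v graph \<Rightarrow> 'v graph \<Rightarrow> bool" where
  "subtree_of S G \<longleftrightarrow> tree_graph S \<and> verts S \<subseteq> verts G \<and> edges S \<subseteq> edges G"

definition single_vertex :: "'v \<Rightarrow> 'v graph" where
  "single_vertex x = \<lparr>verts = {x}, edges = {}\<rparr>"

definition delete_vertex :: "'v graph \<Rightarrow> 'v \<Rightarrow> 'v graph" where
  "delete_vertex G x = \<lparr>verts = verts G - {x}, edges = {e \<in> edges G. x \<notin> e}\<rparr>"

definition delete_edge :: "'v graph \<Rightarrow> 'v set \<Rightarrow> 'v graph" where
  "delete_edge G e = \<lparr>verts = verts G, edges = edges G - {e}\<rparr>"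

definition component_of :: "'v graph \<Rightarrow> 'v \<Rightarrow> 'v graph" where
  "component_of G v =
     \<lparr>verts = {u. \<exists>p. path_between G v p u},
      edges = {e \<in> edges G. e \<subseteq> {u. \<exists>p. path_between G v p u}}\<rparr>"

definition components :: "'v graph \<Rightarrow> 'v graph set" where
  "components G = component_of G ` verts G"

definition cut_edge :: "'v graph \<Rightarrow> 'v set \<Rightarrow> bool" where
  "cut_edge G e \<longleftrightarrow> e \<in> edges G \<and> card (components G) < card (components (delete_edge G e))"

definition suppress_vertex :: "'v graph \<Rightarrow> 'v graph \<Rightarrow> bool" where
  "suppress_vertex G H \<longleftrightarrow>
     (\<exists>v \<in> verts G. \<exists>u w. deg G v = 2 \<and> u \<noteq> w \<and> {u, v} \<in> edges G \<and> {v, w} \<in> edges G \<and>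
        H = \<lparr>verts = verts G - {v}, edges = (edges G - {{u, v}, {v, w}}) \<union> {{u, w}}\<rparr>)"

definition suppresses_to :: "'v graph \<Rightarrow> 'v graph \<Rightarrow> bool" where
  "suppresses_to G H \<longleftrightarrow> suppress_vertex\<^sup>*\<^sup>* G H \<and> (\<forall>v \<in> verts H. deg H v \<noteq> 2)"


section \<open>Phylogenetic networks, trees and forests\<close>

definition phylo_network :: "'v set \<Rightarrow> 'v graph \<Rightarrow> bool" where
  "phylo_network X N \<longleftrightarrow> finite X \<and> X \<noteq> {} \<and> simple_graph N \<and> connected_graph N \<and>
     leaves N = X \<and> (\<forall>v \<in> verts N - leaves N. deg N v = 3)"

definition reticulation_number :: "'v graph \<Rightarrow> int" where
  "reticulation_number N = int (card (edges N)) - (int (card (verts N)) - 1)"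

definition phylo_tree :: "'v set \<Rightarrow> 'v graph \<Rightarrow> bool" where
  "phylo_tree Y T \<longleftrightarrow> phylo_network Y T \<and> acyclic_graph T"

definition phylo_forest :: "'v set \<Rightarrow> 'v graph set \<Rightarrow> bool" where
  "phylo_forest X F \<longleftrightarrow> finite X \<and> X \<noteq> {} \<and> (\<forall>T \<in> F. \<exists>Y. phylo_tree Y T) \<and>
     pairwise (\<lambda>T T'. disjnt (leaves T) (leaves T')) F \<and> (\<Union>T \<in> F. leaves T) = X"

definition phylo_iso :: "'v graph \<Rightarrow> 'v graph \<Rightarrow> bool" where
  "phylo_iso G H \<longleftrightarrow> (\<exists>f. bij_betw f (verts G) (verts H) \<and>
     (\<forall>u \<in> verts G. \<forall>v \<in> verts G. {u, v} \<in> edges G \<longleftrightarrow> {f u, f v} \<in> edges H) \<and>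
     (\<forall>x \<in> leaves G. f x = x))"

text \<open>
  As usual for leaf-labelled trees, only the leaves carry names: what is obtained from the
  subtree of the network is compared with the displayed tree up to an isomorphism that fixes
  every leaf.
\<close>

definition displays_via :: "'v graph \<Rightarrow> 'v graph \<Rightarrow> 'v graph \<Rightarrow> bool" where
  "displays_via N S T \<longleftrightarrow> subtree_of S N \<and> (\<exists>H. suppresses_to S H \<and> phylo_iso H T)"

definition displays_forest :: "'v graph \<Rightarrow> 'v graph set \<Rightarrow> bool" where
  "displays_forest N F \<longleftrightarrow> (\<exists>S. (\<forall>T \<in> F. displays_via N (S T) T) \<and>
     pairwise (\<lambda>T T'. disjnt (verts (S T)) (verts (S T'))) F)"


section \<open>Cherries, pendant subtrees and deletions in forests\<close>

definition cherry :: "'v graph \<Rightarrow> 'v \<Rightarrow> 'v \<Rightarrow> bool" where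
  "cherry T x y \<longleftrightarrow> x \<noteq> y \<and> x \<in> leaves T \<and> y \<in> leaves T \<and>
     ((verts T = {x, y} \<and> edges T = {{x, y}}) \<or>
      (\<exists>v. {x, v} \<in> edges T \<and> {y, v} \<in> edges T))"

definition forest_cherry :: "'v graph set \<Rightarrow> 'v \<Rightarrow> 'v \<Rightarrow> bool" where
  "forest_cherry F x y \<longleftrightarrow> (\<exists>T \<in> F. cherry T x y)"

text \<open>\<open>proper_pendant T e S\<close>: \<open>S\<close> is a proper pendant subtree of \<open>T\<close> and \<open>e\<close> is its edge
  \<open>e\<^sub>S\<close>.\<close>

definition proper_pendant :: "'v graph \<Rightarrow> 'v set \<Rightarrow> 'v graph \<Rightarrow> bool" where
  "proper_pendant T e S \<longleftrightarrow> cut_edge T e \<and> (\<exists>Y. phylo_tree Y S) \<and>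
     (\<exists>C \<in> components (delete_edge T e). suppresses_to C S)"

text \<open>
  Suppression forgets where \<open>S\<close> was attached to \<open>T\<close>: for instance \<open>(((x,y),p),q)\<close> and
  \<open>((x,y),(p,q))\<close> both suppress to the quartet with cherries \<open>(x,y)\<close> and \<open>(p,q)\<close>. The bracket
  notation refers to the position in \<open>T\<close>, so the pairs are also required to be cherries of \<open>T\<close>.
\<close>

definition pendant3 :: "'v graph \<Rightarrow> 'v set \<Rightarrow> 'v \<Rightarrow> 'v \<Rightarrow> 'v \<Rightarrow> bool" where
  "pendant3 T e x y p \<longleftrightarrow> distinct [x, y, p] \<and>
     (\<exists>S. proper_pendant T e S \<and> leaves S = {x, y, p} \<and> cherry S x y) \<and> cherry T x y"

definition pendant4 :: "'v graph \<Rightarrow> 'v set \<Rightarrow> 'v \<Rightarrow> 'v \<Rightarrow> 'v \<Rightarrow> 'v \<Rightarrow> bool" where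
  "pendant4 T e x y p q \<longleftrightarrow> distinct [x, y, p, q] \<and>
     (\<exists>S. proper_pendant T e S \<and> leaves S = {x, y, p, q} \<and> cherry S x y \<and> cherry S p q) \<and>
     cherry T x y \<and> cherry T p q"

definition pendant2 :: "'v graph \<Rightarrow> 'v set \<Rightarrow> 'v \<Rightarrow> 'v \<Rightarrow> bool" where
  "pendant2 T e p q \<longleftrightarrow> p \<noteq> q \<and> (\<exists>S. proper_pendant T e S \<and> leaves S = {p, q})"

text \<open>The tree \<open>T\<close> containing \<open>e\<close> is an explicit argument, since distinct trees of a forest are
  only required to have disjoint leaf sets and may share names of inner vertices.\<close>

definition forest_minus_edge :: "'v graph set \<Rightarrow> 'v graph \<Rightarrow> 'v set \<Rightarrow> 'v graph set" where
  "forest_minus_edge F T e =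
     (F - {T}) \<union> {S. \<exists>C \<in> components (delete_edge T e). suppresses_to C S}"

definition forest_minus_leaf :: "'v graph set \<Rightarrow> 'v \<Rightarrow> 'v graph set" where
  "forest_minus_leaf F x = {T \<in> F. x \<notin> leaves T} \<union>
     {S. \<exists>T \<in> F. x \<in> leaves T \<and> T \<noteq> single_vertex x \<and> suppresses_to (delete_vertex T x) S}"

text \<open>\<open>cuts_leaf_edge F x G\<close>: \<open>G = F - e\<^sub>x\<close>.\<close>

definition cuts_leaf_edge :: "'v graph set \<Rightarrow> 'v \<Rightarrow> 'v graph set \<Rightarrow> bool" where
  "cuts_leaf_edge F x G \<longleftrightarrow> (\<exists>T \<in> F. \<exists>e \<in> edges T. x \<in> leaves T \<and> x \<in> e \<and>
     G = forest_minus_edge F T e)"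


section \<open>Cherry picking sequences\<close>

text \<open>In the step relations, \<open>F\<close>, \<open>F'\<close> are the forests before and \<open>G\<close>, \<open>G'\<close> those after the
  step.\<close>

definition C1 :: "'v \<Rightarrow> 'v graph set \<Rightarrow> 'v graph set \<Rightarrow> 'v graph set \<Rightarrow> 'v graph set \<Rightarrow> bool" where
  "C1 x F F' G G' \<longleftrightarrow> (\<exists>y. forest_cherry F x y \<and> forest_cherry F' x y) \<and>
     G = forest_minus_leaf F x \<and> G' = forest_minus_leaf F' x"

definition C2a :: "'v \<Rightarrow> 'v \<Rightarrow> 'v graph set \<Rightarrow> 'v graph set \<Rightarrow> 'v graph set \<Rightarrow> 'v graph set \<Rightarrow> bool" where
  "C2a x y F F' G G' \<longleftrightarrow> (\<exists>z. z \<noteq> y \<and> forest_cherry F' x z) \<and> G' = F' \<and>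
     ((cuts_leaf_edge F x G \<or> cuts_leaf_edge F y G) \<or>
      (\<exists>T \<in> F. \<exists>e p. pendant3 T e x y p \<and>
         (cuts_leaf_edge F p G \<or> G = forest_minus_edge F T e)) \<or>
      (\<exists>T \<in> F. \<exists>e p q. pendant4 T e x y p q \<and>
         (cuts_leaf_edge F p G \<or> cuts_leaf_edge F q G \<or>
          (\<exists>e'. pendant2 T e' p q \<and> G = forest_minus_edge F T e'))))"

definition C2b :: "'v \<Rightarrow> 'v \<Rightarrow> 'v graph set \<Rightarrow> 'v graph set \<Rightarrow> 'v graph set \<Rightarrow> 'v graph set \<Rightarrow> bool" where
  "C2b x y F F' G G' \<longleftrightarrow> (\<exists>T' \<in> F'. x \<in> leaves T' \<and> y \<in> leaves T' \<and>
     (\<nexists>z. cherry T' x z) \<and> (\<nexists>z. cherry T' y z) \<and>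
     ((G' = F' \<and> (cuts_leaf_edge F x G \<or> cuts_leaf_edge F y G)) \<or>
      (\<exists>e \<in> edges T'. \<exists>v p. {x, v} \<in> edges T' \<and> v \<in> e \<and>
         path_between T' x p y \<and> e \<notin> path_edges p \<and>
         G' = forest_minus_edge F' T' e \<and> G = F)))"

definition C2c :: "'v \<Rightarrow> 'v \<Rightarrow> 'v graph set \<Rightarrow> 'v graph set \<Rightarrow> 'v graph set \<Rightarrow> 'v graph set \<Rightarrow> bool" where
  "C2c x y F F' G G' \<longleftrightarrow>
     (\<exists>T \<in> F'. \<exists>T' \<in> F'. T \<noteq> T' \<and> x \<in> leaves T \<and> y \<in> leaves T') \<and>
     single_vertex x \<notin> F' \<and> single_vertex y \<notin> F' \<and>
     (\<nexists>z. forest_cherry F' x z) \<and> (\<nexists>z. forest_cherry F' y z) \<and>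
     G' = F' \<and> (cuts_leaf_edge F x G \<or> cuts_leaf_edge F y G)"

definition C2_oriented :: "'v \<Rightarrow> 'v graph set \<Rightarrow> 'v graph set \<Rightarrow> 'v graph set \<Rightarrow> 'v graph set \<Rightarrow> bool" where
  "C2_oriented x F F' G G' \<longleftrightarrow>
     (\<exists>y. forest_cherry F x y \<and> (C2a x y F F' G G' \<or> C2b x y F F' G G' \<or> C2c x y F F' G G'))"

definition C2 :: "'v \<Rightarrow> 'v graph set \<Rightarrow> 'v graph set \<Rightarrow> 'v graph set \<Rightarrow> 'v graph set \<Rightarrow> bool" where
  "C2 x F F' G G' \<longleftrightarrow> C2_oriented x F F' G G' \<or> C2_oriented x F' F G' G"

definition C3 :: "'v \<Rightarrow> 'v graph set \<Rightarrow> 'v graph set \<Rightarrow> 'v graph set \<Rightarrow> 'v graph set \<Rightarrow> bool" where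
  "C3 x F F' G G' \<longleftrightarrow> (single_vertex x \<in> F \<or> single_vertex x \<in> F') \<and>
     G = forest_minus_leaf F x \<and> G' = forest_minus_leaf F' x"

definition picking_step :: "'v \<Rightarrow> 'v graph set \<Rightarrow> 'v graph set \<Rightarrow> 'v graph set \<Rightarrow> 'v graph set \<Rightarrow> bool" where
  "picking_step x F F' G G' \<longleftrightarrow>
     (C1 x F F' G G' \<and> \<not> C2 x F F' G G' \<and> \<not> C3 x F F' G G') \<or>
     (\<not> C1 x F F' G G' \<and> C2 x F F' G G' \<and> \<not> C3 x F F' G G') \<or>
     (\<not> C1 x F F' G G' \<and> \<not> C2 x F F' G G' \<and> C3 x F F' G G')"

text \<open>
  Indices are shifted by one: \<open>\<sigma> ! i\<close>, \<open>Fs i\<close>, \<open>Fs' i\<close> with \<open>0 \<le> i < m\<close> are the (\<open>i+1\<close>)-st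
  element and forests of the sequence. The forests are kept as explicit parameters because the
  cost of a step refers to them.
\<close>

definition cherry_picking_sequence ::
  "'v set \<Rightarrow> 'v graph set \<Rightarrow> 'v graph set \<Rightarrow> 'v list \<Rightarrow>
   (nat \<Rightarrow> 'v graph set) \<Rightarrow> (nat \<Rightarrow> 'v graph set) \<Rightarrow> bool" where
  "cherry_picking_sequence X F F' \<sigma> Fs Fs' \<longleftrightarrow>
     set \<sigma> \<subseteq> X \<and> card X \<le> length \<sigma> \<and> 1 \<le> card X \<and>
     (\<forall>i < length \<sigma>. (\<exists>Y. phylo_forest Y (Fs i)) \<and> (\<exists>Y. phylo_forest Y (Fs' i))) \<and>
     Fs 0 = F \<and> Fs' 0 = F' \<and>
     Fs (length \<sigma> - 1) = {single_vertex (last \<sigma>)} \<and>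
     Fs' (length \<sigma> - 1) = {single_vertex (last \<sigma>)} \<and>
     (\<forall>i < length \<sigma> - 1. picking_step (\<sigma> ! i) (Fs i) (Fs' i) (Fs (Suc i)) (Fs' (Suc i)))"

definition step_cost :: "'v \<Rightarrow> 'v graph set \<Rightarrow> 'v graph set \<Rightarrow> 'v graph set \<Rightarrow> 'v graph set \<Rightarrow> nat" where
  "step_cost x F F' G G' = (if C1 x F F' G G' \<or> C3 x F F' G G' then 0 else 1)"

definition weight ::
  "'v list \<Rightarrow> (nat \<Rightarrow> 'v graph set) \<Rightarrow> (nat \<Rightarrow> 'v graph set) \<Rightarrow> nat" where
  "weight \<sigma> Fs Fs' =
     (\<Sum>i < length \<sigma> - 1. step_cost (\<sigma> ! i) (Fs i) (Fs' i) (Fs (Suc i)) (Fs' (Suc i)))"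

end

theory Submission
  imports Defs
begin

text \<open>
  Each tree of the two forests is embedded topologically in the network, the edges of the tree being sent to
  paths. Let \<open>E\<close> and \<open>E'\<close> be the unions of all paths of the two forests. By induction there
  is a sequence whose weight is at most the nullity of \<open>E \<union> E'\<close>, which is at most the
  reticulation number of the network. Steps (C1) and (C3) are free and only shrink the images. When none
  is possible, it suffices to find a step (C2) cutting a tree edge whose path contains an edge that
  is exclusive to one of the two images and is not a bridge of \<open>E \<union> E'\<close>.

  To avoid exclusive bridges one works in a minimal side \<open>W\<close> of such a bridge, and takes there a
  deepest cherry \<open>(x, y)\<close> of the forest that uses the bridge. If the path from \<open>x\<close> to \<open>y\<close> is
  not contained in the other image, \<open>e\<^sub>x\<close> or \<open>e\<^sub>y\<close> can be cut. Otherwise \<open>x\<close> and \<open>y\<close> lie in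
  one tree of the other forest; if they are in no cherry there, that tree branches off the path at a vertex
  where the first does not, and (C2)(b)(ii) applies; if \<open>(x, z)\<close> is a cherry there, both cherries branch
  at the same network vertex and every edge of the first tree leaving the path from \<open>x\<close> to \<open>z\<close> beyond that
  vertex is exclusive. As \<open>(x, y)\<close> was chosen deepest, one of these is among the edges listed in
  (C2)(a)(ii) and (iii).
\<close>

section \<open>Reachability and nullity\<close>

definition reach :: "'v set set \<Rightarrow> 'v \<Rightarrow> 'v \<Rightarrow> bool" where
  "reach E = (\<lambda>a b. {a, b} \<in> E)\<^sup>*\<^sup>*"

lemma reach_refl [simp, intro]: "reach E u u"
  by (simp add: reach_def)

lemma reach_trans: "reach E u v \<Longrightarrow> reach E v w \<Longrightarrow> reach E u w"
  unfolding reach_def by (rule rtranclp_trans)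

lemma reach_step: "reach E u v \<Longrightarrow> {v, w} \<in> E \<Longrightarrow> reach E u w"
  unfolding reach_def by (rule rtranclp.rtrancl_into_rtrancl)

lemma reach_Cons: "{u, v} \<in> E \<Longrightarrow> reach E v w \<Longrightarrow> reach E u w"
  unfolding reach_def by (rule converse_rtranclp_into_rtranclp)

lemma reach_induct [consumes 1, case_names base step]:
  assumes "reach E a b" "P a" "\<And>y z. reach E a y \<Longrightarrow> {y, z} \<in> E \<Longrightarrow> P y \<Longrightarrow> P z"
  shows "P b"
  using assms unfolding reach_def by (rule rtranclp_induct)

lemma reach_cases:
  assumes "reach E a b" "a \<noteq> b"
  obtains y where "{a, y} \<in> E" "reach E y b"
  using assms unfolding reach_def by (auto elim: converse_rtranclpE)

lemma reach_sym: "reach E u v \<Longrightarrow> reach E v u"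
proof (induction rule: reach_induct)
  case (step y z)
  then have "{z, y} \<in> E" by (simp add: insert_commute)
  then show ?case using step.IH by (rule reach_Cons)
qed simp

lemma reach_edge: "{u, v} \<in> E \<Longrightarrow> reach E u v"
  by (blast intro: reach_step)

lemma reach_mono: "reach E u v \<Longrightarrow> E \<subseteq> E' \<Longrightarrow> reach E' u v"
  by (induction rule: reach_induct) (auto intro: reach_step)

lemma reach_closed:
  assumes "reach E u v" "u \<in> A" "\<And>g. g \<in> E \<Longrightarrow> g \<inter> A \<noteq> {} \<Longrightarrow> g \<subseteq> A"
  shows "v \<in> A"
  using assms(1) by (induction rule: reach_induct) (use assms(2,3) in blast)+

lemma reach_insert:
  "reach (insert {a, b} E) u v \<longleftrightarrow>
     reach E u v \<or> (reach E u a \<and> reach E b v) \<or> (reach E u b \<and> reach E a v)"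
proof
  assume "reach (insert {a, b} E) u v"
  then show "reach E u v \<or> (reach E u a \<and> reach E b v) \<or> (reach E u b \<and> reach E a v)"
  proof (induction rule: reach_induct)
    case base
    then show ?case by simp
  next
    case (step y z)
    show ?case
    proof (cases "{y, z} \<in> E")
      case True
      then show ?thesis using step.IH by (meson reach_step)
    next
      case False
      then have "(y = a \<and> z = b) \<or> (y = b \<and> z = a)"
        using step.hyps(2) by (auto simp: doubleton_eq_iff)
      then show ?thesis using step.IH by auto
    qed
  qed
next
  have m: "reach E s t \<Longrightarrow> reach (insert {a, b} E) s t" for s t
    by (erule reach_mono) auto
  have "reach (insert {a, b} E) a b" "reach (insert {a, b} E) b a"
    by (auto intro!: reach_edge simp: insert_commute)
  moreover assume "reach E u v \<or> (reach E u a \<and> reach E b v) \<or> (reach E u b \<and> reach E a v)"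
  ultimately show "reach (insert {a, b} E) u v"
    using m by (meson reach_trans)
qed

definition comp_class :: "'v set \<Rightarrow> 'v set set \<Rightarrow> 'v \<Rightarrow> 'v set" where
  "comp_class V E u = {v \<in> V. reach E u v}"

definition nullity :: "'v set \<Rightarrow> 'v set set \<Rightarrow> int" where
  "nullity V E = int (card E) + int (card (comp_class V E ` V)) - int (card V)"

lemma card_comp_class_insert_le:
  assumes "finite V" "a \<in> V" "b \<in> V"
  shows "card (comp_class V E ` V) \<le> card (comp_class V (insert {a, b} E) ` V) + 1"
proof -
  let ?c = "comp_class V E" and ?d = "comp_class V (insert {a, b} E)"
  have "?c ` V - {?c a, ?c b} \<subseteq> ?d ` V - {?d a}"
  proof
    fix C assume C: "C \<in> ?c ` V - {?c a, ?c b}"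
    then obtain u where u: "u \<in> V" "C = ?c u" by auto
    have eq: "reach E u w \<Longrightarrow> ?c u = ?c w" for w
      unfolding comp_class_def by (auto intro: reach_trans dest: reach_sym)
    have n: "\<not> reach E u a" "\<not> reach E u b" using eq C u(2) by auto
    then have "?d u = C" using u(2) unfolding comp_class_def reach_insert by auto
    moreover have "u \<notin> ?d a"
      using n unfolding comp_class_def reach_insert by (auto dest: reach_sym)
    moreover have "u \<in> ?d u" using u(1) by (simp add: comp_class_def)
    ultimately show "C \<in> ?d ` V - {?d a}" using u(1) by blast
  qed
  then have "card (?c ` V - {?c a, ?c b}) \<le> card (?d ` V - {?d a})"
    using assms(1) by (intro card_mono) auto
  moreover have "card (?d ` V - {?d a}) = card (?d ` V) - 1"
    using assms by (intro card_Diff_singleton) auto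
  moreover have "card (?c ` V) - card {?c a, ?c b} \<le> card (?c ` V - {?c a, ?c b})"
    by (rule diff_card_le_card_Diff) auto
  moreover have "card {?c a, ?c b} \<le> 2" by (simp add: card_insert_if)
  moreover have "card (?d ` V) \<ge> 1" using assms by (metis One_nat_def Suc_leI card_gt_0_iff
      empty_iff finite_imageI image_is_empty)
  ultimately show ?thesis by linarith
qed

lemma nullity_insert_ge:
  assumes "finite V" "finite E" "a \<in> V" "b \<in> V"
  shows "nullity V E \<le> nullity V (insert {a, b} E)"
proof (cases "{a, b} \<in> E")
  case True
  then show ?thesis by (simp add: insert_absorb)
next
  case False
  then show ?thesis
    using card_comp_class_insert_le[OF assms(1,3,4), of E] assms(2) by (simp add: nullity_def)
qed

lemma nullity_mono:
  assumes "finite V" "finite E'" "E \<subseteq> E'" "\<And>e. e \<in> E' \<Longrightarrow> \<exists>a\<in>V. \<exists>b\<in>V. e = {a, b}"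
  shows "nullity V E \<le> nullity V E'"
proof -
  have "finite D \<Longrightarrow> D \<subseteq> E' \<Longrightarrow> nullity V E \<le> nullity V (E \<union> D)" for D
  proof (induction rule: finite_induct)
    case (insert d D)
    then obtain a b where "a \<in> V" "b \<in> V" "d = {a, b}" using assms(4) by blast
    moreover have "finite (E \<union> D)" using assms(2,3) insert.hyps by (meson finite_UnI finite_subset)
    ultimately have "nullity V (E \<union> D) \<le> nullity V (insert d (E \<union> D))"
      using nullity_insert_ge[OF assms(1)] by auto
    then show ?case using insert by simp
  qed simp
  then show ?thesis using assms(2,3) by (metis Un_absorb1 order_refl)
qed

lemma nullity_remove_cyclic_edge:
  assumes "finite E" "{u, v} \<in> E" "reach (E - {{u, v}}) u v"
  shows "nullity V (E - {{u, v}}) + 1 = nullity V E"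
proof -
  have "reach (insert {u, v} (E - {{u, v}})) = reach (E - {{u, v}})"
  proof (intro ext)
    fix s t
    show "reach (insert {u, v} (E - {{u, v}})) s t = reach (E - {{u, v}}) s t"
      unfolding reach_insert using assms(3) reach_sym[OF assms(3)] by (meson reach_trans)
  qed
  then have "comp_class V E = comp_class V (E - {{u, v}})"
    using assms(2) by (intro ext) (simp add: comp_class_def insert_absorb)
  moreover have "card E > 0" using assms by (auto simp: card_gt_0_iff)
  ultimately show ?thesis using assms by (simp add: nullity_def)
qed

lemma nullity_empty: "finite V \<Longrightarrow> nullity V {} = 0"
proof -
  have "reach {} u v \<longleftrightarrow> u = v" for u v :: 'a
    by (auto elim: reach_cases[of "{}"])
  then have "comp_class V {} u = {u}" if "u \<in> V" for u
    using that by (auto simp: comp_class_def)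
  then have "card (comp_class V {} ` V) = card V"
    by (intro card_image) (auto simp: inj_on_def)
  then show ?thesis by (simp add: nullity_def)
qed

lemma nullity_nonneg:
  assumes "finite V" "finite E" "\<And>e. e \<in> E \<Longrightarrow> \<exists>a\<in>V. \<exists>b\<in>V. e = {a, b}"
  shows "nullity V E \<ge> 0"
  using nullity_mono[OF assms(1,2), of "{}"] assms(3) nullity_empty[OF assms(1)] by auto

lemma nullity_connected:
  assumes "V \<noteq> {}" "\<And>u v. u \<in> V \<Longrightarrow> v \<in> V \<Longrightarrow> reach E u v"
  shows "nullity V E = int (card E) - (int (card V) - 1)"
proof -
  have "comp_class V E ` V = {V}" using assms by (auto simp: comp_class_def)
  then show ?thesis by (simp add: nullity_def)
qed

section \<open>Paths and reachability\<close>

lemma successively_imp_reach: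
  "successively (\<lambda>u v. {u, v} \<in> E) p \<Longrightarrow> p \<noteq> [] \<Longrightarrow> reach E (hd p) (last p)"
  by (induction p rule: induct_list012) (auto intro: reach_Cons)

lemma path_between_imp_reach: "path_between G u p v \<Longrightarrow> reach (edges G) u v"
  using successively_imp_reach by (auto simp: path_between_def is_path_def)

lemma reach_imp_path:
  assumes "reach E u v" "u \<in> verts G" "\<And>e. e \<in> E \<Longrightarrow> e \<subseteq> verts G" "E \<subseteq> edges G"
  shows "\<exists>p. path_between G u p v \<and> successively (\<lambda>u v. {u, v} \<in> E) p"
  using assms(1)
proof (induction rule: reach_induct)
  case base
  then show ?case using assms(2)
    by (intro exI[of _ "[u]"]) (auto simp: path_between_def is_path_def)
next
  case (step y z)
  then obtain p where p: "path_between G u p y" "successively (\<lambda>u v. {u, v} \<in> E) p" by blast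
  show ?case
  proof (cases "z \<in> set p")
    case True
    then obtain q r where qr: "p = q @ z # r" by (meson split_list)
    have "hd (q @ [z]) = hd p" by (cases q) (auto simp: qr)
    moreover have "successively R (q @ [z])" if "successively R p" for R
      using that unfolding qr by (simp add: successively_append_iff)
    ultimately have "path_between G u (q @ [z]) z" "successively (\<lambda>u v. {u, v} \<in> E) (q @ [z])"
      using p by (simp_all add: path_between_def is_path_def qr)
    then show ?thesis by blast
  next
    case False
    have "z \<in> verts G" using step.hyps(2) assms(3) by blast
    then have "path_between G u (p @ [z]) z" "successively (\<lambda>u v. {u, v} \<in> E) (p @ [z])"
      using p step.hyps(2) subsetD[OF assms(4) step.hyps(2)] False
      by (simp_all add: path_between_def is_path_def successively_append_iff)
    then show ?thesis by blast
  qed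
qed

lemma ex_path_between_iff:
  assumes "\<And>e. e \<in> edges G \<Longrightarrow> e \<subseteq> verts G" "u \<in> verts G"
  shows "(\<exists>p. path_between G u p v) \<longleftrightarrow> reach (edges G) u v"
proof
  assume "reach (edges G) u v"
  from reach_imp_path[OF this assms(2,1)] show "\<exists>p. path_between G u p v" by blast
qed (auto dest: path_between_imp_reach)

lemma connected_graph_iff:
  assumes "simple_graph G"
  shows "connected_graph G \<longleftrightarrow> verts G \<noteq> {} \<and> (\<forall>u\<in>verts G. \<forall>v\<in>verts G. reach (edges G) u v)"
proof -
  have "(\<exists>p. path_between G u p v) \<longleftrightarrow> reach (edges G) u v" if "u \<in> verts G" for u v
    using that assms by (intro ex_path_between_iff) (auto simp: simple_graph_def)
  then show ?thesis by (simp add: connected_graph_def)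
qed

lemma path_edges_subset:
  "successively (\<lambda>u v. {u, v} \<in> E) p \<Longrightarrow> path_edges p \<subseteq> E"
  by (auto simp: path_edges_def successively_conv_nth)

lemma acyclic_graph_iff:
  assumes "simple_graph G"
  shows "acyclic_graph G \<longleftrightarrow> (\<forall>u v. {u, v} \<in> edges G \<longrightarrow> \<not> reach (edges G - {{u, v}}) u v)"
proof
  assume ac: "acyclic_graph G"
  show "\<forall>u v. {u, v} \<in> edges G \<longrightarrow> \<not> reach (edges G - {{u, v}}) u v"
  proof (intro allI impI notI)
    fix u v assume e: "{u, v} \<in> edges G" and r: "reach (edges G - {{u, v}}) u v"
    have uv: "u \<noteq> v" "u \<in> verts G" using e assms by (auto simp: simple_graph_def)
    obtain p where p: "path_between G u p v"
      "successively (\<lambda>a b. {a, b} \<in> edges G - {{u, v}}) p"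
      using reach_imp_path[OF r uv(2)] assms unfolding simple_graph_def by blast
    have "3 \<le> length p"
    proof (rule ccontr)
      assume "\<not> 3 \<le> length p"
      then consider "p = []" | a where "p = [a]" | a b where "p = [a, b]"
        by (cases p rule: remdups_adj.cases) (auto simp: numeral_eq_Suc not_le less_Suc_eq)
      then show False using p uv(1) by cases (auto simp: path_between_def is_path_def)
    qed
    moreover have "{last p, hd p} \<in> edges G"
      using p(1) e by (auto simp: path_between_def insert_commute)
    ultimately show False using ac p(1) unfolding acyclic_graph_def path_between_def by blast
  qed
next
  assume br: "\<forall>u v. {u, v} \<in> edges G \<longrightarrow> \<not> reach (edges G - {{u, v}}) u v"
  show "acyclic_graph G"
    unfolding acyclic_graph_def
  proof
    assume "\<exists>p. is_path G p \<and> 3 \<le> length p \<and> {last p, hd p} \<in> edges G"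
    then obtain p where p: "is_path G p" "3 \<le> length p" "{last p, hd p} \<in> edges G" by blast
    have ne: "p \<noteq> []" using p(2) by auto
    have "{p ! i, p ! Suc i} \<noteq> {last p, hd p}" if "Suc i < length p" for i
    proof
      assume "{p ! i, p ! Suc i} = {last p, hd p}"
      then have "(p ! i = p ! (length p - 1) \<and> p ! Suc i = p ! 0) \<or>
                 (p ! i = p ! 0 \<and> p ! Suc i = p ! (length p - 1))"
        using ne by (auto simp: doubleton_eq_iff last_conv_nth hd_conv_nth)
      moreover have "distinct p" using p(1) by (simp add: is_path_def)
      ultimately show False using that p(2) ne by (auto simp: nth_eq_iff_index_eq)
    qed
    then have "successively (\<lambda>u v. {u, v} \<in> edges G - {{hd p, last p}}) p"
      using p(1) unfolding is_path_def successively_conv_nth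
      by (simp add: insert_commute[of "hd p" "last p"])
    from successively_imp_reach[OF this ne] br p(3) show False
      by (simp add: insert_commute[of "last p" "hd p"])
  qed
qed

section \<open>Trees, suppression and sides of edges\<close>

lemma reach_subst:
  assumes "reach E a b" "\<And>y z. {y, z} \<in> E \<Longrightarrow> reach E' y z"
  shows "reach E' a b"
  using assms(1)
  by (induction rule: reach_induct) (auto dest: assms(2) intro: reach_trans)

lemma tree_graph_iff:
  "tree_graph G \<longleftrightarrow> simple_graph G \<and> verts G \<noteq> {} \<and>
     (\<forall>u\<in>verts G. \<forall>v\<in>verts G. reach (edges G) u v) \<and>
     (\<forall>u v. {u, v} \<in> edges G \<longrightarrow> \<not> reach (edges G - {{u, v}}) u v)"
  unfolding tree_graph_def using connected_graph_iff acyclic_graph_iff by blast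

lemma simple_graph_finite_edges: "simple_graph G \<Longrightarrow> finite (edges G)"
  unfolding simple_graph_def by (meson Pow_iff finite_Pow_iff finite_subset subsetI)

lemma simple_graph_edge:
  assumes "simple_graph G" "{u, v} \<in> edges G"
  shows "u \<in> verts G" "v \<in> verts G" "u \<noteq> v"
  using assms by (auto simp: simple_graph_def)

lemma simple_graph_edgeE:
  assumes "simple_graph G" "e \<in> edges G"
  obtains u v where "e = {u, v}" "u \<noteq> v" "u \<in> verts G" "v \<in> verts G"
  using assms unfolding simple_graph_def by (metis card_2_iff insert_subset)

lemma simple_graph_edge_at:
  assumes "simple_graph G" "e \<in> edges G" "u \<in> e"
  obtains v where "e = {u, v}" "u \<noteq> v" "v \<in> verts G"
proof -
  obtain a b where "e = {a, b}" "a \<noteq> b" "a \<in> verts G" "b \<in> verts G"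
    using simple_graph_edgeE[OF assms(1,2)] .
  then show ?thesis using assms(3) that[of b] that[of a] by (auto simp: insert_commute)
qed

locale suppression =
  fixes G H :: "'v graph" and u v w :: 'v
  assumes tree: "tree_graph G"
    and v: "v \<in> verts G" "deg G v = 2" and uw: "u \<noteq> w"
    and e1: "{u, v} \<in> edges G" and e2: "{v, w} \<in> edges G"
    and H: "H = \<lparr>verts = verts G - {v}, edges = (edges G - {{u, v}, {v, w}}) \<union> {{u, w}}\<rparr>"
begin

lemma simple: "simple_graph G"
  using tree by (simp add: tree_graph_iff)

lemma neq: "u \<noteq> v" "w \<noteq> v" "u \<in> verts G" "w \<in> verts G"
  using simple_graph_edge[OF simple e1] simple_graph_edge[OF simple e2] by auto

lemma neq12: "{u, v} \<noteq> {v, w}"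
  using uw neq by (auto simp: doubleton_eq_iff)

lemma bridge: "{a, b} \<in> edges G \<Longrightarrow> \<not> reach (edges G - {{a, b}}) a b"
  using tree by (simp add: tree_graph_iff)

lemma star: "e \<in> edges G \<Longrightarrow> v \<in> e \<Longrightarrow> e = {u, v} \<or> e = {v, w}"
proof -
  have "{{u, v}, {v, w}} = {e \<in> edges G. v \<in> e}"
    using e1 e2 neq12 v(2) simple_graph_finite_edges[OF simple]
    by (intro card_subset_eq) (auto simp: deg_def)
  then show "e \<in> edges G \<Longrightarrow> v \<in> e \<Longrightarrow> e = {u, v} \<or> e = {v, w}" by blast
qed

lemma new_edge: "{u, w} \<notin> edges G"
proof
  assume a: "{u, w} \<in> edges G"
  then have "reach (edges G - {{u, v}}) u w" using neq by (intro reach_edge) (auto simp: doubleton_eq_iff)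
  moreover have "reach (edges G - {{u, v}}) w v"
    using e2 neq12 by (intro reach_edge) (auto simp: insert_commute)
  ultimately show False using bridge[OF e1] by (meson reach_trans)
qed

lemma simple_H: "simple_graph H"
proof -
  have "e \<subseteq> verts G - {v} \<and> card e = 2" if "e \<in> edges H" for e
  proof (cases "e = {u, w}")
    case True
    then show ?thesis using neq uw by auto
  next
    case False
    then have "e \<in> edges G" "v \<notin> e" using that star by (auto simp: H)
    then show ?thesis using simple by (auto simp: simple_graph_def)
  qed
  then show ?thesis using simple by (auto simp: simple_graph_def H)
qed

lemma connected_H:
  assumes "a \<in> verts H" "b \<in> verts H"
  shows "reach (edges H) a b"
proof -
  define r where "r n = (if n = v then u else n)" for n
  have "reach (edges H) (r s) (r t)" if "reach (edges G) s t" for s t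
    using that
  proof (induction rule: reach_induct)
    case (step y z)
    have "reach (edges H) (r y) (r z)"
    proof (cases "{y, z} = {u, v} \<or> {y, z} = {v, w}")
      case True
      then consider "y = u" "z = v" | "y = v" "z = u" | "y = v" "z = w" | "y = w" "z = v"
        by (auto simp: doubleton_eq_iff)
      then show ?thesis
      proof cases
        case 3
        then show ?thesis using neq by (auto intro!: reach_edge simp: r_def H)
      next
        case 4
        then show ?thesis using neq by (auto intro!: reach_edge simp: r_def H insert_commute)
      qed (use neq in \<open>auto simp: r_def\<close>)
    next
      case False
      then have "y \<noteq> v" "z \<noteq> v" using star[of "{y, z}"] step.hyps(2) by auto
      then show ?thesis using False step.hyps(2) by (auto intro!: reach_edge simp: r_def H)
    qed
    then show ?case using step.IH by (meson reach_trans)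
  qed simp
  moreover have "reach (edges G) a b" using tree assms by (auto simp: tree_graph_iff H)
  ultimately have "reach (edges H) (r a) (r b)" by blast
  then show ?thesis using assms by (simp add: r_def H)
qed

lemma bridge_H:
  assumes "{a, b} \<in> edges H"
  shows "\<not> reach (edges H - {{a, b}}) a b"
proof
  assume r: "reach (edges H - {{a, b}}) a b"
  show False
  proof (cases "{a, b} = {u, w}")
    case True
    then have "a = u \<and> b = w \<or> a = w \<and> b = u" by (auto simp: doubleton_eq_iff)
    then have "reach (edges H - {{u, w}}) u w"
      using r reach_sym[OF r] by (auto simp: insert_commute)
    then have "reach (edges G - {{u, v}}) u w" by (rule reach_mono) (auto simp: H)
    moreover have "reach (edges G - {{u, v}}) w v"
      using e2 neq12 by (intro reach_edge) (auto simp: insert_commute)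
    ultimately show False using bridge[OF e1] by (meson reach_trans)
  next
    case False
    then have ab: "{a, b} \<in> edges G" "{a, b} \<noteq> {u, v}" "{a, b} \<noteq> {v, w}"
      using assms by (auto simp: H)
    have u1: "reach (edges G - {{a, b}}) u w" "reach (edges G - {{a, b}}) w u"
    proof -
      have "reach (edges G - {{a, b}}) u v" "reach (edges G - {{a, b}}) v w"
        using e1 e2 ab by (auto intro!: reach_edge)
      then show "reach (edges G - {{a, b}}) u w" by (meson reach_trans)
      then show "reach (edges G - {{a, b}}) w u" by (rule reach_sym)
    qed
    have "reach (edges G - {{a, b}}) a b"
    proof (rule reach_subst[OF r])
      fix y z assume yz: "{y, z} \<in> edges H - {{a, b}}"
      show "reach (edges G - {{a, b}}) y z"
      proof (cases "{y, z} = {u, w}")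
        case True
        then show ?thesis using u1 by (auto simp: doubleton_eq_iff)
      next
        case False
        then show ?thesis using yz by (intro reach_edge) (auto simp: H)
      qed
    qed
    then show False using bridge[OF ab(1)] by blast
  qed
qed

lemma tree_H: "tree_graph H"
  using simple_H connected_H bridge_H neq by (auto simp: tree_graph_iff H)

lemma deg_H: assumes "n \<in> verts H" shows "deg H n = deg G n"
proof -
  have nv: "n \<noteq> v" using assms by (simp add: H)
  have fin: "finite {e \<in> edges G. n \<in> e}" using simple_graph_finite_edges[OF simple] by simp
  consider "n = u" | "n = w" | "n \<noteq> u" "n \<noteq> w" by blast
  then show ?thesis
  proof cases
    case 1
    then have "{e \<in> edges H. n \<in> e} = insert {u, w} ({e \<in> edges G. n \<in> e} - {{u, v}})"
      using neq uw by (auto simp: H)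
    moreover have "card {e \<in> edges G. n \<in> e} = Suc (card ({e \<in> edges G. n \<in> e} - {{u, v}}))"
      using 1 e1 fin by (intro card.remove) auto
    ultimately show ?thesis using fin new_edge by (simp add: deg_def)
  next
    case 2
    then have "{e \<in> edges H. n \<in> e} = insert {u, w} ({e \<in> edges G. n \<in> e} - {{v, w}})"
      using neq uw by (auto simp: H)
    moreover have "card {e \<in> edges G. n \<in> e} = Suc (card ({e \<in> edges G. n \<in> e} - {{v, w}}))"
      using 2 e2 fin by (intro card.remove) auto
    ultimately show ?thesis using fin new_edge by (simp add: deg_def)
  next
    case 3
    then have "{e \<in> edges H. n \<in> e} = {e \<in> edges G. n \<in> e}" using nv by (auto simp: H)
    then show ?thesis by (simp add: deg_def)
  qed
qed

lemma verts_H: "verts H = verts G - {v}"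
  by (simp add: H)

lemma leaves_H: "leaves H = leaves G"
proof (rule set_eqI)
  fix n
  show "n \<in> leaves H \<longleftrightarrow> n \<in> leaves G"
  proof (cases "n \<in> verts H")
    case True
    then show ?thesis using deg_H[OF True] verts_H by (simp add: leaves_def)
  next
    case False
    then have "n \<notin> verts G \<or> n = v" using verts_H by simp
    then show ?thesis using False v(2) by (auto simp: leaves_def)
  qed
qed

end

lemma suppress_vertexE:
  assumes "suppress_vertex G H" "tree_graph G"
  obtains u v w where "suppression G H u v w"
proof -
  obtain v u w where "v \<in> verts G" "deg G v = 2" "u \<noteq> w" "{u, v} \<in> edges G" "{v, w} \<in> edges G"
    "H = \<lparr>verts = verts G - {v}, edges = (edges G - {{u, v}, {v, w}}) \<union> {{u, w}}\<rparr>"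
    using assms(1) unfolding suppress_vertex_def by (elim bexE exE conjE)
  with assms(2) have "suppression G H u v w" by (intro suppression.intro)
  then show ?thesis by (rule that)
qed

definition side :: "'v graph \<Rightarrow> 'v \<Rightarrow> 'v \<Rightarrow> 'v set" where
  "side T t s = {n. reach (edges T - {{s, t}}) s n}"

locale ptree =
  fixes Y :: "'v set" and T :: "'v graph"
  assumes pt: "phylo_tree Y T"
begin

lemma simple: "simple_graph T"
  using pt by (simp add: phylo_tree_def phylo_network_def)

lemma tree: "tree_graph T"
  using pt by (simp add: phylo_tree_def phylo_network_def tree_graph_def)

lemma finite_verts: "finite (verts T)"
  using simple by (simp add: simple_graph_def)

lemma finite_edges: "finite (edges T)"
  using simple by (rule simple_graph_finite_edges)

lemmas edge = simple_graph_edge[OF simple]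
lemmas edgeE = simple_graph_edgeE[OF simple]
lemmas edge_at = simple_graph_edge_at[OF simple]

lemma connected: "u \<in> verts T \<Longrightarrow> v \<in> verts T \<Longrightarrow> reach (edges T) u v"
  using tree by (simp add: tree_graph_iff)

lemma bridge: "{u, v} \<in> edges T \<Longrightarrow> \<not> reach (edges T - {{u, v}}) u v"
  using tree by (simp add: tree_graph_iff)

lemma leaves: "leaves T = Y"
  using pt by (simp add: phylo_tree_def phylo_network_def)

lemma Y_verts: "x \<in> Y \<Longrightarrow> x \<in> verts T"
  using leaves by (auto simp: leaves_def)

lemma Y_ne: "Y \<noteq> {}"
  using pt by (simp add: phylo_tree_def phylo_network_def)

lemma deg_inner: "v \<in> verts T \<Longrightarrow> v \<notin> Y \<Longrightarrow> deg T v = 3"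
  using pt leaves by (auto simp: phylo_tree_def phylo_network_def)

lemma deg_leaf: "x \<in> Y \<Longrightarrow> deg T x \<le> 1"
  using leaves by (auto simp: leaves_def)

lemma leaf_edge_unique:
  assumes "x \<in> Y" "e \<in> edges T" "f \<in> edges T" "x \<in> e" "x \<in> f"
  shows "e = f"
proof -
  have "finite {e \<in> edges T. x \<in> e}" "card {e \<in> edges T. x \<in> e} \<le> Suc 0"
    using finite_edges deg_leaf[OF assms(1)] by (simp_all add: deg_def)
  then have "\<forall>a\<in>{e \<in> edges T. x \<in> e}. \<forall>b\<in>{e \<in> edges T. x \<in> e}. a = b"
    by (rule iffD1[OF card_le_Suc0_iff_eq])
  from bspec[OF bspec[OF this, of e], of f] show ?thesis using assms(2-5) by blast
qed

lemma leaf_edge_ex: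
  assumes "x \<in> Y" "T \<noteq> single_vertex x"
  obtains v where "{x, v} \<in> edges T"
proof -
  have "\<exists>w \<in> verts T. w \<noteq> x"
  proof (rule ccontr)
    assume "\<not> ?thesis"
    then have V: "verts T = {x}" using Y_verts[OF assms(1)] by blast
    have "e \<notin> edges T" for e
    proof
      assume "e \<in> edges T"
      then obtain u v where "u \<noteq> v" "u \<in> verts T" "v \<in> verts T" by (rule edgeE)
      then show False using V by simp
    qed
    then have "edges T = {}" by blast
    then show False using V assms(2) by (simp add: single_vertex_def)
  qed
  then obtain w where w: "w \<in> verts T" "w \<noteq> x" by blast
  have "reach (edges T) x w" using connected Y_verts[OF assms(1)] w(1) by blast
  then show ?thesis using w(2) that by (auto elim: reach_cases)
qed

lemma inner_star:
  assumes "v \<notin> Y" "{v, t} \<in> edges T"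
  obtains s1 s2 where "s1 \<noteq> s2" "s1 \<noteq> t" "s2 \<noteq> t"
    "{e \<in> edges T. v \<in> e} = {{v, t}, {v, s1}, {v, s2}}"
proof -
  have "card {e \<in> edges T. v \<in> e} = 3"
    using deg_inner assms edge(1) by (simp add: deg_def)
  then have "card ({e \<in> edges T. v \<in> e} - {{v, t}}) = 2"
    using assms(2) by (subst card_Diff_singleton) auto
  then obtain f g where fg: "{e \<in> edges T. v \<in> e} - {{v, t}} = {f, g}" "f \<noteq> g"
    by (auto simp: card_2_iff)
  then have "f \<in> edges T" "v \<in> f" "g \<in> edges T" "v \<in> g" "f \<noteq> {v, t}" "g \<noteq> {v, t}" by blast+
  obtain s1 where s1: "f = {v, s1}" using edge_at[OF \<open>f \<in> edges T\<close> \<open>v \<in> f\<close>] .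
  obtain s2 where s2: "g = {v, s2}" using edge_at[OF \<open>g \<in> edges T\<close> \<open>v \<in> g\<close>] .
  have "{e \<in> edges T. v \<in> e} = {{v, t}, f, g}" using fg assms(2) by blast
  then have "{e \<in> edges T. v \<in> e} = {{v, t}, {v, s1}, {v, s2}}" by (simp only: s1 s2)
  then show ?thesis
    using that[of s1 s2] fg(2) \<open>f \<noteq> {v, t}\<close> \<open>g \<noteq> {v, t}\<close> s1 s2 by blast
qed

lemma inner_star3:
  assumes "v \<notin> Y" "{v, a} \<in> edges T" "{v, b} \<in> edges T" "{v, c} \<in> edges T" "a \<noteq> b" "a \<noteq> c" "b \<noteq> c"
  shows "{e \<in> edges T. v \<in> e} = {{v, a}, {v, b}, {v, c}}"
proof -
  have "card {e \<in> edges T. v \<in> e} = 3"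
    using deg_inner assms edge(1) by (simp add: deg_def)
  moreover have "card {{v, a}, {v, b}, {v, c}} = 3"
    using assms by (simp add: doubleton_eq_iff)
  moreover have "{{v, a}, {v, b}, {v, c}} \<subseteq> {e \<in> edges T. v \<in> e}" using assms by simp
  moreover have "finite {e \<in> edges T. v \<in> e}" using finite_edges by simp
  ultimately show ?thesis by (metis card_subset_eq)
qed

lemma two_edges_inner:
  assumes "{v, a} \<in> edges T" "{v, b} \<in> edges T" "a \<noteq> b"
  shows "v \<notin> Y"
  using leaf_edge_unique[OF _ assms(1,2)] assms(3) by (auto simp: doubleton_eq_iff)

lemma side_self: "s \<in> side T t s"
  by (simp add: side_def)

lemma side_closed:
  assumes "g \<in> edges T" "g \<noteq> {s, t}" "g \<inter> side T t s \<noteq> {}"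
  shows "g \<subseteq> side T t s"
proof -
  obtain m where m: "m \<in> g" "m \<in> side T t s" using assms(3) by blast
  obtain n where "g = {m, n}" using edge_at[OF assms(1) m(1)] .
  then have g: "g = {m, n}" "m \<in> side T t s" using m by auto
  have "reach (edges T - {{s, t}}) s n"
    using g assms(1,2) by (auto simp: side_def intro: reach_step)
  then show ?thesis using g by (simp add: side_def)
qed

lemma side_subset: "s \<in> verts T \<Longrightarrow> side T t s \<subseteq> verts T"
proof
  fix n assume s: "s \<in> verts T" and "n \<in> side T t s"
  then have "reach (edges T - {{s, t}}) s n" by (simp add: side_def)
  then show "n \<in> verts T"
    by (rule reach_closed) (use s simple in \<open>auto simp: simple_graph_def\<close>)
qed

lemma side_not: "{s, t} \<in> edges T \<Longrightarrow> t \<notin> side T t s"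
  using bridge by (simp add: side_def)

lemma side_disjoint: "{s, t} \<in> edges T \<Longrightarrow> side T t s \<inter> side T s t = {}"
proof -
  assume st: "{s, t} \<in> edges T"
  have "False" if "n \<in> side T t s" "n \<in> side T s t" for n
  proof -
    have "reach (edges T - {{s, t}}) s n" "reach (edges T - {{s, t}}) t n"
      using that by (auto simp: side_def insert_commute)
    then show False using bridge[OF st] by (meson reach_sym reach_trans)
  qed
  then show ?thesis by blast
qed

lemma side_union: 
  assumes "{s, t} \<in> edges T"
  shows "side T t s \<union> side T s t = verts T"
proof
  show "side T t s \<union> side T s t \<subseteq> verts T" using side_subset edge[OF assms] by auto
  show "verts T \<subseteq> side T t s \<union> side T s t"
  proof
    fix n assume "n \<in> verts T"
    then have "reach (edges T) s n" using connected edge[OF assms] by blast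
    then have "reach (insert {s, t} (edges T - {{s, t}})) s n"
      using assms by (simp add: insert_absorb)
    then show "n \<in> side T t s \<union> side T s t"
      unfolding reach_insert by (auto simp: side_def insert_commute)
  qed
qed

lemma side_mono:
  assumes "{s, t} \<in> edges T" "{s, s1} \<in> edges T" "s1 \<noteq> t"
  shows "side T s s1 \<subset> side T t s"
proof -
  have s: "s \<notin> side T s s1" using side_not[of s1 s] assms(2) by (simp add: insert_commute)
  have "n \<in> side T t s" if "n \<in> side T s s1" for n
  proof -
    have "reach (edges T - {{s1, s}}) s1 n" using that by (simp add: side_def)
    then have "n \<in> side T t s \<inter> side T s s1"
    proof (induction rule: reach_induct)
      case base
      have "s1 \<in> side T t s"
        using side_closed[of "{s, s1}" s t] assms side_self by (auto simp: doubleton_eq_iff)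
      then show ?case using side_self by blast
    next
      case (step y z)
      have "{y, z} \<noteq> {s, t}"
      proof
        assume "{y, z} = {s, t}"
        then have "y = t" using step.IH s by (auto simp: doubleton_eq_iff)
        then show False using step.IH side_not[OF assms(1)] by blast
      qed
      then have "z \<in> side T t s" using side_closed[of "{y, z}" s t] step by auto
      moreover have "z \<in> side T s s1" using side_closed[of "{y, z}" s1 s] step by auto
      ultimately show ?case by blast
    qed
    then show ?thesis by blast
  qed
  then show ?thesis using s side_self by blast
qed

text \<open>\<open>cherry_below t s v x y\<close>: the leaves \<open>x\<close>, \<open>y\<close> below \<open>v\<close> form a cherry on the \<open>s\<close>-side of the
  edge \<open>{s, t}\<close>; \<open>uncle_below\<close> describes the vertex \<open>a\<close> above \<open>v\<close>, the root \<open>c\<close> of the other subtree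
  below \<open>a\<close> (a leaf or the root of a cherry), and the vertex \<open>d\<close> above \<open>a\<close>.\<close>

definition cherry_below :: "'v \<Rightarrow> 'v \<Rightarrow> 'v \<Rightarrow> 'v \<Rightarrow> 'v \<Rightarrow> bool" where
  "cherry_below t s v x y \<longleftrightarrow> x \<noteq> y \<and> x \<in> Y \<and> y \<in> Y \<and> {v, x} \<in> edges T \<and> {v, y} \<in> edges T \<and>
     {v, x, y} \<subseteq> side T t s \<and> x \<noteq> t \<and> y \<noteq> t"

definition uncle_below :: "'v \<Rightarrow> 'v \<Rightarrow> 'v \<Rightarrow> 'v \<Rightarrow> 'v \<Rightarrow> 'v \<Rightarrow> 'v \<Rightarrow> 'v \<Rightarrow> bool" where
  "uncle_below t s v x y a c d \<longleftrightarrow> {a, c} \<subseteq> side T t s \<and>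
     {a, v} \<in> edges T \<and> {a, c} \<in> edges T \<and> {a, d} \<in> edges T \<and>
     v \<noteq> c \<and> v \<noteq> d \<and> c \<noteq> d \<and> a \<noteq> x \<and> a \<noteq> y \<and>
     (c \<in> Y \<or> (\<exists>p q. p \<noteq> q \<and> p \<in> Y \<and> q \<in> Y \<and> p \<noteq> a \<and> q \<noteq> a \<and> {p, q} \<subseteq> side T t s \<and>
        {c, p} \<in> edges T \<and> {c, q} \<in> edges T)) \<and>
     (a = s \<and> d = t \<or> {a, d} \<noteq> {s, t})"

lemma deep_cherry:
  assumes "{s, t} \<in> edges T" "s \<notin> Y"
  shows "\<exists>v x y. cherry_below t s v x y \<and> (v = s \<or> (\<exists>a c d. uncle_below t s v x y a c d))"
  using assms
proof (induction "card (side T t s)" arbitrary: t s rule: less_induct)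
  case less
  obtain s1 s2 where st: "s1 \<noteq> s2" "s1 \<noteq> t" "s2 \<noteq> t"
    "{e \<in> edges T. s \<in> e} = {{s, t}, {s, s1}, {s, s2}}"
    using inner_star[OF less.prems(2,1)] .
  have e: "{s, s1} \<in> edges T" "{s, s2} \<in> edges T" using st by auto
  have finside: "finite (side T t s)"
    using side_subset edge(1)[OF less.prems(1)] finite_verts by (meson finite_subset)
  have sub: "side T s s1 \<subset> side T t s" "side T s s2 \<subset> side T t s"
    using side_mono[OF less.prems(1)] e st by auto
  have sin: "s \<in> side T t s" "s1 \<in> side T t s" "s2 \<in> side T t s" using sub side_self by blast+
  have tnot: "t \<notin> side T t s" using side_not[OF less.prems(1)] .
  have lift: "(\<exists>v x y. cherry_below t s v x y \<and> (\<exists>a c d. uncle_below t s v x y a c d)) \<or>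
     (\<exists>x y. cherry_below t s si x y \<and> x \<noteq> s \<and> y \<noteq> s)"
    if si: "si = s1 \<or> si = s2" "si \<notin> Y" for si
  proof -
    have esi: "{si, s} \<in> edges T" using si(1) e by (auto simp: insert_commute)
    have subi: "side T s si \<subset> side T t s" using si(1) sub by auto
    have "card (side T s si) < card (side T t s)" using psubset_card_mono[OF finside subi] .
    from less.hyps[OF this esi si(2)] obtain v x y where
      vxy: "cherry_below s si v x y" "v = si \<or> (\<exists>a c d. uncle_below s si v x y a c d)" by blast
    have b: "cherry_below t s v x y" using vxy(1) subi tnot unfolding cherry_below_def by blast
    have "uncle_below t s v x y a c d" if up: "uncle_below s si v x y a c d" for a c d
    proof -
      have "{a, d} \<noteq> {s, t}"
      proof
        assume "{a, d} = {s, t}"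
        then have "a = s \<or> a = t" by (auto simp: doubleton_eq_iff)
        moreover have "a \<in> side T s si" using up unfolding uncle_below_def by blast
        moreover have "s \<notin> side T s si" using side_not[OF esi] .
        ultimately show False using subi tnot by blast
      qed
      moreover have "{a, c} \<subseteq> side T t s" "{a, v} \<in> edges T \<and> {a, c} \<in> edges T \<and> {a, d} \<in> edges T \<and>
          v \<noteq> c \<and> v \<noteq> d \<and> c \<noteq> d \<and> a \<noteq> x \<and> a \<noteq> y"
        using up subi unfolding uncle_below_def by auto
      moreover have "c \<in> Y \<or> (\<exists>p q. p \<noteq> q \<and> p \<in> Y \<and> q \<in> Y \<and> p \<noteq> a \<and> q \<noteq> a \<and> {p, q} \<subseteq> side T t s \<and>
          {c, p} \<in> edges T \<and> {c, q} \<in> edges T)"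
      proof -
        have "c \<in> Y \<or> (\<exists>p q. p \<noteq> q \<and> p \<in> Y \<and> q \<in> Y \<and> p \<noteq> a \<and> q \<noteq> a \<and> {p, q} \<subseteq> side T s si \<and>
          {c, p} \<in> edges T \<and> {c, q} \<in> edges T)"
          using up unfolding uncle_below_def by (elim conjE)
        moreover have "{p, q} \<subseteq> side T s si \<Longrightarrow> {p, q} \<subseteq> side T t s" for p q using subi by blast
        ultimately show ?thesis by meson
      qed
      ultimately show ?thesis unfolding uncle_below_def by blast
    qed
    moreover have "x \<noteq> s" "y \<noteq> s" using vxy(1) by (auto simp: cherry_below_def)
    ultimately show ?thesis using b vxy(2) by blast
  qed
  show ?case
  proof (cases "s1 \<in> Y \<and> s2 \<in> Y")
    case True
    have "cherry_below t s s s1 s2" using True e st sin unfolding cherry_below_def by blast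
    then show ?thesis by blast
  next
    case F: False
    have core: "\<exists>v x y. cherry_below t s v x y \<and> (v = s \<or> (\<exists>a c d. uncle_below t s v x y a c d))"
      if ii: "si = s1 \<and> sj = s2 \<or> si = s2 \<and> sj = s1" "si \<notin> Y" for si sj
    proof -
      have i: "si \<noteq> sj" "si \<noteq> t" "sj \<noteq> t" "{s, si} \<in> edges T" "{s, sj} \<in> edges T" "sj \<in> side T t s"
        using ii st e sin by auto
      consider "\<exists>v x y. cherry_below t s v x y \<and> (\<exists>a c d. uncle_below t s v x y a c d)"
        | x y where "cherry_below t s si x y" "x \<noteq> s" "y \<noteq> s"
        using lift[of si] ii by blast
      then show ?thesis
      proof cases
        case 1
        then show ?thesis by blast
      next
        case 2
        show ?thesis
        proof (cases "sj \<in> Y")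
          case True
          then have "uncle_below t s si x y s sj t"
            using i less.prems(1) sin 2 unfolding cherry_below_def uncle_below_def
            by (auto simp: insert_commute)
          then show ?thesis using 2 by blast
        next
          case False
          then consider "\<exists>v x y. cherry_below t s v x y \<and> (\<exists>a c d. uncle_below t s v x y a c d)"
            | p q where "cherry_below t s sj p q" "p \<noteq> s" "q \<noteq> s"
            using lift[of sj] ii by blast
          then show ?thesis
          proof cases
            case 1
            then show ?thesis by blast
          next
            case pq: 2
            have "\<exists>p q. p \<noteq> q \<and> p \<in> Y \<and> q \<in> Y \<and> p \<noteq> s \<and> q \<noteq> s \<and> {p, q} \<subseteq> side T t s \<and>
                {sj, p} \<in> edges T \<and> {sj, q} \<in> edges T"
              using pq unfolding cherry_below_def by blast
            then have "uncle_below t s si x y s sj t"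
              using i less.prems(1) sin 2 unfolding cherry_below_def uncle_below_def
              by (auto simp: insert_commute)
            then show ?thesis using 2 by blast
          qed
        qed
      qed
    qed
    show ?thesis using F core[of s1 s2] core[of s2 s1] by blast
  qed
qed

lemma side_has_leaf:
  assumes "{s, t} \<in> edges T"
  shows "Y \<inter> side T t s \<noteq> {}"
proof (cases "s \<in> Y")
  case True
  then show ?thesis using side_self by blast
next
  case False
  then obtain v x y where "x \<in> Y" "{v, x, y} \<subseteq> side T t s"
    using deep_cherry[OF assms False] unfolding cherry_below_def by blast
  then show ?thesis by blast
qed

end

section \<open>Cutting an edge of a phylogenetic tree\<close>

definition cutside :: "'v graph \<Rightarrow> 'v \<Rightarrow> 'v \<Rightarrow> 'v graph" where
  "cutside T t s = \<lparr>verts = side T t s, edges = {e \<in> edges T - {{s, t}}. e \<subseteq> side T t s}\<rparr>"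

definition prune :: "'v graph \<Rightarrow> 'v \<Rightarrow> 'v \<Rightarrow> 'v graph" where
  "prune T t s = (THE S. suppresses_to (cutside T t s) S)"

lemma suppresses_to_unique_vertex:
  assumes "suppression G H u v w" "\<And>n. n \<in> verts G \<Longrightarrow> n \<noteq> v \<Longrightarrow> deg G n \<noteq> 2"
  shows "suppresses_to G S \<longleftrightarrow> S = H"
proof -
  interpret suppression G H u v w by fact
  have degH: "deg H n \<noteq> 2" if "n \<in> verts H" for n
    using deg_H[OF that] assms(2)[of n] that by (simp add: H)
  have stepG: "suppress_vertex G H' \<Longrightarrow> H' = H" for H'
  proof -
    assume "suppress_vertex G H'"
    then obtain u' v' w' where "suppression G H' u' v' w'"
      using tree by (rule suppress_vertexE)
    then interpret s: suppression G H' u' v' w' .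
    have "v' = v" using assms(2) s.v by blast
    then have st: "{u', v} = {u, v} \<or> {u', v} = {v, w}" "{v, w'} = {u, v} \<or> {v, w'} = {v, w}"
      using star[OF s.e1] star[OF s.e2] by simp_all
    have "(u' = u \<and> w' = w) \<or> (u' = w \<and> w' = u)"
      using st s.uw uw neq by (auto simp: doubleton_eq_iff)
    then show "H' = H" unfolding s.H H \<open>v' = v\<close> by (auto simp: insert_commute)
  qed
  have stepH: "\<not> suppress_vertex H K" for K
    using degH unfolding suppress_vertex_def by blast
  have GH: "suppress_vertex G H"
    using v uw e1 e2 H unfolding suppress_vertex_def by blast
  show ?thesis
  proof
    assume S: "suppresses_to G S"
    then have "suppress_vertex\<^sup>*\<^sup>* G S" "S \<noteq> G" using v by (auto simp: suppresses_to_def)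
    then obtain K where "suppress_vertex G K" "suppress_vertex\<^sup>*\<^sup>* K S"
      by (auto elim: converse_rtranclpE)
    then have "suppress_vertex\<^sup>*\<^sup>* H S" using stepG by blast
    then show "S = H" using stepH by (auto elim: converse_rtranclpE)
  next
    assume "S = H"
    then show "suppresses_to G S" using GH degH by (auto simp: suppresses_to_def)
  qed
qed

lemma suppresses_to_no_vertex:
  assumes "\<And>n. n \<in> verts G \<Longrightarrow> deg G n \<noteq> 2"
  shows "suppresses_to G S \<longleftrightarrow> S = G"
proof -
  have "\<not> suppress_vertex G K" for K using assms unfolding suppress_vertex_def by blast
  then show ?thesis using assms unfolding suppresses_to_def by (auto elim: converse_rtranclpE)
qed

context ptree
begin

lemma cutside_tree:
  assumes "{s, t} \<in> edges T"
  shows "tree_graph (cutside T t s)"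
proof -
  have sub: "side T t s \<subseteq> verts T" using side_subset edge(1)[OF assms] by blast
  have from_s: "reach (edges (cutside T t s)) s n" if "n \<in> side T t s" for n
  proof -
    have "reach (edges T - {{s, t}}) s n" using that by (simp add: side_def)
    then have "reach (edges (cutside T t s)) s n \<and> n \<in> side T t s"
    proof (induction rule: reach_induct)
      case base
      then show ?case using side_self by simp
    next
      case (step y z)
      then have "{y, z} \<subseteq> side T t s" using side_closed[of "{y, z}" s t] by blast
      then have "{y, z} \<in> edges (cutside T t s)" "z \<in> side T t s"
        using step.hyps(2) by (simp_all add: cutside_def)
      then show ?case using step.IH by (blast intro: reach_step)
    qed
    then show ?thesis by blast
  qed
  have "simple_graph (cutside T t s)"
    using simple sub finite_subset[OF sub] by (auto simp: simple_graph_def cutside_def)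
  moreover have "verts (cutside T t s) \<noteq> {}" using side_self by (auto simp: cutside_def)
  moreover have "reach (edges (cutside T t s)) u v"
    if "u \<in> verts (cutside T t s)" "v \<in> verts (cutside T t s)" for u v
  proof -
    have "u \<in> side T t s" "v \<in> side T t s" using that by (simp_all add: cutside_def)
    then show ?thesis using from_s reach_sym reach_trans by metis
  qed
  moreover have "\<not> reach (edges (cutside T t s) - {{u, v}}) u v"
    if "{u, v} \<in> edges (cutside T t s)" for u v
  proof
    assume r: "reach (edges (cutside T t s) - {{u, v}}) u v"
    have "{u, v} \<in> edges T" using that by (simp add: cutside_def)
    moreover have "reach (edges T - {{u, v}}) u v"
      by (rule reach_mono[OF r]) (auto simp: cutside_def)
    ultimately show False using bridge by blast
  qed
  ultimately show ?thesis unfolding tree_graph_iff by blast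
qed

lemma cutside_star:
  assumes "{s, t} \<in> edges T" "n \<in> side T t s"
  shows "{e \<in> edges (cutside T t s). n \<in> e} = {e \<in> edges T. n \<in> e} - {{s, t}}"
  using side_closed[of _ s t] assms(2) by (auto simp: cutside_def)

lemma cutside_deg:
  assumes "{s, t} \<in> edges T" "n \<in> side T t s" "n \<noteq> s"
  shows "deg (cutside T t s) n = deg T n"
proof -
  have "n \<noteq> t" using side_not[OF assms(1)] assms(2) by blast
  then have "{e \<in> edges T. n \<in> e} - {{s, t}} = {e \<in> edges T. n \<in> e}" using assms(3) by auto
  then show ?thesis using cutside_star[OF assms(1,2)] by (simp add: deg_def)
qed

lemma cutside_deg_root:
  assumes "{s, t} \<in> edges T"
  shows "deg (cutside T t s) s = deg T s - 1"
  using cutside_star[OF assms side_self] assms finite_edges by (simp add: deg_def card_Diff_singleton)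

lemma leaves_cutside:
  assumes "{s, t} \<in> edges T"
  shows "leaves (cutside T t s) = Y \<inter> side T t s"
proof (rule set_eqI)
  fix n
  have "deg (cutside T t s) n \<le> 1 \<longleftrightarrow> n \<in> Y" if n: "n \<in> side T t s"
  proof (cases "n = s")
    case True
    show ?thesis
    proof (cases "s \<in> Y")
      case True
      then show ?thesis
        using \<open>n = s\<close> cutside_deg_root[OF assms] deg_leaf[of s] by simp
    next
      case False
      then have "deg T s = 3" using deg_inner edge(1)[OF assms] by blast
      then show ?thesis using False \<open>n = s\<close> cutside_deg_root[OF assms] by simp
    qed
  next
    case False
    have "n \<in> verts T" using side_subset[OF edge(1)[OF assms]] n by blast
    then show ?thesis
      using cutside_deg[OF assms n False] deg_leaf[of n] deg_inner[of n] by fastforce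
  qed
  then show "n \<in> leaves (cutside T t s) \<longleftrightarrow> n \<in> Y \<inter> side T t s"
    by (auto simp: leaves_def cutside_def)
qed

lemma cutside_cases:
  assumes "{s, t} \<in> edges T"
  obtains (leaf) "s \<in> Y" "cutside T t s = single_vertex s"
      "\<And>S. suppresses_to (cutside T t s) S \<longleftrightarrow> S = cutside T t s"
    | (inner) H u w where "s \<notin> Y" "suppression (cutside T t s) H u s w"
      "\<And>S. suppresses_to (cutside T t s) S \<longleftrightarrow> S = H"
      "\<And>n. n \<in> verts H \<Longrightarrow> deg H n = deg T n"
proof (cases "s \<in> Y")
  case True
  have star: "e \<inter> {s} = {}" if "e \<in> edges T - {{s, t}}" for e
    using leaf_edge_unique[OF True _ assms, of e] that by auto
  have "n \<in> {s}" if "reach (edges T - {{s, t}}) s n" for n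
    by (rule reach_closed[OF that]) (use star in auto)
  then have "side T t s \<subseteq> {s}" by (auto simp: side_def)
  then have sd: "side T t s = {s}" using side_self by blast
  have "e \<notin> edges (cutside T t s)" for e
  proof
    assume e: "e \<in> edges (cutside T t s)"
    then have "e \<in> edges T" "e \<subseteq> {s}" by (auto simp: cutside_def sd)
    then show False using simple by (auto simp: simple_graph_def dest!: bspec card_mono[rotated])
  qed
  then have E: "edges (cutside T t s) = {}" by blast
  then have "cutside T t s = single_vertex s" by (simp add: cutside_def single_vertex_def sd)
  moreover have "suppresses_to (cutside T t s) S \<longleftrightarrow> S = cutside T t s" for S
    by (rule suppresses_to_no_vertex) (simp add: deg_def E)
  ultimately show ?thesis using leaf True by blast
next
  case False
  obtain u w where uw: "u \<noteq> w" "u \<noteq> t" "w \<noteq> t"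
    "{e \<in> edges T. s \<in> e} = {{s, t}, {s, u}, {s, w}}"
    using inner_star[OF False assms] .
  have st: "{e \<in> edges (cutside T t s). s \<in> e} = {{s, u}, {s, w}}"
    unfolding cutside_star[OF assms side_self] uw(4) using uw by (auto simp: doubleton_eq_iff)
  let ?H = "\<lparr>verts = verts (cutside T t s) - {s},
    edges = (edges (cutside T t s) - {{u, s}, {s, w}}) \<union> {{u, w}}\<rparr>"
  have "{u, s} \<in> edges (cutside T t s)" "{s, w} \<in> edges (cutside T t s)"
    using st by (auto simp: insert_commute)
  moreover have "deg (cutside T t s) s = 2"
    unfolding deg_def st using uw(1) by (simp add: doubleton_eq_iff)
  moreover have "s \<in> verts (cutside T t s)" using side_self by (simp add: cutside_def)
  ultimately have sp: "suppression (cutside T t s) ?H u s w"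
    using uw(1) cutside_tree[OF assms] by (intro suppression.intro) simp_all
  interpret sp: suppression "cutside T t s" ?H u s w by (rule sp)
  have degT: "deg (cutside T t s) n = deg T n \<and> n \<in> verts T"
    if "n \<in> verts (cutside T t s)" "n \<noteq> s" for n
    using that cutside_deg[OF assms] side_subset[OF edge(1)[OF assms]] by (auto simp: cutside_def)
  have "suppresses_to (cutside T t s) S \<longleftrightarrow> S = ?H" for S
  proof (rule suppresses_to_unique_vertex[OF sp])
    fix n assume "n \<in> verts (cutside T t s)" "n \<noteq> s"
    then show "deg (cutside T t s) n \<noteq> 2"
      using degT[of n] deg_leaf[of n] deg_inner[of n] by fastforce
  qed
  moreover have "deg ?H n = deg T n" if "n \<in> verts ?H" for n
    using sp.deg_H[OF that] that degT[of n] by simp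
  ultimately show ?thesis using inner[of ?H u w] False sp by blast
qed

lemma suppresses_to_cutside_iff:
  assumes "{s, t} \<in> edges T"
  shows "suppresses_to (cutside T t s) S \<longleftrightarrow> S = prune T t s"
  using cutside_cases[OF assms] unfolding prune_def by (metis the_equality)

lemma prune_phylo_tree:
  assumes "{s, t} \<in> edges T"
  shows "phylo_tree (Y \<inter> side T t s) (prune T t s)"
proof -
  have ne: "Y \<inter> side T t s \<noteq> {}" using side_has_leaf[OF assms] .
  have fin: "finite (Y \<inter> side T t s)"
    using pt by (simp add: phylo_tree_def phylo_network_def)
  have "tree_graph (prune T t s) \<and> leaves (prune T t s) = Y \<inter> side T t s \<and>
    (\<forall>v\<in>verts (prune T t s) - leaves (prune T t s). deg (prune T t s) v = 3)"
    using assms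
  proof (cases rule: cutside_cases)
    case leaf
    then have p: "prune T t s = cutside T t s" using suppresses_to_cutside_iff[OF assms] by blast
    have "verts (cutside T t s) - leaves (cutside T t s) = {}"
      using leaf(1,2) leaves_cutside[OF assms] side_self by (auto simp: single_vertex_def)
    then show ?thesis
      unfolding p using cutside_tree[OF assms] leaves_cutside[OF assms] by blast
  next
    case (inner H u w)
    then interpret sp: suppression "cutside T t s" H u s w by simp
    have p: "prune T t s = H" using inner(3) suppresses_to_cutside_iff[OF assms] by blast
    have "deg H v = 3" if "v \<in> verts H - leaves H" for v
    proof -
      have v: "v \<in> side T t s" "v \<notin> Y"
        using that sp.verts_H sp.leaves_H leaves_cutside[OF assms] by (auto simp: cutside_def)
      then have "v \<in> verts T" using side_subset[OF edge(1)[OF assms]] by blast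
      then show ?thesis using inner(4)[of v] that v(2) deg_inner by auto
    qed
    then show ?thesis unfolding p using sp.tree_H sp.leaves_H leaves_cutside[OF assms] by simp
  qed
  then show ?thesis
    using ne fin by (auto simp: phylo_tree_def phylo_network_def tree_graph_def)
qed

lemma leaves_prune:
  "{s, t} \<in> edges T \<Longrightarrow> leaves (prune T t s) = Y \<inter> side T t s"
  using prune_phylo_tree by (auto simp: phylo_tree_def phylo_network_def)

lemma prune_keeps_edge:
  assumes "{s, t} \<in> edges T" "e \<in> edges T" "e \<subseteq> side T t s" "s \<notin> e"
  shows "e \<in> edges (prune T t s)"
proof -
  have e: "e \<in> edges (cutside T t s)" using assms by (auto simp: cutside_def)
  show ?thesis using assms(1)
  proof (cases rule: cutside_cases)
    case leaf
    then show ?thesis using e by (simp add: single_vertex_def)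
  next
    case (inner H u w)
    then have "prune T t s = H" using suppresses_to_cutside_iff[OF assms(1)] by blast
    then show ?thesis using inner(2) e assms(4) by (auto simp: suppression_def)
  qed
qed

lemma component_of_delete_edge:
  assumes "{s, t} \<in> edges T" "v \<in> side T t s"
  shows "component_of (delete_edge T {s, t}) v = cutside T t s"
proof -
  have v: "v \<in> verts T" using side_subset[OF edge(1)[OF assms(1)]] assms(2) by blast
  have sv: "reach (edges T - {{s, t}}) s v" using assms(2) by (simp add: side_def)
  have "(\<exists>p. path_between (delete_edge T {s, t}) v p n) \<longleftrightarrow> reach (edges T - {{s, t}}) v n" for n
    using ex_path_between_iff[of "delete_edge T {s, t}" v n] simple v
    by (auto simp: delete_edge_def simple_graph_def)
  also have "reach (edges T - {{s, t}}) v n \<longleftrightarrow> n \<in> side T t s" for n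
    using sv reach_sym[OF sv] by (auto simp: side_def intro: reach_trans)
  finally show ?thesis by (simp add: component_of_def cutside_def delete_edge_def)
qed

lemma components_delete_edge:
  assumes "{s, t} \<in> edges T"
  shows "components (delete_edge T {s, t}) = {cutside T t s, cutside T s t}"
proof -
  have ts: "{t, s} \<in> edges T" using assms by (simp add: insert_commute)
  have 1: "component_of (delete_edge T {s, t}) v = cutside T t s" if "v \<in> side T t s" for v
    using component_of_delete_edge[OF assms that] .
  have 2: "component_of (delete_edge T {s, t}) v = cutside T s t" if "v \<in> side T s t" for v
    using component_of_delete_edge[OF ts that] by (simp add: insert_commute)
  have "components (delete_edge T {s, t}) =
    component_of (delete_edge T {s, t}) ` (side T t s \<union> side T s t)"
    by (simp add: components_def delete_edge_def side_union[OF assms])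
  also have "\<dots> = {cutside T t s, cutside T s t}"
  proof -
    have "component_of (delete_edge T {s, t}) ` side T t s = (\<lambda>_. cutside T t s) ` side T t s"
      using 1 by (rule image_cong[OF refl])
    moreover have "component_of (delete_edge T {s, t}) ` side T s t = (\<lambda>_. cutside T s t) ` side T s t"
      using 2 by (rule image_cong[OF refl])
    ultimately show ?thesis
      using side_self[of s t] side_self[of t s] unfolding image_Un by auto
  qed
  finally show ?thesis .
qed

lemma suppressed_components:
  assumes "{s, t} \<in> edges T"
  shows "{S. \<exists>C\<in>components (delete_edge T {s, t}). suppresses_to C S} = {prune T t s, prune T s t}"
proof -
  have ts: "{t, s} \<in> edges T" using assms by (simp add: insert_commute)
  show ?thesis
    unfolding components_delete_edge[OF assms]
    using suppresses_to_cutside_iff[OF assms] suppresses_to_cutside_iff[OF ts] by auto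
qed

lemma delete_leaf_suppress:
  assumes "{s, x} \<in> edges T" "x \<in> Y"
  shows "suppresses_to (delete_vertex T x) S \<longleftrightarrow> S = prune T x s" "side T x s = verts T - {x}"
proof -
  have xs: "{x, s} \<in> edges T" using assms(1) by (simp add: insert_commute)
  have "side T s x = {x}"
    using xs
  proof (cases rule: cutside_cases)
    case leaf
    then show ?thesis by (simp add: cutside_def single_vertex_def)
  qed (use assms in simp)
  then show sd: "side T x s = verts T - {x}"
    using side_union[OF assms(1)] side_disjoint[OF assms(1)] by blast
  have "e \<subseteq> side T x s \<longleftrightarrow> x \<notin> e" if "e \<in> edges T" for e
    using that simple unfolding sd simple_graph_def by blast
  then have "delete_vertex T x = cutside T x s"
    unfolding delete_vertex_def cutside_def sd by auto
  then show "suppresses_to (delete_vertex T x) S \<longleftrightarrow> S = prune T x s"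
    using suppresses_to_cutside_iff[OF assms(1)] by simp
qed

lemma cut_edge:
  assumes "{s, t} \<in> edges T"
  shows "cut_edge T {s, t}"
proof -
  have "component_of T u = \<lparr>verts = verts T, edges = edges T\<rparr>" if "u \<in> verts T" for u
  proof -
    have "(\<exists>p. path_between T u p n) \<longleftrightarrow> n \<in> verts T" for n
    proof -
      have "(\<exists>p. path_between T u p n) \<longleftrightarrow> reach (edges T) u n"
        using ex_path_between_iff[of T u n] simple that by (auto simp: simple_graph_def)
      moreover have "reach (edges T) u n \<Longrightarrow> n \<in> verts T"
        by (erule reach_closed) (use simple that in \<open>auto simp: simple_graph_def\<close>)
      ultimately show ?thesis using connected[OF that] by blast
    qed
    then show ?thesis using simple by (auto simp: component_of_def simple_graph_def)
  qed
  then have "components T \<subseteq> {\<lparr>verts = verts T, edges = edges T\<rparr>}" by (auto simp: components_def)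
  then have "card (components T) \<le> 1" using card_mono[of "{\<lparr>verts = verts T, edges = edges T\<rparr>}"] by fastforce
  moreover have "cutside T t s \<noteq> cutside T s t"
    using side_disjoint[OF assms] side_self[of s t] by (auto simp: cutside_def)
  ultimately show ?thesis
    unfolding cut_edge_def components_delete_edge[OF assms] using assms by simp
qed

lemma proper_pendant_prune:
  assumes "{s, t} \<in> edges T"
  shows "proper_pendant T {s, t} (prune T t s)"
  unfolding proper_pendant_def components_delete_edge[OF assms]
  using cut_edge[OF assms] prune_phylo_tree[OF assms] suppresses_to_cutside_iff[OF assms] by blast

end

section \<open>Topological embeddings\<close>

definition inc :: "'v set set \<Rightarrow> 'v \<Rightarrow> 'v set set" where
  "inc E n = {g \<in> E. n \<in> g}"

lemma inc_Un: "inc (A \<union> B) n = inc A n \<union> inc B n"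
  by (auto simp: inc_def)

lemma finite_inc: "finite E \<Longrightarrow> finite (inc E n)"
  by (simp add: inc_def)

text \<open>An embedding sends each edge \<open>e\<close> to the edge set \<open>P e\<close> of a path. Instead of as vertex lists, the paths
  are described by the parity of their vertex degrees and, in the last clause, by their connectedness
  through inner vertices; this makes the notion stable under suppression.\<close>

definition emb :: "'w graph \<Rightarrow> ('w \<Rightarrow> 'v) \<Rightarrow> ('w set \<Rightarrow> 'v set set) \<Rightarrow> bool" where
  "emb T \<phi> P \<longleftrightarrow> inj_on \<phi> (verts T) \<and>
    (\<forall>e\<in>edges T. finite (P e)) \<and>
    (\<forall>e\<in>edges T. \<forall>f\<in>edges T. e \<noteq> f \<longrightarrow> P e \<inter> P f = {}) \<and>
    (\<forall>n. n \<notin> \<phi> ` verts T \<longrightarrow> (\<forall>e\<in>edges T. inc (P e) n = {} \<or>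
        card (inc (P e) n) = 2 \<and> (\<forall>f\<in>edges T. f \<noteq> e \<longrightarrow> inc (P f) n = {}))) \<and>
    (\<forall>t\<in>verts T. \<forall>e\<in>edges T. card (inc (P e) (\<phi> t)) = (if t \<in> e then 1 else 0)) \<and>
    (\<forall>e\<in>edges T. \<forall>Q\<subseteq>P e. Q \<noteq> {} \<longrightarrow>
       (\<forall>g\<in>Q. \<forall>g'\<in>P e. \<forall>n\<in>g \<inter> g'. n \<notin> \<phi> ` verts T \<longrightarrow> g' \<in> Q) \<longrightarrow> Q = P e)"

lemma embI:
  assumes "inj_on \<phi> (verts T)" "\<And>e. e \<in> edges T \<Longrightarrow> finite (P e)"
    "\<And>e f. e \<in> edges T \<Longrightarrow> f \<in> edges T \<Longrightarrow> e \<noteq> f \<Longrightarrow> P e \<inter> P f = {}"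
    "\<And>n e. n \<notin> \<phi> ` verts T \<Longrightarrow> e \<in> edges T \<Longrightarrow> inc (P e) n \<noteq> {} \<Longrightarrow> card (inc (P e) n) = 2"
    "\<And>n e f. n \<notin> \<phi> ` verts T \<Longrightarrow> e \<in> edges T \<Longrightarrow> f \<in> edges T \<Longrightarrow> e \<noteq> f \<Longrightarrow> inc (P e) n \<noteq> {} \<Longrightarrow> inc (P f) n = {}"
    "\<And>t e. t \<in> verts T \<Longrightarrow> e \<in> edges T \<Longrightarrow> card (inc (P e) (\<phi> t)) = (if t \<in> e then 1 else 0)"
    "\<And>e Q. e \<in> edges T \<Longrightarrow> Q \<subseteq> P e \<Longrightarrow> Q \<noteq> {} \<Longrightarrow>
      (\<And>g g' n. g \<in> Q \<Longrightarrow> g' \<in> P e \<Longrightarrow> n \<in> g \<Longrightarrow> n \<in> g' \<Longrightarrow> n \<notin> \<phi> ` verts T \<Longrightarrow> g' \<in> Q) \<Longrightarrow> Q = P e"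
  shows "emb T \<phi> P"
  unfolding emb_def
proof (intro conjI ballI allI impI)
  fix n e assume "n \<notin> \<phi> ` verts T" "e \<in> edges T"
  then show "inc (P e) n = {} \<or>
        card (inc (P e) n) = 2 \<and> (\<forall>f\<in>edges T. f \<noteq> e \<longrightarrow> inc (P f) n = {})"
    using assms(4,5) by metis
next
  fix e Q
  assume "e \<in> edges T" "Q \<subseteq> P e" "Q \<noteq> {}" "\<forall>g\<in>Q. \<forall>g'\<in>P e. \<forall>n\<in>g \<inter> g'. n \<notin> \<phi> ` verts T \<longrightarrow> g' \<in> Q"
  then show "Q = P e" by (intro assms(7)) blast+
qed (use assms in auto)

lemma embD:
  assumes "emb T \<phi> P"
  shows "inj_on \<phi> (verts T)" "\<And>e. e \<in> edges T \<Longrightarrow> finite (P e)"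
    "\<And>e f. e \<in> edges T \<Longrightarrow> f \<in> edges T \<Longrightarrow> e \<noteq> f \<Longrightarrow> P e \<inter> P f = {}"
    "\<And>n e. n \<notin> \<phi> ` verts T \<Longrightarrow> e \<in> edges T \<Longrightarrow> inc (P e) n \<noteq> {} \<Longrightarrow> card (inc (P e) n) = 2"
    "\<And>n e f. n \<notin> \<phi> ` verts T \<Longrightarrow> e \<in> edges T \<Longrightarrow> f \<in> edges T \<Longrightarrow> e \<noteq> f \<Longrightarrow> inc (P e) n \<noteq> {} \<Longrightarrow> inc (P f) n = {}"
    "\<And>t e. t \<in> verts T \<Longrightarrow> e \<in> edges T \<Longrightarrow> card (inc (P e) (\<phi> t)) = (if t \<in> e then 1 else 0)"
proof -
  note d = assms[unfolded emb_def]
  show "inj_on \<phi> (verts T)" using d by (elim conjE)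
  have "\<forall>e\<in>edges T. finite (P e)" using d by (elim conjE)
  then show "\<And>e. e \<in> edges T \<Longrightarrow> finite (P e)" by (rule bspec)
  have "\<forall>e\<in>edges T. \<forall>f\<in>edges T. e \<noteq> f \<longrightarrow> P e \<inter> P f = {}" using d by (elim conjE)
  then show "\<And>e f. e \<in> edges T \<Longrightarrow> f \<in> edges T \<Longrightarrow> e \<noteq> f \<Longrightarrow> P e \<inter> P f = {}" by simp
  have "\<forall>t\<in>verts T. \<forall>e\<in>edges T. card (inc (P e) (\<phi> t)) = (if t \<in> e then 1 else 0)"
    using d by (elim conjE)
  then show "\<And>t e. t \<in> verts T \<Longrightarrow> e \<in> edges T \<Longrightarrow> card (inc (P e) (\<phi> t)) = (if t \<in> e then 1 else 0)"
    by simp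
  have k: "\<forall>n. n \<notin> \<phi> ` verts T \<longrightarrow> (\<forall>e\<in>edges T. inc (P e) n = {} \<or>
        card (inc (P e) n) = 2 \<and> (\<forall>f\<in>edges T. f \<noteq> e \<longrightarrow> inc (P f) n = {}))"
    using d by (elim conjE)
  then show "\<And>n e. n \<notin> \<phi> ` verts T \<Longrightarrow> e \<in> edges T \<Longrightarrow> inc (P e) n \<noteq> {} \<Longrightarrow> card (inc (P e) n) = 2"
    "\<And>n e f. n \<notin> \<phi> ` verts T \<Longrightarrow> e \<in> edges T \<Longrightarrow> f \<in> edges T \<Longrightarrow> e \<noteq> f \<Longrightarrow> inc (P e) n \<noteq> {} \<Longrightarrow> inc (P f) n = {}"
    by metis+
qed

lemma emb_path_connected:
  assumes "emb T \<phi> P" "e \<in> edges T" "Q \<subseteq> P e" "Q \<noteq> {}"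
    "\<And>g g' n. g \<in> Q \<Longrightarrow> g' \<in> P e \<Longrightarrow> n \<in> g \<Longrightarrow> n \<in> g' \<Longrightarrow> n \<notin> \<phi> ` verts T \<Longrightarrow> g' \<in> Q"
  shows "Q = P e"
proof -
  have "\<forall>e\<in>edges T. \<forall>Q\<subseteq>P e. Q \<noteq> {} \<longrightarrow>
       (\<forall>g\<in>Q. \<forall>g'\<in>P e. \<forall>n\<in>g \<inter> g'. n \<notin> \<phi> ` verts T \<longrightarrow> g' \<in> Q) \<longrightarrow> Q = P e"
    using assms(1) unfolding emb_def by (elim conjE)
  then have "(\<forall>g\<in>Q. \<forall>g'\<in>P e. \<forall>n\<in>g \<inter> g'. n \<notin> \<phi> ` verts T \<longrightarrow> g' \<in> Q) \<longrightarrow> Q = P e"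
    using assms(2-4) by simp
  moreover have "\<forall>g\<in>Q. \<forall>g'\<in>P e. \<forall>n\<in>g \<inter> g'. n \<notin> \<phi> ` verts T \<longrightarrow> g' \<in> Q"
    using assms(5) by blast
  ultimately show ?thesis by (rule mp)
qed

lemma emb_inc_end:
  assumes "emb T \<phi> P" "t \<in> verts T" "e \<in> edges T"
  shows "t \<in> e \<Longrightarrow> \<exists>g. inc (P e) (\<phi> t) = {g}" "t \<notin> e \<Longrightarrow> inc (P e) (\<phi> t) = {}"
proof -
  have "card (inc (P e) (\<phi> t)) = (if t \<in> e then 1 else 0)" "finite (inc (P e) (\<phi> t))"
    using embD(6)[OF assms] embD(2)[OF assms(1,3)] by (simp_all add: finite_inc)
  then show "t \<in> e \<Longrightarrow> \<exists>g. inc (P e) (\<phi> t) = {g}" "t \<notin> e \<Longrightarrow> inc (P e) (\<phi> t) = {}"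
    by (simp_all add: card_1_singleton_iff)
qed

lemma emb_identity:
  assumes "simple_graph S"
  shows "emb S id (\<lambda>e. {e})"
proof (rule embI)
  fix n e assume "n \<notin> id ` verts S" "e \<in> edges S" "inc {e} n \<noteq> {}"
  then show "card (inc {e} n) = 2" using assms by (auto simp: simple_graph_def inc_def)
next
  fix n e f assume "n \<notin> id ` verts S" "e \<in> edges S" "inc {e} n \<noteq> {}"
  then show "inc {f} n = {}" using assms by (auto simp: simple_graph_def inc_def)
next
  fix t e assume "t \<in> verts S" "e \<in> edges S"
  have "inc {e} (id t) = (if t \<in> e then {e} else {})" by (auto simp: inc_def)
  then show "card (inc {e} (id t)) = (if t \<in> e then 1 else 0)" by simp
qed auto

lemma emb_subgraph:
  assumes "emb T \<phi> P" "verts C \<subseteq> verts T" "edges C \<subseteq> edges T" "\<And>e. e \<in> edges C \<Longrightarrow> e \<subseteq> verts C"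
  shows "emb C \<phi> P"
proof (rule embI)
  have img: "n \<notin> \<phi> ` verts T" if "n \<notin> \<phi> ` verts C" "e \<in> edges C" "inc (P e) n \<noteq> {}" for n e
  proof
    assume "n \<in> \<phi> ` verts T"
    then obtain t where t: "t \<in> verts T" "n = \<phi> t" by blast
    then have "t \<notin> verts C" using that(1) by blast
    then have "t \<notin> e" using assms(4) that(2) by blast
    then show False using emb_inc_end(2)[OF assms(1) t(1)] that(2,3) assms(3) t(2) by blast
  qed
  show "inj_on \<phi> (verts C)" using embD(1)[OF assms(1)] assms(2) by (rule inj_on_subset)
  show "finite (P e)" if "e \<in> edges C" for e using that assms(3) embD(2)[OF assms(1)] by blast
  show "P e \<inter> P f = {}" if "e \<in> edges C" "f \<in> edges C" "e \<noteq> f" for e f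
    using that assms(3) embD(3)[OF assms(1)] by blast
  show "card (inc (P e) n) = 2" if "n \<notin> \<phi> ` verts C" "e \<in> edges C" "inc (P e) n \<noteq> {}" for n e
    using embD(4)[OF assms(1) img[OF that]] that assms(3) by blast
  show "inc (P f) n = {}"
    if "n \<notin> \<phi> ` verts C" "e \<in> edges C" "f \<in> edges C" "e \<noteq> f" "inc (P e) n \<noteq> {}" for n e f
    using embD(5)[OF assms(1) img[OF that(1,2,5)]] that assms(3) by blast
  show "card (inc (P e) (\<phi> t)) = (if t \<in> e then 1 else 0)" if "t \<in> verts C" "e \<in> edges C" for t e
    using embD(6)[OF assms(1)] that assms(2,3) by blast
  show "Q = P e" if "e \<in> edges C" "Q \<subseteq> P e" "Q \<noteq> {}"
    "\<And>g g' n. g \<in> Q \<Longrightarrow> g' \<in> P e \<Longrightarrow> n \<in> g \<Longrightarrow> n \<in> g' \<Longrightarrow> n \<notin> \<phi> ` verts C \<Longrightarrow> g' \<in> Q" for e Q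
  proof (rule emb_path_connected[OF assms(1) _ that(2,3)])
    show "e \<in> edges T" using that(1) assms(3) by blast
    fix g g' n assume "g \<in> Q" "g' \<in> P e" "n \<in> g" "n \<in> g'" "n \<notin> \<phi> ` verts T"
    then show "g' \<in> Q" using that(4)[of g g' n] assms(2) by blast
  qed
qed

lemma emb_iso:
  assumes "emb H \<phi> P" "bij_betw h (verts T) (verts H)"
    "\<And>e. e \<in> edges T \<Longrightarrow> e \<subseteq> verts T \<and> h ` e \<in> edges H"
  shows "emb T (\<phi> \<circ> h) (\<lambda>e. P (h ` e))"
proof (rule embI)
  have inj: "inj_on h (verts T)" and im: "h ` verts T = verts H"
    using assms(2) by (auto simp: bij_betw_def)
  have hv: "h t \<in> verts H" if "t \<in> verts T" for t using im that by blast
  have im2: "(\<phi> \<circ> h) ` verts T = \<phi> ` verts H" by (simp only: im[symmetric] image_comp)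
  have eq: "h ` e \<noteq> h ` f" if "e \<in> edges T" "f \<in> edges T" "e \<noteq> f" for e f
    using inj_on_image_eq_iff[OF inj, of e f] assms(3)[OF that(1)] assms(3)[OF that(2)] that(3) by simp
  have mem: "h t \<in> h ` e \<longleftrightarrow> t \<in> e" if "t \<in> verts T" "e \<in> edges T" for t e
    using inj_on_image_mem_iff[OF inj that(1), of e] assms(3)[OF that(2)] by simp
  show "inj_on (\<phi> \<circ> h) (verts T)"
    using comp_inj_on[OF inj] embD(1)[OF assms(1)] im by simp
  show "finite (P (h ` e))" if "e \<in> edges T" for e
    using embD(2)[OF assms(1)] assms(3)[OF that] by blast
  show "P (h ` e) \<inter> P (h ` f) = {}" if "e \<in> edges T" "f \<in> edges T" "e \<noteq> f" for e f
    using embD(3)[OF assms(1) _ _ eq[OF that]] assms(3) that by blast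
  show "card (inc (P (h ` e)) n) = 2"
    if "n \<notin> (\<phi> \<circ> h) ` verts T" "e \<in> edges T" "inc (P (h ` e)) n \<noteq> {}" for n e
    using embD(4)[OF assms(1)] that assms(3) unfolding im2 by blast
  show "inc (P (h ` f)) n = {}"
    if "n \<notin> (\<phi> \<circ> h) ` verts T" "e \<in> edges T" "f \<in> edges T" "e \<noteq> f" "inc (P (h ` e)) n \<noteq> {}" for n e f
    using embD(5)[OF assms(1) _ _ _ eq[OF that(2-4)]] that assms(3) unfolding im2 by blast
  show "card (inc (P (h ` e)) ((\<phi> \<circ> h) t)) = (if t \<in> e then 1 else 0)"
    if "t \<in> verts T" "e \<in> edges T" for t e
    using embD(6)[OF assms(1) hv[OF that(1)], of "h ` e"] assms(3)[OF that(2)] mem[OF that] by simp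
  show "Q = P (h ` e)" if "e \<in> edges T" "Q \<subseteq> P (h ` e)" "Q \<noteq> {}"
    "\<And>g g' n. g \<in> Q \<Longrightarrow> g' \<in> P (h ` e) \<Longrightarrow> n \<in> g \<Longrightarrow> n \<in> g' \<Longrightarrow> n \<notin> (\<phi> \<circ> h) ` verts T \<Longrightarrow> g' \<in> Q" for e Q
    using emb_path_connected[OF assms(1) _ that(2,3)] that(4) assms(3)[OF that(1)] unfolding im2 by blast
qed

lemma (in suppression) emb_suppress:
  assumes "emb G \<phi> P"
  shows "\<exists>P'. emb H \<phi> P' \<and> \<Union>(P' ` edges H) = \<Union>(P ` edges G)"
proof -
  define P' where "P' e = (if e = {u, w} then P {u, v} \<union> P {v, w} else P e)" for e
  have old: "e \<in> edges G" "v \<notin> e" "P' e = P e" "e \<noteq> {u, v}" "e \<noteq> {v, w}"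
    if "e \<in> edges H" "e \<noteq> {u, w}" for e
    using that star by (auto simp: H P'_def)
  have new: "P' {u, w} = P {u, v} \<union> P {v, w}" by (simp add: P'_def)
  have disj: "P {u, v} \<inter> P {v, w} = {}" using embD(3)[OF assms e1 e2 neq12] .
  have fin: "finite (P {u, v})" "finite (P {v, w})" using embD(2)[OF assms] e1 e2 by auto
  obtain g1 where g1: "inc (P {u, v}) (\<phi> v) = {g1}"
    using emb_inc_end(1)[OF assms v(1) e1] by auto
  obtain g2 where g2: "inc (P {v, w}) (\<phi> v) = {g2}"
    using emb_inc_end(1)[OF assms v(1) e2] by auto
  have g12: "g1 \<in> P {u, v}" "g2 \<in> P {v, w}" "\<phi> v \<in> g1" "\<phi> v \<in> g2" "g1 \<noteq> g2"
  proof -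
    have "g1 \<in> inc (P {u, v}) (\<phi> v)" "g2 \<in> inc (P {v, w}) (\<phi> v)" using g1 g2 by simp_all
    then show "g1 \<in> P {u, v}" "g2 \<in> P {v, w}" "\<phi> v \<in> g1" "\<phi> v \<in> g2" by (simp_all add: inc_def)
    then show "g1 \<noteq> g2" using disj by blast
  qed
  have inj\<phi>: "inj_on \<phi> (verts G)" using embD(1)[OF assms] .
  have \<phi>v: "\<phi> v \<notin> \<phi> ` verts H" using inj\<phi> v(1) by (auto simp: H inj_on_def)
  have img: "n = \<phi> v \<or> n \<notin> \<phi> ` verts G" if "n \<notin> \<phi> ` verts H" for n
    using that by (auto simp: H)
  have incv: "inc (P' e) (\<phi> v) = (if e = {u, w} then {g1, g2} else {})" if "e \<in> edges H" for e
  proof (cases "e = {u, w}")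
    case True
    then show ?thesis using new g1 g2 by (auto simp: inc_Un)
  next
    case False
    then show ?thesis using emb_inc_end(2)[OF assms v(1) old(1)] old[OF that False] that by simp
  qed
  have inc0: "inc (P' e) n \<noteq> {} \<Longrightarrow> e \<in> edges H \<Longrightarrow> \<exists>e0 \<in> edges G. inc (P e0) n \<noteq> {} \<and>
      (if e = {u, w} then e0 = {u, v} \<or> e0 = {v, w} else e0 = e)" for e n
  proof (cases "e = {u, w}")
    case True
    assume "inc (P' e) n \<noteq> {}"
    then show ?thesis using True new e1 e2 by (auto simp: inc_Un)
  next
    case False
    assume "inc (P' e) n \<noteq> {}" "e \<in> edges H"
    then show ?thesis using False old[of e] by auto
  qed
  have "emb H \<phi> P'"
  proof (rule embI)
    show "inj_on \<phi> (verts H)" using inj\<phi> by (rule inj_on_subset) (auto simp: H)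
    show "finite (P' e)" if "e \<in> edges H" for e
      using old[OF that] new fin embD(2)[OF assms] by (cases "e = {u, w}") auto
    have d1: "P' {u, w} \<inter> P' f = {}" if "f \<in> edges H" "f \<noteq> {u, w}" for f
      using old[OF that] new embD(3)[OF assms e1, of f] embD(3)[OF assms e2, of f] by auto
    show "P' e \<inter> P' f = {}" if "e \<in> edges H" "f \<in> edges H" "e \<noteq> f" for e f
    proof -
      consider "e = {u, w}" | "f = {u, w}" | "e \<noteq> {u, w}" "f \<noteq> {u, w}" by blast
      then show ?thesis
      proof cases
        case 3
        then show ?thesis using old[of e] old[of f] that embD(3)[OF assms, of e f] by simp
      qed (use d1[of e] d1[of f] that in auto)
    qed
    show "card (inc (P' e) n) = 2" if n: "n \<notin> \<phi> ` verts H" and e: "e \<in> edges H"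
      and ne: "inc (P' e) n \<noteq> {}" for n e
    proof (cases "n = \<phi> v")
      case True
      then show ?thesis using incv[OF e] ne g12(5) by (auto split: if_splits)
    next
      case F: False
      then have nG: "n \<notin> \<phi> ` verts G" using img[OF n] by blast
      show ?thesis
      proof (cases "e = {u, w}")
        case True
        show ?thesis
        proof (cases "inc (P {u, v}) n = {}")
          case E: True
          then have "inc (P' e) n = inc (P {v, w}) n" using True new by (simp add: inc_Un)
          then show ?thesis using embD(4)[OF assms nG e2] ne by simp
        next
          case False
          then have "inc (P {v, w}) n = {}" using embD(5)[OF assms nG e1 e2 neq12] by blast
          then have "inc (P' e) n = inc (P {u, v}) n" using True new by (simp add: inc_Un)
          then show ?thesis using embD(4)[OF assms nG e1] ne by simp
        qed
      next
        case False
        then show ?thesis using embD(4)[OF assms nG, of e] old[OF e False] ne by simp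
      qed
    qed
    show "inc (P' f) n = {}" if n: "n \<notin> \<phi> ` verts H" and ef: "e \<in> edges H" "f \<in> edges H" "e \<noteq> f"
      and ne: "inc (P' e) n \<noteq> {}" for n e f
    proof (cases "n = \<phi> v")
      case True
      then show ?thesis using incv[OF ef(1)] incv[OF ef(2)] ne ef(3) by (auto split: if_splits)
    next
      case False
      then have nG: "n \<notin> \<phi> ` verts G" using img[OF n] by blast
      show ?thesis
      proof (rule ccontr)
        assume ne2: "inc (P' f) n \<noteq> {}"
        obtain e0 where e0: "e0 \<in> edges G" "inc (P e0) n \<noteq> {}"
          "if e = {u, w} then e0 = {u, v} \<or> e0 = {v, w} else e0 = e"
          using inc0[OF ne ef(1)] by blast
        obtain f0 where f0: "f0 \<in> edges G" "inc (P f0) n \<noteq> {}"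
          "if f = {u, w} then f0 = {u, v} \<or> f0 = {v, w} else f0 = f"
          using inc0[OF ne2 ef(2)] by blast
        have "e0 \<noteq> f0"
          using e0(3) f0(3) ef old[of e] old[of f] by (auto split: if_splits)
        then show False using embD(5)[OF assms nG e0(1) f0(1)] e0(2) f0(2) by blast
      qed
    qed
    show "card (inc (P' e) (\<phi> t)) = (if t \<in> e then 1 else 0)"
      if t: "t \<in> verts H" and e: "e \<in> edges H" for t e
    proof -
      have tG: "t \<in> verts G" "t \<noteq> v" using t by (auto simp: H)
      show ?thesis
      proof (cases "e = {u, w}")
        case True
        have c: "card (inc (P' e) (\<phi> t)) = card (inc (P {u, v}) (\<phi> t)) + card (inc (P {v, w}) (\<phi> t))"
          unfolding True new inc_Un using fin disj
          by (intro card_Un_disjoint) (auto simp: inc_def)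
        show ?thesis
          unfolding c using embD(6)[OF assms tG(1) e1] embD(6)[OF assms tG(1) e2] tG(2) uw True by auto
      next
        case False
        then show ?thesis using embD(6)[OF assms tG(1), of e] old[OF e False] by simp
      qed
    qed
    show "Q = P' e" if e: "e \<in> edges H" and Q: "Q \<subseteq> P' e" "Q \<noteq> {}"
      and cl: "\<And>g g' n. g \<in> Q \<Longrightarrow> g' \<in> P' e \<Longrightarrow> n \<in> g \<Longrightarrow> n \<in> g' \<Longrightarrow> n \<notin> \<phi> ` verts H \<Longrightarrow> g' \<in> Q" for e Q
    proof -
      have sub: "\<phi> ` verts H \<subseteq> \<phi> ` verts G" by (auto simp: H)
      have part: "P e0 \<subseteq> Q" if "e0 \<in> edges G" "P e0 \<subseteq> P' e" "Q \<inter> P e0 \<noteq> {}" for e0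
      proof -
        have "Q \<inter> P e0 = P e0"
        proof (rule emb_path_connected[OF assms that(1) _ that(3)])
          show "Q \<inter> P e0 \<subseteq> P e0" by blast
          fix g g' n assume "g \<in> Q \<inter> P e0" "g' \<in> P e0" "n \<in> g" "n \<in> g'" "n \<notin> \<phi> ` verts G"
          then show "g' \<in> Q \<inter> P e0" using cl[of g g' n] that(2) sub by blast
        qed
        then show ?thesis by blast
      qed
      show ?thesis
      proof (cases "e = {u, w}")
        case True
        have subs: "P {u, v} \<subseteq> P' e" "P {v, w} \<subseteq> P' e" using True new by auto
        have "g1 \<in> Q \<longleftrightarrow> g2 \<in> Q"
          using cl[of g1 g2 "\<phi> v"] cl[of g2 g1 "\<phi> v"] g12 \<phi>v subs by blast
        moreover have "g1 \<in> Q \<or> g2 \<in> Q"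
          using Q part[OF e1 subs(1)] part[OF e2 subs(2)] g12 True new by blast
        ultimately have "P {u, v} \<subseteq> Q" "P {v, w} \<subseteq> Q"
          using part[OF e1 subs(1)] part[OF e2 subs(2)] g12 by blast+
        then show ?thesis using Q(1) True new by blast
      next
        case False
        have "P e = P' e" "e \<in> edges G" using old[OF e False] by auto
        then show ?thesis using part[of e] Q by blast
      qed
    qed
  qed
  moreover have "\<Union>(P' ` edges H) = \<Union>(P ` edges G)"
  proof -
    have "edges H = insert {u, w} (edges G - {{u, v}, {v, w}})" by (simp add: H)
    moreover have "P' e = P e" if "e \<in> edges G - {{u, v}, {v, w}}" for e
      using that new_edge by (auto simp: P'_def)
    ultimately have "\<Union>(P' ` edges H) = P {u, v} \<union> P {v, w} \<union> \<Union>(P ` (edges G - {{u, v}, {v, w}}))"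
      using new by simp
    also have "\<dots> = \<Union>(P ` edges G)" using e1 e2 by blast
    finally show ?thesis .
  qed
  ultimately show ?thesis by blast
qed

definition embeds :: "'v graph \<Rightarrow> 'v set set \<Rightarrow> bool" where
  "embeds T J \<longleftrightarrow> (\<exists>\<phi> P. emb T \<phi> P \<and> (\<forall>x\<in>leaves T. \<phi> x = x) \<and> J = \<Union>(P ` edges T))"

lemma (in ptree) embeds_prune:
  assumes "emb T \<phi> P" "\<forall>x\<in>Y. \<phi> x = x" "{s, t} \<in> edges T"
  shows "embeds (prune T t s) (\<Union>(P ` edges (cutside T t s)))"
proof -
  have sub: "side T t s \<subseteq> verts T" using side_subset edge(1)[OF assms(3)] by blast
  have C: "emb (cutside T t s) \<phi> P"
    by (rule emb_subgraph[OF assms(1)]) (use sub in \<open>auto simp: cutside_def\<close>)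
  have fx: "\<phi> x = x" if "x \<in> leaves (prune T t s)" for x
    using that assms(2) leaves_prune[OF assms(3)] by blast
  show ?thesis
    using assms(3)
  proof (cases rule: cutside_cases)
    case leaf
    then have "prune T t s = cutside T t s" using suppresses_to_cutside_iff[OF assms(3)] by blast
    then show ?thesis using C fx unfolding embeds_def by metis
  next
    case (inner H u w)
    then have "prune T t s = H" using suppresses_to_cutside_iff[OF assms(3)] by blast
    then show ?thesis
      using suppression.emb_suppress[OF inner(2) C] fx unfolding embeds_def by metis
  qed
qed

lemma displays_via_embeds:
  assumes "displays_via N S T" "phylo_tree Y T"
  shows "embeds T (edges S)"
proof -
  interpret ptree Y T by unfold_locales (fact assms(2))
  have S: "tree_graph S" using assms(1) by (simp add: displays_via_def subtree_of_def)
  obtain K where K: "suppresses_to S K" "phylo_iso K T"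
    using assms(1) by (auto simp: displays_via_def)
  have "suppress_vertex\<^sup>*\<^sup>* S K" using K(1) by (simp add: suppresses_to_def)
  then have "tree_graph K \<and> (\<exists>P. emb K id P \<and> \<Union>(P ` edges K) = edges S)"
  proof (induction rule: rtranclp_induct)
    case base
    have "emb S id (\<lambda>e. {e})" using S by (intro emb_identity) (simp add: tree_graph_def)
    moreover have "\<Union>((\<lambda>e. {e}) ` edges S) = edges S" by auto
    ultimately show ?case using S by (intro conjI exI[of _ "\<lambda>e. {e}"])
  next
    case (step G H)
    then obtain P where P: "tree_graph G" "emb G id P" "\<Union>(P ` edges G) = edges S" by blast
    obtain u v w where "suppression G H u v w" using suppress_vertexE[OF step.hyps(2) P(1)] .
    then interpret suppression G H u v w .
    show ?case using emb_suppress[OF P(2)] tree_H unfolding P(3) by blast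
  qed
  then obtain P where K': "tree_graph K" "emb K id P" "\<Union>(P ` edges K) = edges S" by blast
  have sK: "simple_graph K" using K'(1) by (simp add: tree_graph_def)
  obtain f where f: "bij_betw f (verts K) (verts T)"
    "\<And>u v. u \<in> verts K \<Longrightarrow> v \<in> verts K \<Longrightarrow> {u, v} \<in> edges K \<longleftrightarrow> {f u, f v} \<in> edges T"
    "\<And>x. x \<in> leaves K \<Longrightarrow> f x = x"
    using K(2) unfolding phylo_iso_def by blast
  define h where "h = the_inv_into (verts K) f"
  have h: "bij_betw h (verts T) (verts K)" unfolding h_def using f(1) by (rule bij_betw_the_inv_into)
  have inj: "inj_on f (verts K)" "f ` verts K = verts T" using f(1) by (auto simp: bij_betw_def)
  have hf: "h (f u) = u" if "u \<in> verts K" for u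
    using that inj by (simp add: h_def the_inv_into_f_f)
  have fh: "f (h t) = t" "h t \<in> verts K" if t: "t \<in> verts T" for t
  proof -
    obtain u where "u \<in> verts K" "t = f u" using t inj(2) by blast
    then show "f (h t) = t" "h t \<in> verts K" using hf by auto
  qed
  have eT: "e \<subseteq> verts T \<and> h ` e \<in> edges K" if e: "e \<in> edges T" for e
  proof -
    obtain a b where "e = {a, b}" "a \<in> verts T" "b \<in> verts T" using edgeE[OF e] .
    then show ?thesis using f(2)[of "h a" "h b"] fh e by auto
  qed
  have eK: "f ` e \<in> edges T \<and> h ` f ` e = e" if e: "e \<in> edges K" for e
  proof -
    obtain a b where "e = {a, b}" "a \<in> verts K" "b \<in> verts K" using simple_graph_edgeE[OF sK e] .
    then show ?thesis using f(2)[of a b] hf e by auto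
  qed
  have emb: "emb T (id \<circ> h) (\<lambda>e. P (h ` e))" using emb_iso[OF K'(2) h eT] .
  have hE: "(`) h ` edges T = edges K"
  proof
    show "(`) h ` edges T \<subseteq> edges K" using eT by blast
    show "edges K \<subseteq> (`) h ` edges T" using eK by (metis image_eqI subsetI)
  qed
  have img: "\<Union>((\<lambda>e. P (h ` e)) ` edges T) = edges S"
    unfolding K'(3)[symmetric] hE[symmetric] by (simp add: image_comp)
  have "(id \<circ> h) x = x" if x: "x \<in> leaves T" for x
  proof -
    have xT: "x \<in> verts T" using x by (simp add: leaves_def)
    have fin: "finite {e \<in> edges T. x \<in> e}" using finite_edges by simp
    have "inj_on ((`) f) {e \<in> edges K. h x \<in> e}"
      by (rule inj_onI) (metis (mono_tags, lifting) eK mem_Collect_eq)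
    moreover have "(`) f ` {e \<in> edges K. h x \<in> e} \<subseteq> {e \<in> edges T. x \<in> e}"
    proof
      fix k assume "k \<in> (`) f ` {e \<in> edges K. h x \<in> e}"
      then obtain e where e: "e \<in> edges K" "h x \<in> e" "k = f ` e" by blast
      have "f (h x) \<in> k" unfolding e(3) by (rule imageI[OF e(2)])
      then show "k \<in> {e \<in> edges T. x \<in> e}" using eK[OF e(1)] e(3) fh(1)[OF xT] by simp
    qed
    ultimately have "deg K (h x) \<le> deg T x" 
      unfolding deg_def using fin by (rule card_inj_on_le)
    then have "h x \<in> leaves K" using x fh(2)[OF xT] by (auto simp: leaves_def)
    then show ?thesis using f(3)[of "h x"] fh(1)[OF xT] by simp
  qed
  then show ?thesis using emb img unfolding embeds_def by metis
qed

section \<open>Operations on forests\<close>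

lemma phylo_forest_tree:
  assumes "phylo_forest X F" "T \<in> F"
  shows "phylo_tree (leaves T) T" "leaves T \<subseteq> X"
proof -
  obtain Y where Y: "phylo_tree Y T" using assms unfolding phylo_forest_def by blast
  then have "leaves T = Y" by (simp add: phylo_tree_def phylo_network_def)
  then show "phylo_tree (leaves T) T" using Y by simp
  show "leaves T \<subseteq> X" using assms unfolding phylo_forest_def by blast
qed

lemma phylo_forest_ptree: "phylo_forest X F \<Longrightarrow> T \<in> F \<Longrightarrow> ptree (leaves T) T"
  using phylo_forest_tree by (simp add: ptree_def)

lemma phylo_forest_unique:
  assumes "phylo_forest X F" "T \<in> F" "T' \<in> F" "x \<in> leaves T" "x \<in> leaves T'"
  shows "T = T'"
  using assms unfolding phylo_forest_def pairwise_def disjnt_def by blast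

lemma phylo_forest_ex:
  assumes "phylo_forest X F" "x \<in> X"
  obtains T where "T \<in> F" "x \<in> leaves T"
  using assms unfolding phylo_forest_def by blast

lemma phylo_forestI:
  assumes "finite X" "X \<noteq> {}" "\<And>T. T \<in> F \<Longrightarrow> phylo_tree (leaves T) T"
    "\<And>T T'. T \<in> F \<Longrightarrow> T' \<in> F \<Longrightarrow> T \<noteq> T' \<Longrightarrow> leaves T \<inter> leaves T' = {}" "(\<Union>T\<in>F. leaves T) = X"
  shows "phylo_forest X F"
  using assms unfolding phylo_forest_def pairwise_def disjnt_def by blast

lemma leaves_single_vertex: "leaves (single_vertex x) = {x}"
  by (auto simp: leaves_def single_vertex_def deg_def)

definition fembeds :: "'v graph set \<Rightarrow> ('v graph \<Rightarrow> 'v set set) \<Rightarrow> bool" where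
  "fembeds F I \<longleftrightarrow> (\<forall>T\<in>F. embeds T (I T)) \<and>
     (\<forall>T\<in>F. \<forall>T'\<in>F. T \<noteq> T' \<longrightarrow> \<Union>(I T) \<inter> \<Union>(I T') = {})"

lemma fembeds_subset: "fembeds F I \<Longrightarrow> F' \<subseteq> F \<Longrightarrow> fembeds F' I"
  unfolding fembeds_def by blast

lemma fembeds_insert:
  assumes "fembeds F I" "S \<notin> F" "embeds S J" "\<And>T. T \<in> F \<Longrightarrow> \<Union>(I T) \<inter> \<Union>J = {}"
  shows "fembeds (insert S F) (I(S := J))"
proof -
  have I: "(I(S := J)) T = I T" if "T \<in> F" for T using that assms(2) by auto
  have e: "embeds T (I T)" and d: "T' \<in> F \<Longrightarrow> T \<noteq> T' \<Longrightarrow> \<Union>(I T) \<inter> \<Union>(I T') = {}"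
    if "T \<in> F" for T T'
    using assms(1) that unfolding fembeds_def by simp_all
  show ?thesis
    unfolding fembeds_def
  proof (intro conjI ballI impI)
    fix T assume "T \<in> insert S F"
    then show "embeds T ((I(S := J)) T)" using assms(3) e I by (cases "T = S") auto
  next
    fix T T' assume TT: "T \<in> insert S F" "T' \<in> insert S F" "T \<noteq> T'"
    consider "T = S" "T' \<in> F" | "T' = S" "T \<in> F" | "T \<in> F" "T' \<in> F" using TT by blast
    then show "\<Union>((I(S := J)) T) \<inter> \<Union>((I(S := J)) T') = {}"
    proof cases
      case 1
      then show ?thesis using assms(4)[of T'] I[of T'] by (simp add: Int_commute)
    next
      case 2
      then show ?thesis using assms(4)[of T] I[of T] by simp
    next
      case 3
      then show ?thesis using d[of T T'] TT(3) I by simp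
    qed
  qed
qed

locale cut_forest =
  fixes X :: "'v set" and F :: "'v graph set" and T :: "'v graph" and s t :: 'v
  assumes F: "phylo_forest X F" and T: "T \<in> F" and st: "{s, t} \<in> edges T"
begin

sublocale pt: ptree "leaves T" T
  by (rule phylo_forest_ptree[OF F T])

lemma ts: "{t, s} \<in> edges T"
  using st by (simp add: insert_commute)

lemma minus_edge_eq: "forest_minus_edge F T {s, t} = (F - {T}) \<union> {prune T t s, prune T s t}"
  unfolding forest_minus_edge_def pt.suppressed_components[OF st] ..

lemma leaves_prunes:
  "leaves (prune T t s) \<noteq> {}" "leaves (prune T s t) \<noteq> {}"
  "leaves (prune T t s) \<union> leaves (prune T s t) = leaves T"
  "leaves (prune T t s) \<inter> leaves (prune T s t) = {}"
proof -
  note l = pt.leaves_prune[OF st] pt.leaves_prune[OF ts]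
  show "leaves (prune T t s) \<noteq> {}" "leaves (prune T s t) \<noteq> {}"
    unfolding l using pt.side_has_leaf[OF st] pt.side_has_leaf[OF ts] by auto
  show "leaves (prune T t s) \<union> leaves (prune T s t) = leaves T"
    unfolding l using pt.side_union[OF st] pt.Y_verts by blast
  show "leaves (prune T t s) \<inter> leaves (prune T s t) = {}"
    unfolding l using pt.side_disjoint[OF st] by blast
qed

lemma leaves_other: "T' \<in> F - {T} \<Longrightarrow> leaves T' \<inter> leaves T = {}"
  using phylo_forest_unique[OF F _ T] by blast

lemma prune_notin: "prune T t s \<notin> F - {T}" "prune T s t \<notin> F - {T}" "prune T t s \<noteq> prune T s t"
proof -
  show "prune T t s \<notin> F - {T}" "prune T s t \<notin> F - {T}"
    using leaves_other[of "prune T t s"] leaves_other[of "prune T s t"] leaves_prunes by blast+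
  show "prune T t s \<noteq> prune T s t" using leaves_prunes by auto
qed

lemma phylo_prunes:
  "phylo_tree (leaves (prune T t s)) (prune T t s)" "phylo_tree (leaves (prune T s t)) (prune T s t)"
  using pt.prune_phylo_tree[OF st] pt.leaves_prune[OF st]
    pt.prune_phylo_tree[OF ts] pt.leaves_prune[OF ts] by simp_all

lemma minus_edge_phylo: "phylo_forest X (forest_minus_edge F T {s, t})"
proof (rule phylo_forestI)
  show "finite X" "X \<noteq> {}" using F by (auto simp: phylo_forest_def)
  show "phylo_tree (leaves T') T'" if "T' \<in> forest_minus_edge F T {s, t}" for T'
    using that phylo_prunes phylo_forest_tree(1)[OF F] unfolding minus_edge_eq by blast
  show "leaves T1 \<inter> leaves T2 = {}"
    if T12: "T1 \<in> forest_minus_edge F T {s, t}" "T2 \<in> forest_minus_edge F T {s, t}" "T1 \<noteq> T2" for T1 T2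
  proof -
    have o: "leaves T1 \<inter> leaves T2 = {}"
      if "T1 \<in> F - {T}" "T2 \<in> {prune T t s, prune T s t}" for T1 T2
      using leaves_other[OF that(1)] that(2) leaves_prunes(3) by blast
    consider "T1 \<in> F - {T}" "T2 \<in> F - {T}" | "T1 \<in> F - {T}" "T2 \<in> {prune T t s, prune T s t}"
      | "T2 \<in> F - {T}" "T1 \<in> {prune T t s, prune T s t}"
      | "T1 \<in> {prune T t s, prune T s t}" "T2 \<in> {prune T t s, prune T s t}"
      using T12 unfolding minus_edge_eq by blast
    then show ?thesis
    proof cases
      case 1
      then show ?thesis using phylo_forest_unique[OF F, of T1 T2] that(3) by blast
    next
      case 2
      then show ?thesis by (rule o)
    next
      case 3
      then show ?thesis using o by blast
    next
      case 4
      then show ?thesis using leaves_prunes(4) that(3) by blast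
    qed
  qed
  have "(\<Union>T'\<in>forest_minus_edge F T {s, t}. leaves T') = (\<Union>T'\<in>F - {T}. leaves T') \<union> leaves T"
    unfolding minus_edge_eq using leaves_prunes(3) by auto
  also have "\<dots> = (\<Union>T'\<in>F. leaves T')" using T by blast
  also have "\<dots> = X" using F by (simp add: phylo_forest_def)
  finally show "(\<Union>T'\<in>forest_minus_edge F T {s, t}. leaves T') = X" .
qed

lemma cutside_images_disjoint:
  assumes "emb T \<phi> P"
  shows "\<Union>(\<Union>(P ` edges (cutside T t s))) \<inter> \<Union>(\<Union>(P ` edges (cutside T s t))) = {}"
proof (rule ccontr)
  assume "\<not> ?thesis"
  then obtain n e f g k where e: "e \<in> edges (cutside T t s)" "g \<in> P e" "n \<in> g"
    and f: "f \<in> edges (cutside T s t)" "k \<in> P f" "n \<in> k" by auto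
  have es: "e \<in> edges T" "e \<subseteq> side T t s" "f \<in> edges T" "f \<subseteq> side T s t"
    using e f by (auto simp: cutside_def)
  have "e \<noteq> {}" using pt.simple es(1) by (auto simp: simple_graph_def)
  then have "e \<noteq> f" using es pt.side_disjoint[OF st] by blast
  have i: "g \<in> inc (P e) n" "k \<in> inc (P f) n" using e f by (auto simp: inc_def)
  show False
  proof (cases "n \<in> \<phi> ` verts T")
    case True
    then obtain r where r: "r \<in> verts T" "n = \<phi> r" by blast
    then have "r \<in> e" "r \<in> f" using emb_inc_end(2)[OF assms r(1)] es i by blast+
    then show False using es pt.side_disjoint[OF st] by blast
  next
    case False
    then show False using embD(5)[OF assms False es(1,3) \<open>e \<noteq> f\<close>] i by blast
  qed
qed

lemma minus_edge_embeds:
  assumes "fembeds F I" "emb T \<phi> P" "\<forall>x\<in>leaves T. \<phi> x = x" "I T = \<Union>(P ` edges T)" "{} \<notin> I T"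
  shows "\<exists>I'. fembeds (forest_minus_edge F T {s, t}) I' \<and>
    \<Union>(I' ` forest_minus_edge F T {s, t}) \<subseteq> \<Union>(I ` F) - P {s, t}"
proof -
  define J1 where "J1 = \<Union>(P ` edges (cutside T t s))"
  define J2 where "J2 = \<Union>(P ` edges (cutside T s t))"
  have e1: "embeds (prune T t s) J1" unfolding J1_def by (rule pt.embeds_prune[OF assms(2,3) st])
  have e2: "embeds (prune T s t) J2" unfolding J2_def by (rule pt.embeds_prune[OF assms(2,3) ts])
  have sub: "J1 \<subseteq> I T - P {s, t}" "J2 \<subseteq> I T - P {s, t}"
  proof -
    have a: "P e \<subseteq> I T - P {s, t}" if "e \<in> edges T" "e \<noteq> {s, t}" for e
      using that embD(3)[OF assms(2) that(1) st that(2)] assms(4) by blast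
    show "J1 \<subseteq> I T - P {s, t}"
      unfolding J1_def by (rule UN_least, rule a) (auto simp: cutside_def)
    show "J2 \<subseteq> I T - P {s, t}"
      unfolding J2_def by (rule UN_least, rule a) (auto simp: cutside_def insert_commute)
  qed
  have disj: "\<Union>J1 \<inter> \<Union>J2 = {}" unfolding J1_def J2_def by (rule cutside_images_disjoint[OF assms(2)])
  have other: "\<Union>(I T') \<inter> \<Union>(I T) = {}" if "T' \<in> F - {T}" for T'
    using assms(1) that T unfolding fembeds_def by blast
  define I1 where "I1 = I(prune T t s := J1)"
  have f1: "fembeds (insert (prune T t s) (F - {T})) I1"
    unfolding I1_def
  proof (rule fembeds_insert[OF fembeds_subset[OF assms(1)] prune_notin(1) e1])
    fix T' assume "T' \<in> F - {T}"
    then show "\<Union>(I T') \<inter> \<Union>J1 = {}" using other sub(1) by blast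
  qed blast
  have I1: "I1 (prune T t s) = J1" "T' \<in> F - {T} \<Longrightarrow> I1 T' = I T'" for T'
    using prune_notin by (auto simp: I1_def)
  define I2 where "I2 = I1(prune T s t := J2)"
  have f2: "fembeds (insert (prune T s t) (insert (prune T t s) (F - {T}))) I2"
    unfolding I2_def
  proof (rule fembeds_insert[OF f1 _ e2])
    show "prune T s t \<notin> insert (prune T t s) (F - {T})" using prune_notin by auto
    fix T' assume "T' \<in> insert (prune T t s) (F - {T})"
    then show "\<Union>(I1 T') \<inter> \<Union>J2 = {}"
    proof
      assume "T' = prune T t s"
      then show ?thesis using I1(1) disj by simp
    next
      assume T': "T' \<in> F - {T}"
      then show ?thesis using other[OF T'] I1(2)[OF T'] sub(2) by auto
    qed
  qed
  have I2: "I2 (prune T t s) = J1" "I2 (prune T s t) = J2" "T' \<in> F - {T} \<Longrightarrow> I2 T' = I T'" for T'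
    using prune_notin I1 by (auto simp: I2_def)
  have eq: "forest_minus_edge F T {s, t} = insert (prune T s t) (insert (prune T t s) (F - {T}))"
    unfolding minus_edge_eq by blast
  have "g \<notin> P {s, t}" if g: "g \<in> I T'" "T' \<in> F - {T}" for g T'
  proof
    assume "g \<in> P {s, t}"
    then have gT: "g \<in> I T" using assms(4) st by blast
    then have "g \<noteq> {}" using assms(5) by blast
    then show False using other[OF g(2)] g(1) gT by blast
  qed
  then have "\<Union>(I ` (F - {T})) \<subseteq> \<Union>(I ` F) - P {s, t}" by blast
  moreover have "\<Union>(I2 ` forest_minus_edge F T {s, t}) = J2 \<union> J1 \<union> \<Union>(I ` (F - {T}))"
  proof -
    have "I2 ` (F - {T}) = I ` (F - {T})" using I2(3) by (rule image_cong[OF refl])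
    then show ?thesis unfolding eq using I2(1,2) by auto
  qed
  moreover have "J1 \<subseteq> \<Union>(I ` F) - P {s, t}" "J2 \<subseteq> \<Union>(I ` F) - P {s, t}" using sub T by blast+
  ultimately show ?thesis using f2 unfolding eq by (intro exI[of _ I2]) auto
qed

lemma minus_leaf_eq:
  assumes "t \<in> leaves T"
  shows "forest_minus_leaf F t = insert (prune T t s) (F - {T})"
proof -
  have "T \<noteq> single_vertex t" using st by (auto simp: single_vertex_def)
  have "{T' \<in> F. t \<notin> leaves T'} = F - {T}" using phylo_forest_unique[OF F _ T] assms by blast
  moreover have "{S. \<exists>T'\<in>F. t \<in> leaves T' \<and> T' \<noteq> single_vertex t \<and>
      suppresses_to (delete_vertex T' t) S} = {prune T t s}"
  proof -
    have "(\<exists>T'\<in>F. t \<in> leaves T' \<and> T' \<noteq> single_vertex t \<and> suppresses_to (delete_vertex T' t) S)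
      \<longleftrightarrow> suppresses_to (delete_vertex T t) S" for S
      using phylo_forest_unique[OF F _ T] assms T \<open>T \<noteq> single_vertex t\<close> by blast
    then show ?thesis using pt.delete_leaf_suppress(1)[OF st assms] by simp
  qed
  ultimately show ?thesis unfolding forest_minus_leaf_def by blast
qed

lemma minus_leaf_phylo:
  assumes "t \<in> leaves T"
  shows "phylo_forest (X - {t}) (forest_minus_leaf F t)"
    "\<forall>I. fembeds F I \<longrightarrow> (\<exists>I'. fembeds (forest_minus_leaf F t) I' \<and>
       \<Union>(I' ` forest_minus_leaf F t) \<subseteq> \<Union>(I ` F))"
proof -
  note eq = minus_leaf_eq[OF assms]
  have lp: "leaves (prune T t s) = leaves T - {t}"
    using pt.leaves_prune[OF st] pt.delete_leaf_suppress(2)[OF st assms] pt.Y_verts by blast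
  show "phylo_forest (X - {t}) (forest_minus_leaf F t)"
  proof (rule phylo_forestI)
    show "finite (X - {t})" using F by (auto simp: phylo_forest_def)
    show "X - {t} \<noteq> {}" using lp leaves_prunes(1) phylo_forest_tree(2)[OF F T] by blast
    show "phylo_tree (leaves T') T'" if "T' \<in> forest_minus_leaf F t" for T'
      using that phylo_prunes phylo_forest_tree(1)[OF F] unfolding eq by blast
    show "leaves T1 \<inter> leaves T2 = {}"
      if "T1 \<in> forest_minus_leaf F t" "T2 \<in> forest_minus_leaf F t" "T1 \<noteq> T2" for T1 T2
      using that leaves_other lp phylo_forest_unique[OF F] unfolding eq by blast
    have "(\<Union>T'\<in>F. leaves T') = X" using F by (simp add: phylo_forest_def)
    then have "(\<Union>T'\<in>F - {T}. leaves T') \<union> leaves T = X" using T by blast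
    moreover have "t \<notin> (\<Union>T'\<in>F - {T}. leaves T')" using leaves_other assms by blast
    ultimately show "(\<Union>T'\<in>forest_minus_leaf F t. leaves T') = X - {t}"
      unfolding eq using lp by auto
  qed
  show "\<forall>I. fembeds F I \<longrightarrow> (\<exists>I'. fembeds (forest_minus_leaf F t) I' \<and>
       \<Union>(I' ` forest_minus_leaf F t) \<subseteq> \<Union>(I ` F))"
  proof (intro allI impI)
    fix I assume I: "fembeds F I"
    then have "embeds T (I T)" using T by (simp add: fembeds_def)
    then obtain \<phi> P where P: "emb T \<phi> P" "\<forall>x\<in>leaves T. \<phi> x = x" "I T = \<Union>(P ` edges T)"
      unfolding embeds_def by (elim exE conjE)
    define J where "J = \<Union>(P ` edges (cutside T t s))"
    have e: "embeds (prune T t s) J" unfolding J_def by (rule pt.embeds_prune[OF P(1,2) st])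
    have sub: "J \<subseteq> I T" unfolding J_def P(3) by (auto simp: cutside_def)
    have "fembeds (insert (prune T t s) (F - {T})) (I(prune T t s := J))"
    proof (rule fembeds_insert[OF fembeds_subset[OF I] prune_notin(1) e])
      fix T' assume "T' \<in> F - {T}"
      then have "\<Union>(I T') \<inter> \<Union>(I T) = {}" using I T unfolding fembeds_def by blast
      then show "\<Union>(I T') \<inter> \<Union>J = {}" using sub by blast
    qed blast
    moreover have "\<Union>((I(prune T t s := J)) ` insert (prune T t s) (F - {T})) \<subseteq> \<Union>(I ` F)"
    proof -
      have "(I(prune T t s := J)) T' \<subseteq> \<Union>(I ` F)" if "T' \<in> insert (prune T t s) (F - {T})" for T'
        using that sub T by (auto split: if_splits)
      then show ?thesis by blast
    qed
    ultimately show "\<exists>I'. fembeds (forest_minus_leaf F t) I' \<and>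
       \<Union>(I' ` forest_minus_leaf F t) \<subseteq> \<Union>(I ` F)"
      unfolding eq by blast
  qed
qed

end

lemma minus_single_leaf:
  assumes "phylo_forest X F" "single_vertex x \<in> F" "X \<noteq> {x}"
  shows "forest_minus_leaf F x = F - {single_vertex x}"
    "phylo_forest (X - {x}) (forest_minus_leaf F x)"
proof -
  have un: "T = single_vertex x" if "T \<in> F" "x \<in> leaves T" for T
    using phylo_forest_unique[OF assms(1) that(1) assms(2) that(2)] by (simp add: leaves_single_vertex)
  have nx: "x \<notin> leaves T" if "T \<in> F - {single_vertex x}" for T using un that by blast
  show eq: "forest_minus_leaf F x = F - {single_vertex x}"
    unfolding forest_minus_leaf_def using un leaves_single_vertex[of x] by blast
  have X: "(\<Union>T\<in>F. leaves T) = X" using assms(1) by (simp add: phylo_forest_def)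
  have xX: "x \<in> X"
    using phylo_forest_tree(2)[OF assms(1,2)] by (simp add: leaves_single_vertex)
  show "phylo_forest (X - {x}) (forest_minus_leaf F x)"
  proof (rule phylo_forestI)
    show "finite (X - {x})" "X - {x} \<noteq> {}" using assms xX by (auto simp: phylo_forest_def)
    show "phylo_tree (leaves T) T" if "T \<in> forest_minus_leaf F x" for T
      using that phylo_forest_tree(1)[OF assms(1)] unfolding eq by blast
    show "leaves T1 \<inter> leaves T2 = {}"
      if "T1 \<in> forest_minus_leaf F x" "T2 \<in> forest_minus_leaf F x" "T1 \<noteq> T2" for T1 T2
      using that phylo_forest_unique[OF assms(1)] unfolding eq by blast
    show "(\<Union>T\<in>forest_minus_leaf F x. leaves T) = X - {x}"
      unfolding eq X[symmetric] using nx leaves_single_vertex[of x] by blast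
  qed
qed

lemma minus_leaf:
  assumes "phylo_forest X F" "x \<in> X" "X \<noteq> {x}" "fembeds F I"
  shows "phylo_forest (X - {x}) (forest_minus_leaf F x)"
    "\<exists>I'. fembeds (forest_minus_leaf F x) I' \<and> \<Union>(I' ` forest_minus_leaf F x) \<subseteq> \<Union>(I ` F)"
proof -
  obtain T where T: "T \<in> F" "x \<in> leaves T" using phylo_forest_ex[OF assms(1,2)] .
  interpret ptree "leaves T" T by (rule phylo_forest_ptree[OF assms(1) T(1)])
  have "phylo_forest (X - {x}) (forest_minus_leaf F x) \<and>
    (\<exists>I'. fembeds (forest_minus_leaf F x) I' \<and> \<Union>(I' ` forest_minus_leaf F x) \<subseteq> \<Union>(I ` F))"
  proof (cases "T = single_vertex x")
    case True
    then have s: "single_vertex x \<in> F" using T by simp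
    have "fembeds (F - {single_vertex x}) I" using assms(4) by (rule fembeds_subset) blast
    moreover have "\<Union>(I ` (F - {single_vertex x})) \<subseteq> \<Union>(I ` F)" by blast
    ultimately show ?thesis using minus_single_leaf[OF assms(1) s assms(3)] by metis
  next
    case False
    obtain s where "{x, s} \<in> edges T" using leaf_edge_ex[OF T(2) False] .
    then have "{s, x} \<in> edges T" by (simp add: insert_commute)
    then have "cut_forest X F T s x" using assms(1) T(1) by (intro cut_forest.intro)
    from cut_forest.minus_leaf_phylo[OF this T(2)] show ?thesis using assms(4) by blast
  qed
  then show "phylo_forest (X - {x}) (forest_minus_leaf F x)"
    "\<exists>I'. fembeds (forest_minus_leaf F x) I' \<and> \<Union>(I' ` forest_minus_leaf F x) \<subseteq> \<Union>(I ` F)" by blast+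
qed

section \<open>Pendant subtrees\<close>

context ptree
begin

lemma cherryI: "x \<noteq> y \<Longrightarrow> x \<in> Y \<Longrightarrow> y \<in> Y \<Longrightarrow> {v, x} \<in> edges T \<Longrightarrow> {v, y} \<in> edges T \<Longrightarrow> cherry T x y"
  unfolding cherry_def leaves by (auto simp: insert_commute)

lemma side_subsetI:
  assumes "s \<in> A" "\<And>e n. n \<in> A \<Longrightarrow> n \<in> e \<Longrightarrow> e \<in> edges T \<Longrightarrow> e \<noteq> {s, t} \<Longrightarrow> e \<subseteq> A"
  shows "side T t s \<subseteq> A"
proof
  fix n assume "n \<in> side T t s"
  then have "reach (edges T - {{s, t}}) s n" by (simp add: side_def)
  then show "n \<in> A" using assms(1) by (rule reach_closed) (use assms(2) in blast)
qed

lemma side_step: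
  assumes "{n, m} \<in> edges T" "{n, m} \<noteq> {s, t}" "n \<in> side T t s"
  shows "m \<in> side T t s"
  using side_closed[OF assms(1,2)] assms(3) by blast

lemma star_edge:
  "{e \<in> edges T. v \<in> e} = {{v, a}, {v, b}, {v, c}} \<Longrightarrow> e \<in> edges T \<Longrightarrow> v \<in> e \<Longrightarrow>
     e = {v, a} \<or> e = {v, b} \<or> e = {v, c}"
  by blast

context
  fixes x y v a c d :: 'v
  assumes xy: "x \<noteq> y" "x \<in> Y" "y \<in> Y" "{v, x} \<in> edges T" "{v, y} \<in> edges T"
    and a: "{a, v} \<in> edges T" "{a, c} \<in> edges T" "{a, d} \<in> edges T"
      "v \<noteq> c" "v \<noteq> d" "c \<noteq> d" "a \<noteq> x" "a \<noteq> y"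
begin

lemma star_v: "{e \<in> edges T. v \<in> e} = {{v, x}, {v, y}, {v, a}}"
  using xy a two_edges_inner[OF xy(4,5,1)] by (intro inner_star3) (auto simp: insert_commute)

lemma star_a: "{e \<in> edges T. a \<in> e} = {{a, v}, {a, c}, {a, d}}"
  using a two_edges_inner[OF a(1,2,4)] by (intro inner_star3) auto

lemma inner_va: "v \<notin> Y" "a \<notin> Y"
  using two_edges_inner[OF xy(4,5,1)] two_edges_inner[OF a(1,2,4)] by auto

lemma leaf_at: "z \<in> Y \<Longrightarrow> {n, z} \<in> edges T \<Longrightarrow> e \<in> edges T \<Longrightarrow> z \<in> e \<Longrightarrow> e = {n, z}"
  using leaf_edge_unique by blast

lemma in_side: "a \<in> side T d a" "v \<in> side T d a" "c \<in> side T d a" "x \<in> side T d a" "y \<in> side T d a"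
proof -
  show 1: "a \<in> side T d a" by (rule side_self)
  show 2: "v \<in> side T d a" by (rule side_step[OF a(1) _ 1]) (use a in \<open>auto simp: doubleton_eq_iff\<close>)
  show "c \<in> side T d a" by (rule side_step[OF a(2) _ 1]) (use a in \<open>auto simp: doubleton_eq_iff\<close>)
  have "v \<noteq> a" using edge[OF a(1)] by auto
  show "x \<in> side T d a" by (rule side_step[OF xy(4) _ 2]) (use \<open>v \<noteq> a\<close> a in \<open>auto simp: doubleton_eq_iff\<close>)
  show "y \<in> side T d a" by (rule side_step[OF xy(5) _ 2]) (use \<open>v \<noteq> a\<close> a in \<open>auto simp: doubleton_eq_iff\<close>)
qed

lemma leaf_ne: "z \<in> Y \<Longrightarrow> {n, z} \<in> edges T \<Longrightarrow> n \<noteq> v \<Longrightarrow> z \<noteq> x \<and> z \<noteq> y"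
  using leaf_at xy by (metis doubleton_eq_iff insertCI)

lemma cherry_prune: "cherry (prune T d a) x y"
proof -
  have va: "v \<noteq> a" using edge[OF a(1)] by auto
  have "{v, x} \<in> edges (prune T d a)" "{v, y} \<in> edges (prune T d a)"
    using prune_keeps_edge[OF a(3)] xy a in_side va by auto
  moreover have "x \<in> leaves (prune T d a)" "y \<in> leaves (prune T d a)"
    unfolding leaves_prune[OF a(3)] using xy in_side by auto
  ultimately show ?thesis using xy(1) unfolding cherry_def by (auto simp: insert_commute)
qed

lemma side_leaf_uncle:
  assumes "c \<in> Y"
  shows "side T d a = {a, v, c, x, y}"
proof
  show "side T d a \<subseteq> {a, v, c, x, y}"
  proof (rule side_subsetI)
    fix e n assume n: "n \<in> {a, v, c, x, y}" "n \<in> e" "e \<in> edges T" "e \<noteq> {a, d}"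
    then consider "n = a" | "n = v" | "n = c" | "n = x" | "n = y" by blast
    then show "e \<subseteq> {a, v, c, x, y}"
    proof cases
      case 1
      then show ?thesis using star_edge[OF star_a n(3)] n(2,4) by auto
    next
      case 2
      then show ?thesis using star_edge[OF star_v n(3)] n(2) by auto
    next
      case 3
      then show ?thesis using leaf_at[OF assms a(2) n(3)] n(2) by auto
    next
      case 4
      then show ?thesis using leaf_at[OF xy(2,4) n(3)] n(2) by auto
    next
      case 5
      then show ?thesis using leaf_at[OF xy(3,5) n(3)] n(2) by auto
    qed
  qed simp
  show "{a, v, c, x, y} \<subseteq> side T d a" using in_side by blast
qed

lemma pendant3_uncle:
  assumes "c \<in> Y"
  shows "pendant3 T {a, d} x y c"
proof -
  have va: "v \<noteq> a" using edge[OF a(1)] by auto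
  have "leaves (prune T d a) = {x, y, c}"
    unfolding leaves_prune[OF a(3)] side_leaf_uncle[OF assms] using assms xy inner_va by auto
  moreover have "distinct [x, y, c]" using xy(1) leaf_ne[OF assms a(2)] va by auto
  ultimately show ?thesis
    unfolding pendant3_def using proper_pendant_prune[OF a(3)] cherry_prune cherryI[OF xy] by blast
qed

context
  fixes p q :: 'v
  assumes pq: "p \<noteq> q" "p \<in> Y" "q \<in> Y" "p \<noteq> a" "q \<noteq> a" "{c, p} \<in> edges T" "{c, q} \<in> edges T"
begin

lemma star_c: "{e \<in> edges T. c \<in> e} = {{c, p}, {c, q}, {c, a}}"
  using pq a two_edges_inner[OF pq(6,7,1)] by (intro inner_star3) (auto simp: insert_commute)

lemma side_c: "side T a c = {c, p, q}"
proof
  show "side T a c \<subseteq> {c, p, q}"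
  proof (rule side_subsetI)
    fix e n assume n: "n \<in> {c, p, q}" "n \<in> e" "e \<in> edges T" "e \<noteq> {c, a}"
    then consider "n = c" | "n = p" | "n = q" by blast
    then show "e \<subseteq> {c, p, q}"
    proof cases
      case 1
      then show ?thesis using star_edge[OF star_c n(3)] n(2,4) by auto
    next
      case 2
      then show ?thesis using leaf_at[OF pq(2,6) n(3)] n(2) by auto
    next
      case 3
      then show ?thesis using leaf_at[OF pq(3,7) n(3)] n(2) by auto
    qed
  qed simp
  have c: "c \<in> side T a c" by (rule side_self)
  have "p \<in> side T a c" by (rule side_step[OF pq(6) _ c]) (use pq in \<open>auto simp: doubleton_eq_iff\<close>)
  moreover have "q \<in> side T a c" by (rule side_step[OF pq(7) _ c]) (use pq in \<open>auto simp: doubleton_eq_iff\<close>)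
  ultimately show "{c, p, q} \<subseteq> side T a c" using c by blast
qed

lemma pendant2_uncle: "pendant2 T {a, c} p q"
proof -
  have ca: "{c, a} \<in> edges T" using a(2) by (simp add: insert_commute)
  have "c \<notin> Y" using two_edges_inner[OF pq(6,7,1)] .
  then have "leaves (prune T a c) = {p, q}"
    unfolding leaves_prune[OF ca] side_c using pq by auto
  then show ?thesis
    unfolding pendant2_def using proper_pendant_prune[OF ca] pq(1) by (auto simp: insert_commute)
qed

lemma side_cherry_uncle: "side T d a = {a, v, c, x, y, p, q}"
proof
  have ac: "a \<noteq> c" using edge[OF a(2)] by auto
  show "side T d a \<subseteq> {a, v, c, x, y, p, q}"
  proof (rule side_subsetI)
    fix e n assume n: "n \<in> {a, v, c, x, y, p, q}" "n \<in> e" "e \<in> edges T" "e \<noteq> {a, d}"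
    then consider "n = a" | "n = v" | "n = c" | "n = x" | "n = y" | "n = p" | "n = q" by blast
    then show "e \<subseteq> {a, v, c, x, y, p, q}"
    proof cases
      case 1
      then show ?thesis using star_edge[OF star_a n(3)] n(2,4) by auto
    next
      case 2
      then show ?thesis using star_edge[OF star_v n(3)] n(2) by auto
    next
      case 3
      then show ?thesis using star_edge[OF star_c n(3)] n(2) by auto
    next
      case 4
      then show ?thesis using leaf_at[OF xy(2,4) n(3)] n(2) by auto
    next
      case 5
      then show ?thesis using leaf_at[OF xy(3,5) n(3)] n(2) by auto
    next
      case 6
      then show ?thesis using leaf_at[OF pq(2,6) n(3)] n(2) by auto
    next
      case 7
      then show ?thesis using leaf_at[OF pq(3,7) n(3)] n(2) by auto
    qed
  qed simp
  have "p \<in> side T d a"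
    by (rule side_step[OF pq(6) _ in_side(3)]) (use pq ac in \<open>auto simp: doubleton_eq_iff\<close>)
  moreover have "q \<in> side T d a"
    by (rule side_step[OF pq(7) _ in_side(3)]) (use pq ac in \<open>auto simp: doubleton_eq_iff\<close>)
  ultimately show "{a, v, c, x, y, p, q} \<subseteq> side T d a" using in_side by blast
qed

lemma pendant4_uncle: "pendant4 T {a, d} x y p q"
proof -
  have ac: "a \<noteq> c" using edge[OF a(2)] by auto
  have cY: "c \<notin> Y" using two_edges_inner[OF pq(6,7,1)] .
  have l: "leaves (prune T d a) = {x, y, p, q}"
    unfolding leaves_prune[OF a(3)] side_cherry_uncle using pq xy inner_va cY by auto
  have "distinct [x, y, p, q]"
    using xy(1) pq(1) leaf_ne[OF pq(2,6)] leaf_ne[OF pq(3,7)] a(4) by auto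
  moreover have "cherry (prune T d a) p q"
  proof -
    have "{c, p} \<in> edges (prune T d a)" "{c, q} \<in> edges (prune T d a)"
      using prune_keeps_edge[OF a(3)] pq a side_cherry_uncle ac by auto
    then show ?thesis using pq(1) l unfolding cherry_def by (auto simp: insert_commute)
  qed
  ultimately show ?thesis
    unfolding pendant4_def
    using l proper_pendant_prune[OF a(3)] cherry_prune cherryI[OF xy] cherryI[OF pq(1-3,6,7)] by blast
qed

end
end
end

section \<open>Paths in the image of a forest\<close>

definition pathlike :: "'v set set \<Rightarrow> 'v \<Rightarrow> 'v \<Rightarrow> bool" where
  "pathlike Q x y \<longleftrightarrow> finite Q \<and> x \<noteq> y \<and> card (inc Q x) = 1 \<and> card (inc Q y) = 1 \<and>
     (\<forall>n. n \<noteq> x \<longrightarrow> n \<noteq> y \<longrightarrow> inc Q n = {} \<or> card (inc Q n) = 2)"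

lemma double_count:
  assumes "finite V" "finite H"
  shows "(\<Sum>t\<in>V. card {h \<in> H. t \<in> h}) = (\<Sum>h\<in>H. card (h \<inter> V))"
proof -
  have "(\<Sum>t\<in>V. card {h \<in> H. t \<in> h}) = (\<Sum>t\<in>V. \<Sum>h\<in>H. if t \<in> h then 1 else 0)"
    using assms(2) by (simp add: sum.If_cases Int_def)
  also have "\<dots> = (\<Sum>h\<in>H. \<Sum>t\<in>V. if t \<in> h then 1 else 0)" by (rule sum.swap)
  also have "\<dots> = (\<Sum>h\<in>H. card (h \<inter> V))"
    using assms(1) by (simp add: sum.If_cases Int_def conj_commute)
  finally show ?thesis .
qed

lemma odd_one:
  assumes "finite C" "x \<in> C" "odd (f x)" "\<And>t. t \<in> C \<Longrightarrow> t \<noteq> x \<Longrightarrow> even (f t)"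
  shows "odd (\<Sum>t\<in>C. f t :: nat)"
proof -
  have "(\<Sum>t\<in>C. f t) = f x + (\<Sum>t\<in>C - {x}. f t)" using assms(1,2) by (rule sum.remove)
  moreover have "even (\<Sum>t\<in>C - {x}. f t)" using assms(4) by (intro dvd_sum) auto
  ultimately show ?thesis using assms(3) by simp
qed

lemma (in ptree) adjacent_leaves:
  assumes "{x, y} \<in> edges T" "x \<in> Y" "y \<in> Y"
  shows "verts T = {x, y}" "edges T = {{x, y}}" "cherry T x y"
proof -
  have yx: "{y, x} \<in> edges T" using assms(1) by (simp add: insert_commute)
  have "side T x y = verts T - {x}" using delete_leaf_suppress(2)[OF yx assms(2)] .
  moreover have "side T y x = verts T - {y}" using delete_leaf_suppress(2)[OF assms(1,3)] .
  ultimately show V: "verts T = {x, y}"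
    using side_disjoint[OF assms(1)] side_self[of x y] side_self[of y x] edge[OF assms(1)] by blast
  show E: "edges T = {{x, y}}"
  proof
    show "edges T \<subseteq> {{x, y}}"
    proof
      fix e assume e: "e \<in> edges T"
      then obtain a b where "e = {a, b}" "a \<noteq> b" "a \<in> verts T" "b \<in> verts T" by (rule edgeE)
      then show "e \<in> {{x, y}}" unfolding V by auto
    qed
  qed (use assms in simp)
  show "cherry T x y" unfolding cherry_def leaves using V E assms edge[OF assms(1)] by simp
qed

lemma (in ptree) cherry_cases:
  assumes "cherry T x y"
  obtains (pair) "{x, y} \<in> edges T" "{e \<in> edges T. x \<in> e \<or> y \<in> e} = {{x, y}}"
    | (inner) v where "{v, x} \<in> edges T" "{v, y} \<in> edges T" "v \<notin> Y"
      "{e \<in> edges T. x \<in> e \<or> y \<in> e} = {{v, x}, {v, y}}"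
proof -
  have xy: "x \<noteq> y" "x \<in> Y" "y \<in> Y" using assms by (simp_all add: cherry_def leaves)
  consider "verts T = {x, y}" "edges T = {{x, y}}" | v where "{x, v} \<in> edges T" "{y, v} \<in> edges T"
    using assms unfolding cherry_def by blast
  then show ?thesis
  proof cases
    case 1
    then show ?thesis by (intro pair) auto
  next
    case 2
    then have v: "{v, x} \<in> edges T" "{v, y} \<in> edges T" by (simp_all add: insert_commute)
    have "{e \<in> edges T. x \<in> e \<or> y \<in> e} = {{v, x}, {v, y}}"
      using v leaf_edge_unique[OF xy(2) _ v(1)] leaf_edge_unique[OF xy(3) _ v(2)] by blast
    then show ?thesis using inner[OF v two_edges_inner[OF v xy(1)]] by blast
  qed
qed

lemma cherry_sym: "cherry T x y \<Longrightarrow> cherry T y x"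
  unfolding cherry_def by (auto simp: insert_commute)

locale emb_forest =
  fixes X :: "'v set" and F :: "'v graph set" and \<phi> :: "'v graph \<Rightarrow> 'v \<Rightarrow> 'v"
    and P :: "'v graph \<Rightarrow> 'v set \<Rightarrow> 'v set set"
  assumes F: "phylo_forest X F"
    and emb: "T \<in> F \<Longrightarrow> emb T (\<phi> T) (P T)"
    and fix_leaf: "T \<in> F \<Longrightarrow> x \<in> leaves T \<Longrightarrow> \<phi> T x = x"
    and disjoint: "T \<in> F \<Longrightarrow> T' \<in> F \<Longrightarrow> T \<noteq> T' \<Longrightarrow>
      \<Union>(\<Union>(P T ` edges T)) \<inter> \<Union>(\<Union>(P T' ` edges T')) = {}"
    and no_single: "single_vertex x \<notin> F"
    and finite_img: "finite (\<Union>T\<in>F. \<Union>(P T ` edges T))"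
    and img_edges: "g \<in> (\<Union>T\<in>F. \<Union>(P T ` edges T)) \<Longrightarrow> card g = 2"
begin

definition E where "E = (\<Union>T\<in>F. \<Union>(P T ` edges T))"

definition is_img where "is_img n \<longleftrightarrow> (\<exists>T\<in>F. \<exists>t\<in>verts T. n = \<phi> T t)"

definition cpath where "cpath T x y = \<Union>(P T ` {e \<in> edges T. x \<in> e \<or> y \<in> e})"

lemma cpath_sym: "cpath T x y = cpath T y x"
  by (simp add: cpath_def disj_commute)

lemma ptree: "T \<in> F \<Longrightarrow> ptree (leaves T) T"
  using phylo_forest_ptree[OF F] .

lemma P_E: "T \<in> F \<Longrightarrow> h \<in> edges T \<Longrightarrow> P T h \<subseteq> E"
  unfolding E_def by blast

lemma finE: "finite E"
  unfolding E_def by (rule finite_img)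

lemma edge_nonempty: "g \<in> E \<Longrightarrow> g \<noteq> {}"
  using img_edges unfolding E_def by fastforce

lemma not_single: "T \<in> F \<Longrightarrow> T \<noteq> single_vertex x"
  using no_single by blast

lemma vertex_edge:
  assumes "T \<in> F" "t \<in> verts T"
  obtains e where "e \<in> edges T" "t \<in> e"
proof -
  interpret ptree "leaves T" T by (rule ptree[OF assms(1)])
  show ?thesis
  proof (cases "t \<in> leaves T")
    case True
    obtain s where "{t, s} \<in> edges T" using leaf_edge_ex[OF True not_single[OF assms(1)]] .
    then show ?thesis using that by blast
  next
    case False
    then have "card {e \<in> edges T. t \<in> e} = 3" using deg_inner[OF assms(2)] by (simp add: deg_def)
    then have "{e \<in> edges T. t \<in> e} \<noteq> {}" by (metis card.empty zero_neq_numeral)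
    then show ?thesis using that by blast
  qed
qed

lemma end_edge:
  assumes "T \<in> F" "h \<in> edges T" "t \<in> h"
  obtains g where "inc (P T h) (\<phi> T t) = {g}" "g \<in> P T h" "\<phi> T t \<in> g"
proof -
  interpret ptree "leaves T" T by (rule ptree[OF assms(1)])
  have "t \<in> verts T" using assms(2,3) simple by (auto simp: simple_graph_def)
  then obtain g where g: "inc (P T h) (\<phi> T t) = {g}"
    using emb_inc_end(1)[OF emb[OF assms(1)] _ assms(2,3)] by blast
  then have "g \<in> inc (P T h) (\<phi> T t)" by simp
  then show ?thesis using that g by (simp add: inc_def)
qed

lemma same_tree:
  assumes "T \<in> F" "T' \<in> F" "e \<in> edges T" "g \<in> P T e" "n \<in> g" "e' \<in> edges T'" "g' \<in> P T' e'" "n \<in> g'"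
  shows "T = T'"
proof (rule ccontr)
  assume "T \<noteq> T'"
  from disjoint[OF assms(1,2) this] show False using assms(3-8) by blast
qed

lemma img_in_tree:
  assumes "T \<in> F" "T' \<in> F" "t \<in> verts T" "e' \<in> edges T'" "g' \<in> P T' e'" "\<phi> T t \<in> g'"
  shows "T = T'" "t \<in> e'"
proof -
  obtain e where e: "e \<in> edges T" "t \<in> e" using vertex_edge[OF assms(1,3)] .
  obtain g where g: "g \<in> P T e" "\<phi> T t \<in> g" using end_edge[OF assms(1) e] by blast
  show eq: "T = T'" using same_tree[OF assms(1,2) e(1) g assms(4-6)] .
  have "g' \<in> inc (P T e') (\<phi> T t)" using assms(5,6) eq by (simp add: inc_def)
  moreover have "e' \<in> edges T" using assms(4) eq by simp
  ultimately show "t \<in> e'" using emb_inc_end(2)[OF emb[OF assms(1)] assms(3)] by blast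
qed

lemma \<phi>_inj:
  assumes "T \<in> F" "T' \<in> F" "t \<in> verts T" "t' \<in> verts T'" "\<phi> T t = \<phi> T' t'"
  shows "T = T'" "t = t'"
proof -
  obtain e where e: "e \<in> edges T'" "t' \<in> e" using vertex_edge[OF assms(2,4)] .
  obtain g where "g \<in> P T' e" "\<phi> T' t' \<in> g" using end_edge[OF assms(2) e] by blast
  then show eq: "T = T'" using img_in_tree(1)[OF assms(1,2,3) e(1), of g] assms(5) by simp
  show "t = t'" using embD(1)[OF emb[OF assms(1)]] assms(3-5) eq by (simp add: inj_on_def)
qed

lemma leaf_img:
  assumes "x \<in> X" "T \<in> F" "t \<in> verts T" "\<phi> T t = x"
  shows "t = x" "x \<in> leaves T"
proof -
  obtain T' where T': "T' \<in> F" "x \<in> leaves T'" using phylo_forest_ex[OF F assms(1)] .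
  have "x \<in> verts T'" using T'(2) by (simp add: leaves_def)
  then have "T = T'" "t = x"
    using \<phi>_inj[OF assms(2) T'(1) assms(3)] assms(4) fix_leaf[OF T'] by simp_all
  then show "t = x" "x \<in> leaves T" using T' by auto
qed

lemma inc_nonimg:
  assumes "T \<in> F" "e \<in> edges T" "n \<notin> \<phi> T ` verts T" "inc (P T e) n \<noteq> {}"
  shows "inc E n = inc (P T e) n" "card (inc E n) = 2"
proof -
  show eq: "inc E n = inc (P T e) n"
  proof
    show "inc (P T e) n \<subseteq> inc E n" using P_E[OF assms(1,2)] by (auto simp: inc_def)
    show "inc E n \<subseteq> inc (P T e) n"
    proof
      fix g assume "g \<in> inc E n"
      then obtain T' e' where g: "T' \<in> F" "e' \<in> edges T'" "g \<in> P T' e'" "n \<in> g"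
        by (auto simp: inc_def E_def)
      obtain g0 where g0: "g0 \<in> P T e" "n \<in> g0" using assms(4) by (auto simp: inc_def)
      have eq: "T' = T" using same_tree[OF g(1) assms(1) g(2-4) assms(2) g0] .
      have "e' = e"
      proof (rule ccontr)
        assume "e' \<noteq> e"
        then have "inc (P T e') n = {}"
          using embD(5)[OF emb[OF assms(1)] assms(3,2) _ _ assms(4)] g(2) eq by blast
        then show False using g eq by (auto simp: inc_def)
      qed
      then show "g \<in> inc (P T e) n" using g eq by (simp add: inc_def)
    qed
  qed
  show "card (inc E n) = 2" unfolding eq by (rule embD(4)[OF emb[OF assms(1)] assms(3,2,4)])
qed

lemma card_inc_nonimg:
  assumes "\<not> is_img n"
  shows "card (inc E n) \<le> 2"
proof (cases "inc E n = {}")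
  case False
  then obtain T e where "T \<in> F" "e \<in> edges T" "inc (P T e) n \<noteq> {}"
    by (auto simp: inc_def E_def)
  moreover have "n \<notin> \<phi> T ` verts T" using assms \<open>T \<in> F\<close> by (auto simp: is_img_def)
  ultimately show ?thesis using inc_nonimg(2)[of T e n] by simp
qed simp

lemma card_inc_sub:
  assumes "T \<in> F" "K \<subseteq> edges T" "t \<in> verts T"
  shows "card (inc (\<Union>(P T ` K)) (\<phi> T t)) = card {h \<in> K. t \<in> h}"
proof -
  define f where "f h = (THE g. inc (P T h) (\<phi> T t) = {g})" for h
  have f: "inc (P T h) (\<phi> T t) = {f h}" if h: "h \<in> K" "t \<in> h" for h
  proof -
    have "h \<in> edges T" using h assms(2) by blast
    then obtain g where g: "inc (P T h) (\<phi> T t) = {g}" using end_edge[OF assms(1) _ h(2)] by blast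
    then have "f h = g" unfolding f_def by simp
    then show ?thesis using g by simp
  qed
  have "inc (\<Union>(P T ` K)) (\<phi> T t) = (\<Union>h\<in>K. inc (P T h) (\<phi> T t))" by (auto simp: inc_def)
  also have "\<dots> = (\<Union>h\<in>{h \<in> K. t \<in> h}. inc (P T h) (\<phi> T t))"
    using emb_inc_end(2)[OF emb[OF assms(1)] assms(3)] assms(2) by blast
  also have "\<dots> = f ` {h \<in> K. t \<in> h}" using f by blast
  finally have "inc (\<Union>(P T ` K)) (\<phi> T t) = f ` {h \<in> K. t \<in> h}" .
  moreover have "inj_on f {h \<in> K. t \<in> h}"
  proof (rule inj_onI)
    fix h k assume hk: "h \<in> {h \<in> K. t \<in> h}" "k \<in> {h \<in> K. t \<in> h}" "f h = f k"
    then have "f h \<in> inc (P T h) (\<phi> T t)" "f h \<in> inc (P T k) (\<phi> T t)" using f by auto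
    then have "f h \<in> P T h \<inter> P T k" by (simp add: inc_def)
    then show "h = k" using embD(3)[OF emb[OF assms(1)], of h k] hk assms(2) by blast
  qed
  ultimately show ?thesis by (simp add: card_image)
qed

lemma inc_sub_nonimg:
  assumes "T \<in> F" "K \<subseteq> edges T" "n \<notin> \<phi> T ` verts T"
  shows "inc (\<Union>(P T ` K)) n = {} \<or> card (inc (\<Union>(P T ` K)) n) = 2"
proof (cases "inc (\<Union>(P T ` K)) n = {}")
  case False
  then obtain h where h: "h \<in> K" "inc (P T h) n \<noteq> {}" by (auto simp: inc_def)
  then have hT: "h \<in> edges T" using assms(2) by blast
  have "inc (\<Union>(P T ` K)) n \<subseteq> inc E n"
    using P_E[OF assms(1)] assms(2) by (auto simp: inc_def)
  moreover have "inc (P T h) n \<subseteq> inc (\<Union>(P T ` K)) n" using h(1) by (auto simp: inc_def)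
  ultimately show ?thesis using inc_nonimg[OF assms(1) hT assms(3) h(2)] by auto
qed simp

lemma cherry_path:
  assumes "T \<in> F" "cherry T x y"
  shows "cpath T x y \<subseteq> E" "pathlike (cpath T x y) x y"
    "\<And>T' t. T' \<in> F \<Longrightarrow> t \<in> verts T' \<Longrightarrow> inc (cpath T x y) (\<phi> T' t) \<noteq> {} \<Longrightarrow>
       T' = T \<and> (t = x \<or> t = y \<or> ({t, x} \<in> edges T \<and> {t, y} \<in> edges T))"
proof -
  interpret ptree "leaves T" T by (rule ptree[OF assms(1)])
  have xy: "x \<noteq> y" "x \<in> leaves T" "y \<in> leaves T" using assms(2) by (simp_all add: cherry_def)
  have xyv: "x \<in> verts T" "y \<in> verts T" using xy Y_verts by auto
  define K where "K = {e \<in> edges T. x \<in> e \<or> y \<in> e}"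
  have cp: "cpath T x y = \<Union>(P T ` K)" by (simp add: cpath_def K_def)
  have KT: "K \<subseteq> edges T" by (auto simp: K_def)
  show sub: "cpath T x y \<subseteq> E" unfolding cp using P_E[OF assms(1)] KT by blast
  have at: "card (inc (cpath T x y) (\<phi> T t)) = card {h \<in> K. t \<in> h}" if "t \<in> verts T" for t
    unfolding cp by (rule card_inc_sub[OF assms(1) KT that])
  have cnt: "card {h \<in> K. x \<in> h} = 1" "card {h \<in> K. y \<in> h} = 1"
    "t \<noteq> x \<Longrightarrow> t \<noteq> y \<Longrightarrow> {h \<in> K. t \<in> h} = {} \<or> card {h \<in> K. t \<in> h} = 2 \<and> {t, x} \<in> edges T \<and> {t, y} \<in> edges T" for t
  proof -
    have "card {h \<in> K. x \<in> h} = 1 \<and> card {h \<in> K. y \<in> h} = 1 \<and> (\<forall>t. t \<noteq> x \<longrightarrow> t \<noteq> y \<longrightarrow>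
      {h \<in> K. t \<in> h} = {} \<or> card {h \<in> K. t \<in> h} = 2 \<and> {t, x} \<in> edges T \<and> {t, y} \<in> edges T)"
      using assms(2)
    proof (cases rule: cherry_cases)
      case pair
      then have K: "K = {{x, y}}" by (simp add: K_def)
      have "{h \<in> K. x \<in> h} = {{x, y}}" "{h \<in> K. y \<in> h} = {{x, y}}" unfolding K by auto
      moreover have "{h \<in> K. t \<in> h} = {}" if "t \<noteq> x" "t \<noteq> y" for t unfolding K using that by auto
      ultimately show ?thesis by simp
    next
      case (inner v)
      then have K: "K = {{v, x}, {v, y}}" by (simp add: K_def)
      have vxy: "v \<noteq> x" "v \<noteq> y" using inner(3) xy by auto
      have "{h \<in> K. x \<in> h} = {{v, x}}" "{h \<in> K. y \<in> h} = {{v, y}}" unfolding K using vxy xy(1) by auto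
      moreover have "{h \<in> K. t \<in> h} = {}" if "t \<noteq> x" "t \<noteq> y" "t \<noteq> v" for t unfolding K using that by auto
      moreover have "{h \<in> K. v \<in> h} = {{v, x}, {v, y}}" unfolding K by auto
      moreover have "card {{v, x}, {v, y}} = 2" using xy(1) by (simp add: doubleton_eq_iff)
      ultimately show ?thesis using inner(1,2) by fastforce
    qed
    then show "card {h \<in> K. x \<in> h} = 1" "card {h \<in> K. y \<in> h} = 1"
    "t \<noteq> x \<Longrightarrow> t \<noteq> y \<Longrightarrow> {h \<in> K. t \<in> h} = {} \<or> card {h \<in> K. t \<in> h} = 2 \<and> {t, x} \<in> edges T \<and> {t, y} \<in> edges T"
      by blast+
  qed
  have finQ: "finite (cpath T x y)" using sub finE by (rule finite_subset)
  show "pathlike (cpath T x y) x y"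
    unfolding pathlike_def
  proof (intro conjI allI impI)
    show "finite (cpath T x y)" "x \<noteq> y" by fact+
    show "card (inc (cpath T x y) x) = 1" "card (inc (cpath T x y) y) = 1"
      using at[OF xyv(1)] at[OF xyv(2)] cnt fix_leaf[OF assms(1)] xy by simp_all
    fix n assume n: "n \<noteq> x" "n \<noteq> y"
    show "inc (cpath T x y) n = {} \<or> card (inc (cpath T x y) n) = 2"
    proof (cases "n \<in> \<phi> T ` verts T")
      case True
      then obtain t where t: "t \<in> verts T" "n = \<phi> T t" by blast
      have "t \<noteq> x" "t \<noteq> y" using n t fix_leaf[OF assms(1)] xy by auto
      then have "card (inc (cpath T x y) n) = 0 \<or> card (inc (cpath T x y) n) = 2"
        using cnt(3)[of t] at[OF t(1)] t(2) by (metis card.empty)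
      moreover have "finite (inc (cpath T x y) n)" using finQ by (rule finite_inc)
      ultimately show ?thesis by simp
    next
      case False
      then show ?thesis unfolding cp by (rule inc_sub_nonimg[OF assms(1) KT])
    qed
  qed
  fix T' t assume T': "T' \<in> F" "t \<in> verts T'" "inc (cpath T x y) (\<phi> T' t) \<noteq> {}"
  then obtain g h where g: "h \<in> K" "g \<in> P T h" "\<phi> T' t \<in> g" unfolding cp by (auto simp: inc_def)
  have "T' = T" "t \<in> h" using img_in_tree[OF T'(1) assms(1) T'(2) _ g(2,3)] g(1) KT by blast+
  then have "{h \<in> K. t \<in> h} \<noteq> {}" using g(1) by blast
  then show "T' = T \<and> (t = x \<or> t = y \<or> ({t, x} \<in> edges T \<and> {t, y} \<in> edges T))"
    using cnt(3)[of t] \<open>T' = T\<close> by blast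
qed

lemma all_or_none:
  assumes "Q \<subseteq> E" "pathlike Q x y" "x \<in> X" "y \<in> X" "T \<in> F" "h \<in> edges T"
  shows "P T h \<subseteq> Q \<or> P T h \<inter> Q = {}"
proof (cases "Q \<inter> P T h = {}")
  case False
  have "Q \<inter> P T h = P T h"
  proof (rule emb_path_connected[OF emb[OF assms(5)] assms(6) _ False])
    fix g g' n assume g: "g \<in> Q \<inter> P T h" "g' \<in> P T h" "n \<in> g" "n \<in> g'" "n \<notin> \<phi> T ` verts T"
    have ne: "n \<noteq> z" if z: "z \<in> X" for z
    proof
      assume "n = z"
      obtain Tz where Tz: "Tz \<in> F" "z \<in> leaves Tz" using phylo_forest_ex[OF F z] .
      have zv: "z \<in> verts Tz" using Tz(2) by (simp add: leaves_def)
      have "\<phi> Tz z \<in> g'" using fix_leaf[OF Tz] g(4) \<open>n = z\<close> by simp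
      then have "Tz = T" using img_in_tree(1)[OF Tz(1) assms(5) zv assms(6) g(2)] by blast
      then show False using g(5) fix_leaf[OF Tz] zv \<open>n = z\<close> by (metis imageI)
    qed
    have i: "g \<in> inc Q n" "g' \<in> inc (P T h) n" using g by (simp_all add: inc_def)
    then have c: "card (inc Q n) = 2"
      using assms(2) ne[OF assms(3)] ne[OF assms(4)] unfolding pathlike_def by blast
    have "inc (P T h) n \<noteq> {}" using i by blast
    note e = inc_nonimg[OF assms(5,6) g(5) this]
    have "inc Q n \<subseteq> inc E n" using assms(1) by (auto simp: inc_def)
    moreover have "finite (inc E n)" using finE by (rule finite_inc)
    ultimately have "inc Q n = inc E n" using c e(2) by (intro card_subset_eq) simp_all
    then show "g' \<in> Q \<inter> P T h" using i e(1) g(2) by (auto simp: inc_def)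
  qed blast
  then show ?thesis by blast
qed blast

definition lift where "lift T Q = {h \<in> edges T. P T h \<subseteq> Q}"

lemma card_lift:
  assumes "Q \<subseteq> E" "pathlike Q x y" "x \<in> X" "y \<in> X" "T \<in> F" "t \<in> verts T"
  shows "card {h \<in> lift T Q. t \<in> h} = card (inc Q (\<phi> T t))"
proof -
  have "inc (\<Union>(P T ` lift T Q)) (\<phi> T t) = inc Q (\<phi> T t)"
  proof
    show "inc (\<Union>(P T ` lift T Q)) (\<phi> T t) \<subseteq> inc Q (\<phi> T t)" by (auto simp: inc_def lift_def)
    show "inc Q (\<phi> T t) \<subseteq> inc (\<Union>(P T ` lift T Q)) (\<phi> T t)"
    proof
      fix g assume g: "g \<in> inc Q (\<phi> T t)"
      then have "g \<in> E" "\<phi> T t \<in> g" "g \<in> Q" using assms(1) by (auto simp: inc_def)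
      then obtain T' h where h: "T' \<in> F" "h \<in> edges T'" "g \<in> P T' h" by (auto simp: E_def)
      have "T' = T" using img_in_tree(1)[OF assms(5) h(1) assms(6) h(2,3) \<open>\<phi> T t \<in> g\<close>] by simp
      then have "h \<in> lift T Q"
        using all_or_none[OF assms(1-5), of h] h \<open>g \<in> Q\<close> by (auto simp: lift_def)
      then show "g \<in> inc (\<Union>(P T ` lift T Q)) (\<phi> T t)"
        using h \<open>T' = T\<close> \<open>\<phi> T t \<in> g\<close> by (auto simp: inc_def)
    qed
  qed
  moreover have "lift T Q \<subseteq> edges T" by (auto simp: lift_def)
  ultimately show ?thesis using card_inc_sub[OF assms(5) _ assms(6), of "lift T Q"] by simp
qed

lemma lift_count:
  assumes "Q \<subseteq> E" "pathlike Q x y" "x \<in> X" "y \<in> X" "T \<in> F" "t \<in> verts T" "t \<noteq> x" "t \<noteq> y"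
    "h \<in> lift T Q" "t \<in> h"
  shows "card {h \<in> lift T Q. t \<in> h} = 2" "t \<notin> leaves T" "card (inc Q (\<phi> T t)) = 2"
proof -
  interpret ptree "leaves T" T by (rule ptree[OF assms(5)])
  have fin: "finite {h \<in> lift T Q. t \<in> h}" using finite_edges by (simp add: lift_def)
  have ne: "\<phi> T t \<noteq> x" "\<phi> T t \<noteq> y"
    using leaf_img(1)[OF assms(3,5,6)] leaf_img(1)[OF assms(4,5,6)] assms(7,8) by blast+
  note c = card_lift[OF assms(1-6)]
  have "{h \<in> lift T Q. t \<in> h} \<noteq> {}" using assms(9,10) by blast
  then have "card (inc Q (\<phi> T t)) \<noteq> 0" using c fin by (metis card_0_eq)
  then show 2: "card (inc Q (\<phi> T t)) = 2"
    using assms(2) ne unfolding pathlike_def by (metis card.empty)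
  then show c2: "card {h \<in> lift T Q. t \<in> h} = 2" using c by simp
  show "t \<notin> leaves T"
  proof
    assume "t \<in> leaves T"
    then have "deg T t \<le> 1" by (rule deg_leaf)
    moreover have "card {h \<in> lift T Q. t \<in> h} \<le> deg T t"
      unfolding deg_def using finite_edges by (intro card_mono) (auto simp: lift_def)
    ultimately show False using c2 by simp
  qed
qed

lemma lift_leaf:
  assumes "Q \<subseteq> E" "pathlike Q x y" "x \<in> X" "y \<in> X" "T \<in> F" "x \<in> leaves T" "h \<in> edges T" "x \<in> h"
  shows "h \<in> lift T Q"
proof -
  interpret ptree "leaves T" T by (rule ptree[OF assms(5)])
  have "card {h \<in> lift T Q. x \<in> h} = 1"
    using card_lift[OF assms(1-5) Y_verts[OF assms(6)]] fix_leaf[OF assms(5,6)] assms(2)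
    by (simp add: pathlike_def)
  then obtain k where "k \<in> lift T Q" "x \<in> k" by (auto simp: card_1_singleton_iff)
  then show ?thesis using leaf_edge_unique[OF assms(6) _ assms(7), of k] assms(8) by (auto simp: lift_def)
qed

text \<open>The component of \<open>x\<close> in the lifted path contains an even number of vertices of odd degree,
  hence also \<open>y\<close>.\<close>

lemma lift_reach:
  assumes "Q \<subseteq> E" "pathlike Q x y" "x \<in> X" "y \<in> X" "T \<in> F" "x \<in> leaves T"
  shows "y \<in> leaves T" "reach (lift T Q) x y"
proof -
  interpret ptree "leaves T" T by (rule ptree[OF assms(5)])
  define H where "H = lift T Q"
  define C where "C = {n. reach H x n}"
  have HT: "H \<subseteq> edges T" by (auto simp: H_def lift_def)
  have CV: "C \<subseteq> verts T"
  proof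
    fix n assume "n \<in> C"
    then have "reach H x n" by (simp add: C_def)
    then show "n \<in> verts T" using Y_verts[OF assms(6)]
      by (rule reach_closed) (use HT simple in \<open>auto simp: simple_graph_def\<close>)
  qed
  have finC: "finite C" using CV finite_verts by (rule finite_subset)
  have finH: "finite H" using HT finite_edges by (rule finite_subset)
  have "even (card (h \<inter> C))" if h: "h \<in> H" for h
  proof (cases "h \<inter> C = {}")
    case False
    have hT: "h \<in> edges T" using h HT by blast
    obtain m where m: "m \<in> h" "m \<in> C" using False by blast
    obtain n where n: "h = {m, n}" "m \<noteq> n" using edge_at[OF hT m(1)] .
    have "n \<in> C" using m(2) h n(1) by (auto simp: C_def intro: reach_step)
    then have "h \<inter> C = {m, n}" using m n by auto
    then show ?thesis using n(2) by simp
  qed simp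
  then have "even (\<Sum>h\<in>H. card (h \<inter> C))" by (intro dvd_sum) blast
  then have ev: "even (\<Sum>t\<in>C. card {h \<in> H. t \<in> h})" using double_count[OF finC finH] by simp
  have cl: "card {h \<in> H. t \<in> h} = card (inc Q (\<phi> T t))" if "t \<in> verts T" for t
    unfolding H_def by (rule card_lift[OF assms(1-5) that])
  have xC: "x \<in> C" by (simp add: C_def)
  have ox: "odd (card {h \<in> H. x \<in> h})"
    using cl[OF Y_verts[OF assms(6)]] fix_leaf[OF assms(5,6)] assms(2) by (simp add: pathlike_def)
  have evt: "even (card {h \<in> H. t \<in> h})" if "t \<in> verts T" "t \<noteq> x" "\<phi> T t \<noteq> y" for t
  proof -
    have "\<phi> T t \<noteq> x" using leaf_img(1)[OF assms(3,5) that(1)] that(2) by blast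
    then have "inc Q (\<phi> T t) = {} \<or> card (inc Q (\<phi> T t)) = 2"
      using assms(2) that(3) unfolding pathlike_def by blast
    then show ?thesis using cl[OF that(1)] by auto
  qed
  have "\<exists>t\<in>C. \<phi> T t = y"
  proof (rule ccontr)
    assume "\<not> ?thesis"
    then have "even (card {h \<in> H. t \<in> h})" if "t \<in> C" "t \<noteq> x" for t using evt that CV by blast
    then have "odd (\<Sum>t\<in>C. card {h \<in> H. t \<in> h})" 
      by (rule odd_one[where f = "\<lambda>t. card {h \<in> H. t \<in> h}", OF finC xC ox])
    then show False using ev by blast
  qed
  then obtain t where t: "t \<in> C" "\<phi> T t = y" by blast
  then have "t = y" "y \<in> leaves T" using leaf_img[OF assms(4,5), of t] CV by blast+
  then show "y \<in> leaves T" "reach (lift T Q) x y" using t(1) by (simp_all add: C_def H_def)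
qed

lemma path_in_closed_set:
  assumes "\<And>g. g \<in> E \<Longrightarrow> g \<noteq> e0 \<Longrightarrow> g \<inter> W \<noteq> {} \<Longrightarrow> g \<subseteq> W"
    and "T \<in> F" "h \<in> edges T" "e0 \<notin> P T h" "s \<in> h" "\<phi> T s \<in> W" "g \<in> P T h"
  shows "g \<subseteq> W"
proof -
  obtain g0 where g0: "g0 \<in> P T h" "\<phi> T s \<in> g0" using end_edge[OF assms(2,3,5)] by blast
  have cl: "k \<subseteq> W" if "k \<in> P T h" "k \<inter> W \<noteq> {}" for k
    using assms(1)[of k] that P_E[OF assms(2,3)] assms(4) by blast
  have "{k \<in> P T h. k \<subseteq> W} = P T h"
  proof (rule emb_path_connected[OF emb[OF assms(2)] assms(3)])
    show "{k \<in> P T h. k \<subseteq> W} \<noteq> {}" using cl[OF g0(1)] g0 assms(6) by blast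
    fix k k' n assume "k \<in> {k \<in> P T h. k \<subseteq> W}" "k' \<in> P T h" "n \<in> k" "n \<in> k'"
    then show "k' \<in> {k \<in> P T h. k \<subseteq> W}" using cl[of k'] by blast
  qed blast
  then show ?thesis using assms(7) by blast
qed

lemma end_in_closed_set:
  assumes "\<And>g. g \<in> E \<Longrightarrow> g \<noteq> e0 \<Longrightarrow> g \<inter> W \<noteq> {} \<Longrightarrow> g \<subseteq> W"
    and "T \<in> F" "h \<in> edges T" "e0 \<notin> P T h" "s \<in> h" "\<phi> T s \<in> W" "t \<in> h"
  shows "\<phi> T t \<in> W"
proof -
  obtain g where "g \<in> P T h" "\<phi> T t \<in> g" using end_edge[OF assms(2,3,7)] by blast
  then show ?thesis using path_in_closed_set[OF assms(1-6)] by blast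
qed

lemma side_in_closed_set:
  assumes "\<And>g. g \<in> E \<Longrightarrow> g \<noteq> e0 \<Longrightarrow> g \<inter> W \<noteq> {} \<Longrightarrow> g \<subseteq> W"
    and "T \<in> F" "\<And>h. h \<in> edges T \<Longrightarrow> h \<noteq> {s, t} \<Longrightarrow> e0 \<notin> P T h" "\<phi> T s \<in> W" "n \<in> side T t s"
  shows "\<phi> T n \<in> W"
proof -
  have "reach (edges T - {{s, t}}) s n" using assms(5) by (simp add: side_def)
  then show ?thesis
  proof (induction rule: reach_induct)
    case (step y z)
    then show ?case using end_in_closed_set[OF assms(1,2), where h = "{y, z}" and s = y and t = z] assms(3) by auto
  qed (rule assms(4))
qed

lemma tree_in_closed_set:
  assumes "\<And>g. g \<in> E \<Longrightarrow> g \<noteq> e0 \<Longrightarrow> g \<inter> W \<noteq> {} \<Longrightarrow> g \<subseteq> W"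
    and "T \<in> F" "\<And>h. h \<in> edges T \<Longrightarrow> e0 \<notin> P T h" "s \<in> verts T" "\<phi> T s \<in> W" "n \<in> verts T"
  shows "\<phi> T n \<in> W"
proof -
  interpret ptree "leaves T" T by (rule ptree[OF assms(2)])
  have "reach (edges T) s n" using connected assms(4,6) .
  then show ?thesis
  proof (induction rule: reach_induct)
    case (step y z)
    then show ?case using end_in_closed_set[OF assms(1,2), where h = "{y, z}" and s = y and t = z] assms(3) by auto
  qed (rule assms(5))
qed

lemma bridge_ends:
  assumes "\<And>g. g \<in> E \<Longrightarrow> g \<noteq> e0 \<Longrightarrow> g \<inter> W \<noteq> {} \<Longrightarrow> g \<subseteq> W"
    and "T \<in> F" "h \<in> edges T" "e0 \<in> P T h" "e0 = {u0, v0}" "u0 \<in> W" "v0 \<notin> W"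
  obtains s t where "h = {s, t}" "\<phi> T s \<in> W" "\<phi> T t \<notin> W"
proof -
  interpret ptree "leaves T" T by (rule ptree[OF assms(2)])
  obtain s t where st: "h = {s, t}" "s \<noteq> t" "s \<in> verts T" "t \<in> verts T" using edgeE[OF assms(3)] .
  have emT: "emb T (\<phi> T) (P T)" by (rule emb[OF assms(2)])
  define U where "U = W \<inter> \<Union>(P T h)"
  have finP: "finite (P T h)" using embD(2)[OF emT assms(3)] .
  have c2: "card g = 2" if "g \<in> P T h" for g
    using img_edges[of g] subsetD[OF P_E[OF assms(2,3)] that] by (simp add: E_def)
  have finU: "finite U"
  proof -
    have "finite g" if "g \<in> P T h" for g using c2[OF that] by (metis card.infinite zero_neq_numeral)
    then show ?thesis unfolding U_def using finP by blast
  qed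
  have gU: "g \<inter> U = (if g = e0 then {u0} else if g \<subseteq> W then g else {})" if "g \<in> P T h" for g
    using that assms(1)[of g] assms(4-7) P_E[OF assms(2,3)] by (auto simp: U_def)
  have "odd (\<Sum>g\<in>P T h. card (g \<inter> U))"
  proof (rule odd_one[OF finP assms(4)])
    show "odd (card (e0 \<inter> U))" using gU[OF assms(4)] by simp
    fix g assume "g \<in> P T h" "g \<noteq> e0"
    then show "even (card (g \<inter> U))" using gU[of g] c2[of g] by simp
  qed
  then have od: "odd (\<Sum>n\<in>U. card {g \<in> P T h. n \<in> g})" using double_count[OF finU finP] by simp
  have eq: "{g \<in> P T h. n \<in> g} = inc (P T h) n" for n by (simp add: inc_def)
  have one: "card {g \<in> P T h. \<phi> T s \<in> g} = 1" "card {g \<in> P T h. \<phi> T t \<in> g} = 1"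
    unfolding eq embD(6)[OF emT st(3) assms(3)] embD(6)[OF emT st(4) assms(3)] using st(1) by simp_all
  have evn: "even (card {g \<in> P T h. n \<in> g})" if n: "n \<noteq> \<phi> T s" "n \<noteq> \<phi> T t" for n
  proof (cases "n \<in> \<phi> T ` verts T")
    case True
    then obtain r where r: "r \<in> verts T" "n = \<phi> T r" by blast
    then have "r \<notin> h" using n st(1) by blast
    then show ?thesis unfolding eq r(2) embD(6)[OF emT r(1) assms(3)] by simp
  next
    case False
    then have "inc (P T h) n = {} \<or> card (inc (P T h) n) = 2"
      using embD(4)[OF emT False assms(3)] by blast
    then show ?thesis unfolding eq by auto
  qed
  have inj: "\<phi> T s \<noteq> \<phi> T t" using embD(1)[OF emT] st by (auto simp: inj_on_def)
  have inU: "\<phi> T s \<in> U \<longleftrightarrow> \<phi> T s \<in> W" "\<phi> T t \<in> U \<longleftrightarrow> \<phi> T t \<in> W"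
  proof -
    have "\<phi> T r \<in> \<Union>(P T h)" if r: "r \<in> h" for r
      using end_edge[OF assms(2,3) r] by blast
    then show "\<phi> T s \<in> U \<longleftrightarrow> \<phi> T s \<in> W" "\<phi> T t \<in> U \<longleftrightarrow> \<phi> T t \<in> W" using st(1) by (auto simp: U_def)
  qed
  consider "\<phi> T s \<in> W" "\<phi> T t \<in> W" | "\<phi> T s \<notin> W" "\<phi> T t \<notin> W" | "\<phi> T s \<in> W" "\<phi> T t \<notin> W"
    | "\<phi> T s \<notin> W" "\<phi> T t \<in> W" by blast
  then show ?thesis
  proof cases
    case 1
    then have UU: "\<phi> T s \<in> U" "\<phi> T t \<in> U - {\<phi> T s}" using inU inj by auto
    have "(\<Sum>n\<in>U. card {g \<in> P T h. n \<in> g}) = card {g \<in> P T h. \<phi> T s \<in> g} +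
      (\<Sum>n\<in>U - {\<phi> T s}. card {g \<in> P T h. n \<in> g})" using finU UU(1) by (rule sum.remove)
    moreover have "odd (\<Sum>n\<in>U - {\<phi> T s}. card {g \<in> P T h. n \<in> g})"
    proof (rule odd_one[OF _ UU(2)])
      show "finite (U - {\<phi> T s})" using finU by simp
      show "odd (card {g \<in> P T h. \<phi> T t \<in> g})" using one(2) by simp
      fix n assume "n \<in> U - {\<phi> T s}" "n \<noteq> \<phi> T t"
      then show "even (card {g \<in> P T h. n \<in> g})" using evn[of n] by simp
    qed
    ultimately show ?thesis using od one(1) by simp
  next
    case 2
    have "even (card {g \<in> P T h. n \<in> g})" if n: "n \<in> U" for n
    proof -
      have "n \<noteq> \<phi> T s" "n \<noteq> \<phi> T t" using n 2 inU by auto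
      then show ?thesis by (rule evn)
    qed
    then have "even (\<Sum>n\<in>U. card {g \<in> P T h. n \<in> g})" by (intro dvd_sum) blast
    then show ?thesis using od by blast
  next
    case 3
    then show ?thesis using that st(1) by blast
  next
    case 4
    then show ?thesis using that[of t s] st(1) by (simp add: insert_commute)
  qed
qed

end

section \<open>A step of type (C2) that lowers the nullity\<close>

definition nonbridge :: "'v set set \<Rightarrow> 'v set \<Rightarrow> bool" where
  "nonbridge G g \<longleftrightarrow> (\<exists>u v. g = {u, v} \<and> reach (G - {g}) u v)"

lemma off_path_edge_exclusive:
  assumes "emb_forest X F \<phi> P" "emb_forest X F' \<phi>' P'"
    "Q \<subseteq> emb_forest.E F P" "Q \<subseteq> emb_forest.E F' P'" "pathlike Q x y" "x \<in> X" "y \<in> X" "T \<in> F'"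
    "card (inc Q (\<phi>' T a)) = 2" "\<not> emb_forest.is_img F \<phi> (\<phi>' T a)" "h \<in> edges T" "a \<in> h"
    "h \<notin> emb_forest.lift P' T Q"
  obtains g where "g \<in> P' T h" "\<phi>' T a \<in> g" "g \<notin> emb_forest.E F P"
proof -
  interpret A: emb_forest X F \<phi> P by fact
  interpret B: emb_forest X F' \<phi>' P' by fact
  obtain g where g: "g \<in> P' T h" "\<phi>' T a \<in> g" using B.end_edge[OF assms(8,11,12)] by blast
  have "g \<notin> Q"
    using B.all_or_none[OF assms(4,5-8,11)] assms(11,13) g(1) by (auto simp: B.lift_def)
  have "g \<notin> A.E"
  proof
    assume "g \<in> A.E"
    then have sub: "insert g (inc Q (\<phi>' T a)) \<subseteq> inc A.E (\<phi>' T a)"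
      using g(2) assms(3) by (auto simp: inc_def)
    have "finite (inc Q (\<phi>' T a))" using assms(5) by (simp add: pathlike_def finite_inc)
    moreover have "g \<notin> inc Q (\<phi>' T a)" using \<open>g \<notin> Q\<close> by (simp add: inc_def)
    ultimately have "card (insert g (inc Q (\<phi>' T a))) = 3" using assms(9) by simp
    moreover have "card (insert g (inc Q (\<phi>' T a))) \<le> card (inc A.E (\<phi>' T a))"
      using sub A.finE by (intro card_mono finite_inc)
    ultimately show False using A.card_inc_nonimg[OF assms(10)] by simp
  qed
  then show ?thesis using that g by blast
qed

locale emb_pair =
  A: emb_forest X F \<phi> P + B: emb_forest X F' \<phi>' P'
  for X :: "'v set" and F F' \<phi> \<phi>' P P' +
  fixes W :: "'v set" and e0 :: "'v set"
  assumes no_common: "\<not> (forest_cherry F x y \<and> forest_cherry F' x y)"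
    and W_closed: "g \<in> A.E \<union> B.E \<Longrightarrow> g \<noteq> e0 \<Longrightarrow> g \<inter> W \<noteq> {} \<Longrightarrow> g \<subseteq> W"
    and W_nonbridge: "g \<in> A.E \<union> B.E \<Longrightarrow> g \<noteq> e0 \<Longrightarrow> g \<inter> W \<noteq> {} \<Longrightarrow> g \<notin> A.E \<inter> B.E \<Longrightarrow>
      nonbridge (A.E \<union> B.E) g"
    and e0: "e0 \<notin> B.E"
begin

definition good_step where
  "good_step \<longleftrightarrow> (\<exists>x\<in>X. \<exists>G G'. C2 x F F' G G' \<and>
     (G' = F' \<and> (\<exists>T\<in>F. \<exists>h\<in>edges T. \<exists>g\<in>P T h. g \<notin> B.E \<and> nonbridge (A.E \<union> B.E) g \<and>
        G = forest_minus_edge F T h) \<or>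
      G = F \<and> (\<exists>T\<in>F'. \<exists>h\<in>edges T. \<exists>g\<in>P' T h. g \<notin> A.E \<and> nonbridge (A.E \<union> B.E) g \<and>
        G' = forest_minus_edge F' T h)))"

lemma good_stepA:
  assumes "C2_oriented x F F' (forest_minus_edge F T h) F'" "x \<in> X" "T \<in> F" "h \<in> edges T"
    "g \<in> P T h" "g \<notin> B.E" "g \<inter> W \<noteq> {}" "g \<noteq> e0"
  shows good_step
proof -
  have "g \<in> A.E" using A.P_E[OF assms(3,4)] assms(5) by blast
  then have "nonbridge (A.E \<union> B.E) g" using W_nonbridge[of g] assms(6-8) by blast
  moreover have "C2 x F F' (forest_minus_edge F T h) F'" using assms(1) by (simp add: C2_def)
  ultimately show ?thesis unfolding good_step_def using assms(2-6) by blast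
qed

lemma good_stepB:
  assumes "C2 x F F' F (forest_minus_edge F' T h)" "x \<in> X" "T \<in> F'" "h \<in> edges T"
    "g \<in> P' T h" "g \<notin> A.E" "g \<inter> W \<noteq> {}"
  shows good_step
proof -
  have "g \<in> B.E" using B.P_E[OF assms(3,4)] assms(5) by blast
  then have "nonbridge (A.E \<union> B.E) g" using W_nonbridge[of g] assms(6,7) e0 by blast
  then show ?thesis unfolding good_step_def using assms(1-6) by blast
qed

lemma A_closed: "g \<in> A.E \<Longrightarrow> g \<noteq> e0 \<Longrightarrow> g \<inter> W \<noteq> {} \<Longrightarrow> g \<subseteq> W"
  using W_closed by blast

lemma B_closed: "g \<in> B.E \<Longrightarrow> g \<noteq> e0 \<Longrightarrow> g \<inter> W \<noteq> {} \<Longrightarrow> g \<subseteq> W"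
  using W_closed by blast

lemma B_e0: "T \<in> F' \<Longrightarrow> h \<in> edges T \<Longrightarrow> e0 \<notin> P' T h"
  using e0 B.P_E by blast

lemma leafA: "T \<in> F \<Longrightarrow> x \<in> leaves T \<Longrightarrow> x \<in> X"
  using phylo_forest_tree(2)[OF A.F] by blast

lemma leafB: "T \<in> F' \<Longrightarrow> x \<in> leaves T \<Longrightarrow> x \<in> X"
  using phylo_forest_tree(2)[OF B.F] by blast

lemma cut_cherry_leaf:
  assumes "T \<in> F" "cherry T x y"
    "cuts_leaf_edge F x G \<or> cuts_leaf_edge F y G"
  shows "\<exists>x'\<in>{x, y}. C2_oriented x' F F' G F'"
proof -
  have c: "forest_cherry F x y" "forest_cherry F y x"
    using assms(1) assms(2) cherry_sym[OF assms(2)] unfolding forest_cherry_def by blast+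
  have xy: "x \<in> leaves T" "y \<in> leaves T" using assms(2) by (simp_all add: cherry_def)
  obtain Tx where Tx: "Tx \<in> F'" "x \<in> leaves Tx" using phylo_forest_ex[OF B.F leafA[OF assms(1) xy(1)]] .
  obtain Ty where Ty: "Ty \<in> F'" "y \<in> leaves Ty" using phylo_forest_ex[OF B.F leafA[OF assms(1) xy(2)]] .
  have n: "\<not> forest_cherry F' x y" "\<not> forest_cherry F' y x" using no_common c by blast+
  consider (a) z where "forest_cherry F' x z" | (a') z where "forest_cherry F' y z"
    | (bc) "\<nexists>z. forest_cherry F' x z" "\<nexists>z. forest_cherry F' y z" by blast
  then show ?thesis
  proof cases
    case a
    then have "\<exists>z. z \<noteq> y \<and> forest_cherry F' x z" using n by metis
    then have "C2a x y F F' G F'" unfolding C2a_def using assms(3) by blast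
    then show ?thesis using c unfolding C2_oriented_def by blast
  next
    case a'
    then have "\<exists>z. z \<noteq> x \<and> forest_cherry F' y z" using n by metis
    then have "C2a y x F F' G F'" unfolding C2a_def using assms(3) by blast
    then show ?thesis using c unfolding C2_oriented_def by blast
  next
    case bc
    show ?thesis
    proof (cases "Tx = Ty")
      case True
      then have "C2b x y F F' G F'"
        unfolding C2b_def using Tx Ty bc assms(3) unfolding forest_cherry_def by blast
      then show ?thesis using c unfolding C2_oriented_def by blast
    next
      case False
      then have "C2c x y F F' G F'"
        unfolding C2c_def using Tx Ty bc assms(3) B.no_single by blast
      then show ?thesis using c unfolding C2_oriented_def by blast
    qed
  qed
qed

lemma branch_step:
  assumes "T \<in> F" "cherry T x y" "A.cpath T x y \<subseteq> B.E" "x \<in> W"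
    and T': "T' \<in> F'" "x \<in> leaves T'" "y \<in> leaves T'"
    and nc: "\<nexists>z. forest_cherry F' x z" "\<nexists>z. forest_cherry F' y z"
    and w: "{x, w} \<in> edges T'" "\<not> A.is_img (\<phi>' T' w)"
  shows good_step
proof -
  let ?Q = "A.cpath T x y"
  interpret t: ptree "leaves T'" T' by (rule B.ptree[OF T'(1)])
  have QA: "?Q \<subseteq> A.E" and pl: "pathlike ?Q x y" using A.cherry_path[OF assms(1,2)] by blast+
  have X: "x \<in> X" "y \<in> X" using leafB[OF T'(1)] T'(2,3) by auto
  have wv: "w \<in> verts T'" "w \<noteq> x" using t.edge[OF w(1)] by auto
  have "w \<noteq> y"
  proof
    assume "w = y"
    then have "cherry T' x y" using t.adjacent_leaves(3) w(1) T'(2,3) by blast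
    then show False using nc(1) T'(1) unfolding forest_cherry_def by blast
  qed
  have xl: "{x, w} \<in> B.lift T' ?Q"
    using B.lift_leaf[OF assms(3) pl X T'(1,2) w(1)] by blast
  have w2: "card {h \<in> B.lift T' ?Q. w \<in> h} = 2" "w \<notin> leaves T'" "card (inc ?Q (\<phi>' T' w)) = 2"
    using B.lift_count[OF assms(3) pl X T'(1) wv \<open>w \<noteq> y\<close> xl] by auto
  have "card {h \<in> edges T'. w \<in> h} = 3" using t.deg_inner[OF wv(1) w2(2)] by (simp add: deg_def)
  then have "{h \<in> edges T'. w \<in> h} \<noteq> {h \<in> B.lift T' ?Q. w \<in> h}" using w2(1) by (metis numeral_eq_iff semiring_norm(88,89))
  then obtain h where h: "h \<in> edges T'" "w \<in> h" "h \<notin> B.lift T' ?Q" by (auto simp: B.lift_def)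
  obtain g where g: "g \<in> P' T' h" "\<phi>' T' w \<in> g" "g \<notin> A.E"
    using off_path_edge_exclusive[OF A.emb_forest_axioms B.emb_forest_axioms QA assms(3) pl X T'(1)
      w2(3) w(2) h] .
  have "\<phi>' T' x \<in> W" using B.fix_leaf[OF T'(1,2)] assms(4) by simp
  then have "\<phi>' T' w \<in> W"
    using B.end_in_closed_set[OF B_closed T'(1) w(1) B_e0[OF T'(1) w(1)], of x w] by blast
  then have gW: "g \<inter> W \<noteq> {}" using g(2) by blast
  have "reach (B.lift T' ?Q) x y" using B.lift_reach(2)[OF assms(3) pl X T'(1,2)] .
  then obtain p where p: "path_between T' x p y" "successively (\<lambda>u v. {u, v} \<in> B.lift T' ?Q) p"
    using reach_imp_path[of "B.lift T' ?Q" x y T'] t.Y_verts[OF T'(2)] t.simple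
    by (auto simp: B.lift_def simple_graph_def)
  have "h \<notin> path_edges p" using path_edges_subset[OF p(2)] h(3) by blast
  then have "\<exists>e\<in>edges T'. \<exists>v p. {x, v} \<in> edges T' \<and> v \<in> e \<and> path_between T' x p y \<and> e \<notin> path_edges p \<and>
       forest_minus_edge F' T' h = forest_minus_edge F' T' e \<and> F = F"
    using h(1,2) w(1) p(1) by blast
  then have "C2b x y F F' F (forest_minus_edge F' T' h)"
    unfolding C2b_def using T' nc unfolding forest_cherry_def by blast
  moreover have "forest_cherry F x y" using assms(1,2) unfolding forest_cherry_def by blast
  ultimately have "C2 x F F' F (forest_minus_edge F' T' h)"
    unfolding C2_def C2_oriented_def by blast
  then show ?thesis using good_stepB[OF _ X(1) T'(1) h(1) g(1,3) gW] by blast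
qed

lemma cherry_step:
  assumes "T \<in> F" "cherry T x y" "x \<in> W" "y \<in> W"
    "\<And>h. h \<in> edges T \<Longrightarrow> x \<in> h \<or> y \<in> h \<Longrightarrow> e0 \<notin> P T h"
  obtains good_step
    | x1 y1 z T' where "x1 = x \<and> y1 = y \<or> x1 = y \<and> y1 = x" "T' \<in> F'" "cherry T' x1 z"
      "A.cpath T x1 y1 \<subseteq> B.E" "B.cpath T' x1 z \<subseteq> A.E"
proof -
  note good = that(1) and situation = that(2)
  have xy: "x \<noteq> y" "x \<in> leaves T" "y \<in> leaves T" using assms(2) by (simp_all add: cherry_def)
  have X: "x \<in> X" "y \<in> X" using leafA[OF assms(1)] xy by auto
  have fxy: "\<phi> T x = x" "\<phi> T y = y" using A.fix_leaf[OF assms(1)] xy by auto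
  show ?thesis
  proof (cases "A.cpath T x y \<subseteq> B.E")
    case False
    then obtain g h where g: "h \<in> edges T" "x \<in> h \<or> y \<in> h" "g \<in> P T h" "g \<notin> B.E"
      by (auto simp: A.cpath_def)
    have eh: "e0 \<notin> P T h" using assms(5) g(1,2) by blast
    have "g \<subseteq> W"
      using g(2) A.path_in_closed_set[OF A_closed assms(1) g(1) eh _ _ g(3)] fxy assms(3,4) by metis
    moreover have "g \<noteq> {}" using A.edge_nonempty A.P_E[OF assms(1) g(1)] g(3) by blast
    ultimately have gW: "g \<inter> W \<noteq> {}" by blast
    have "cuts_leaf_edge F x (forest_minus_edge F T h) \<or> cuts_leaf_edge F y (forest_minus_edge F T h)"
      using g(1,2) assms(1) xy unfolding cuts_leaf_edge_def by blast
    from cut_cherry_leaf[OF assms(1,2) this]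
    obtain x' where x': "x' \<in> {x, y}" "C2_oriented x' F F' (forest_minus_edge F T h) F'" ..
    have "x' \<in> X" using x'(1) X by auto
    moreover have "g \<noteq> e0" using eh g(3) by blast
    ultimately show ?thesis using good_stepA[OF x'(2) _ assms(1) g(1,3,4) gW] good by blast
  next
    case QB: True
    note cp = A.cherry_path[OF assms(1,2)]
    obtain T' where T': "T' \<in> F'" "x \<in> leaves T'" using phylo_forest_ex[OF B.F X(1)] .
    have yT': "y \<in> leaves T'" using B.lift_reach(1)[OF QB cp(2) X T'] .
    have sub: thesis if c: "x1 = x \<and> y1 = y \<or> x1 = y \<and> y1 = x" "forest_cherry F' x1 z" for x1 y1 z
    proof -
      obtain T1 where T1: "T1 \<in> F'" "cherry T1 x1 z" using c(2) unfolding forest_cherry_def by blast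
      have x1: "x1 \<in> X" "x1 \<in> W" "x1 \<in> leaves T1" "z \<in> leaves T1" "x1 \<noteq> z"
        using c(1) X assms(3,4) T1(2) by (auto simp: cherry_def)
      have ch: "cherry T x1 y1" using c(1) assms(2) cherry_sym[OF assms(2)] by auto
      then have fc: "forest_cherry F x1 y1" using assms(1) unfolding forest_cherry_def by blast
      have Q1: "A.cpath T x1 y1 \<subseteq> B.E" using c(1) QB A.cpath_sym by auto
      show thesis
      proof (cases "B.cpath T1 x1 z \<subseteq> A.E")
        case True
        then show ?thesis using situation[OF c(1) T1 Q1] by blast
      next
        case False
        then obtain g h where g: "h \<in> edges T1" "x1 \<in> h \<or> z \<in> h" "g \<in> P' T1 h" "g \<notin> A.E"
          by (auto simp: B.cpath_def)
        interpret t: ptree "leaves T1" T1 by (rule B.ptree[OF T1(1)])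
        have "\<phi>' T1 x1 \<in> W" using B.fix_leaf[OF T1(1) x1(3)] x1(2) by simp
        then have inW: "\<phi>' T1 n \<in> W" if "n \<in> verts T1" for n
          using B.tree_in_closed_set[OF B_closed T1(1) B_e0[OF T1(1)] t.Y_verts[OF x1(3)] _ that] by blast
        obtain r where r: "r \<in> h" "r \<in> verts T1" using g(2) t.Y_verts x1(3,4) by blast
        have "g \<subseteq> W"
          using B.path_in_closed_set[OF B_closed T1(1) g(1) B_e0[OF T1(1) g(1)] r(1) inW[OF r(2)] g(3)] by blast
        moreover have "g \<noteq> {}" using B.edge_nonempty B.P_E[OF T1(1) g(1)] g(3) by blast
        ultimately have gW: "g \<inter> W \<noteq> {}" by blast
        have "cuts_leaf_edge F' x1 (forest_minus_edge F' T1 h) \<or> cuts_leaf_edge F' z (forest_minus_edge F' T1 h)"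
          using g(1,2) T1(1) x1 unfolding cuts_leaf_edge_def by blast
        moreover have "y1 \<noteq> z" using fc c(2) no_common by blast
        then have "\<exists>y. y \<noteq> z \<and> forest_cherry F x1 y" using fc by metis
        ultimately have "C2a x1 z F' F (forest_minus_edge F' T1 h) F"
          unfolding C2a_def by blast
        then have "C2 x1 F F' F (forest_minus_edge F' T1 h)"
          unfolding C2_def C2_oriented_def using c(2) by blast
        then show ?thesis using good_stepB[OF _ x1(1) T1(1) g(1,3,4) gW] good by blast
      qed
    qed
    consider (a) z where "forest_cherry F' x z" | (a') z where "forest_cherry F' y z"
      | (b) "\<nexists>z. forest_cherry F' x z" "\<nexists>z. forest_cherry F' y z" by blast
    then show ?thesis
    proof cases
      case a
      then show ?thesis using sub[of x y z] by blast
    next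
      case a'
      then show ?thesis using sub[of y x z] by blast
    next
      case b
      interpret t: ptree "leaves T'" T' by (rule B.ptree[OF T'(1)])
      obtain wx where wx: "{x, wx} \<in> edges T'" using t.leaf_edge_ex[OF T'(2) B.not_single[OF T'(1)]] .
      obtain wy where wy: "{y, wy} \<in> edges T'" using t.leaf_edge_ex[OF yT' B.not_single[OF T'(1)]] .
      have nch: "\<not> cherry T' x y" using b T'(1) unfolding forest_cherry_def by blast
      have "wx \<noteq> wy"
      proof
        assume "wx = wy"
        then have "cherry T' x y"
          using t.cherryI[of x y wx] xy(1) T'(2) yT' wx wy by (simp add: insert_commute)
        then show False using nch by blast
      qed
      have "\<not> A.is_img (\<phi>' T' wx) \<or> \<not> A.is_img (\<phi>' T' wy)"
      proof (rule ccontr)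
        assume "\<not> ?thesis"
        then have im: "A.is_img (\<phi>' T' wx)" "A.is_img (\<phi>' T' wy)" by auto
        have key: "\<exists>v. \<phi>' T' w = \<phi> T v \<and> {v, x} \<in> edges T \<and> {v, y} \<in> edges T"
          if w: "{r, w} \<in> edges T'" "A.is_img (\<phi>' T' w)" and r: "r = x \<or> r = y" for r w
        proof -
          have rT: "r \<in> leaves T'" "r \<in> X" using r T'(2) yT' X by auto
          have wv: "w \<in> verts T'" "w \<noteq> r" using t.edge[OF w(1)] by auto
          have pls: "pathlike (A.cpath T x y) y x" using cp(2) by (auto simp: pathlike_def)
          have rl: "{r, w} \<in> B.lift T' (A.cpath T x y)"
            using r B.lift_leaf[OF QB cp(2) X T' w(1)] B.lift_leaf[OF QB pls X(2,1) T'(1) yT' w(1)] w(1)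
            by auto
          have wne: "w \<noteq> x" "w \<noteq> y"
          proof -
            have "\<not> (w \<in> leaves T')"
            proof
              assume wl: "w \<in> leaves T'"
              then have "cherry T' r w" using t.adjacent_leaves(3)[OF w(1) rT(1)] by blast
              then show False using b r T'(1) unfolding forest_cherry_def by blast
            qed
            then show "w \<noteq> x" "w \<noteq> y" using T'(2) yT' by auto
          qed
          have c2: "card (inc (A.cpath T x y) (\<phi>' T' w)) = 2"
            using B.lift_count(3)[OF QB cp(2) X T'(1) wv(1) wne rl] by blast
          obtain T2 v where v: "T2 \<in> F" "v \<in> verts T2" "\<phi>' T' w = \<phi> T2 v"
            using w(2) by (auto simp: A.is_img_def)
          have "inc (A.cpath T x y) (\<phi> T2 v) \<noteq> {}" using c2 v(3) by auto
          from cp(3)[OF v(1,2) this]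
          have o: "T2 = T" "v = x \<or> v = y \<or> ({v, x} \<in> edges T \<and> {v, y} \<in> edges T)" by blast+
          have "card (inc (A.cpath T x y) x) = 1" "card (inc (A.cpath T x y) y) = 1"
            using cp(2) by (auto simp: pathlike_def)
          then have "\<phi> T v \<noteq> x" "\<phi> T v \<noteq> y" using c2 v(3) o(1) by auto
          then have "v \<noteq> x" "v \<noteq> y" using fxy by auto
          then show ?thesis using o v(3) by blast
        qed
        obtain v where v: "\<phi>' T' wx = \<phi> T v" "{v, x} \<in> edges T" using key[OF wx im(1)] by blast
        obtain v2 where v2: "\<phi>' T' wy = \<phi> T v2" "{v2, x} \<in> edges T" using key[OF wy im(2)] by blast
        interpret a: ptree "leaves T" T by (rule A.ptree[OF assms(1)])
        have "{v, x} = {v2, x}" using a.leaf_edge_unique[OF xy(2) v(2) v2(2)] by blast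
        then have "v = v2" by (auto simp: doubleton_eq_iff)
        then have "\<phi>' T' wx = \<phi>' T' wy" using v v2 by simp
        then have "wx = wy" using B.\<phi>_inj(2)[OF T'(1) T'(1)] t.edge[OF wx] t.edge[OF wy] by blast
        then show False using \<open>wx \<noteq> wy\<close> by blast
      qed
      then have good_step
      proof
        assume "\<not> A.is_img (\<phi>' T' wx)"
        then show ?thesis using branch_step[OF assms(1,2) QB assms(3) T' yT' b wx] by blast
      next
        assume n: "\<not> A.is_img (\<phi>' T' wy)"
        have "A.cpath T y x \<subseteq> B.E" using QB A.cpath_sym by simp
        then show ?thesis
          using branch_step[OF assms(1) cherry_sym[OF assms(2)] _ assms(4) T'(1) yT' T'(2) b(2,1) wy n] by blast
      qed
      then show ?thesis by (rule good)
    qed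
  qed
qed

text \<open>The three edges at the branching vertex of the cherry \<open>(x, y)\<close> all lie in both images, so this
  is also the branching vertex of \<open>(x, z)\<close>; no other vertex of \<open>T\<close> on the path from \<open>x\<close> to \<open>z\<close> can
  then be a branching vertex of \<open>F'\<close>.\<close>

lemma common_cherry_paths:
  assumes "T \<in> F" "cherry T x y" "T' \<in> F'" "cherry T' x z"
    and QB: "A.cpath T x y \<subseteq> B.E" and QA: "B.cpath T' x z \<subseteq> A.E"
  obtains v a where "{v, x} \<in> edges T" "{v, y} \<in> edges T" "{v, a} \<in> edges T" "a \<noteq> x" "a \<noteq> y"
    "v \<notin> leaves T" "a \<notin> leaves T" "{v, a} \<in> A.lift T (B.cpath T' x z)"
    "\<And>b h. b \<in> verts T \<Longrightarrow> b \<noteq> v \<Longrightarrow> b \<notin> leaves T \<Longrightarrow> h \<in> A.lift T (B.cpath T' x z) \<Longrightarrow> b \<in> h \<Longrightarrow>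
       card {k \<in> A.lift T (B.cpath T' x z). b \<in> k} = 2"
    "\<And>b h h'. b \<in> verts T \<Longrightarrow> b \<noteq> v \<Longrightarrow> b \<notin> leaves T \<Longrightarrow> h \<in> A.lift T (B.cpath T' x z) \<Longrightarrow> b \<in> h \<Longrightarrow>
       h' \<in> edges T \<Longrightarrow> b \<in> h' \<Longrightarrow> h' \<notin> A.lift T (B.cpath T' x z) \<Longrightarrow>
       \<exists>g\<in>P T h'. \<phi> T b \<in> g \<and> g \<notin> B.E"
    "\<And>b h. b \<in> leaves T \<Longrightarrow> h \<in> A.lift T (B.cpath T' x z) \<Longrightarrow> b \<in> h \<Longrightarrow> b = x \<or> b = z"
proof -
  let ?Q = "A.cpath T x y" and ?R = "B.cpath T' x z"
  let ?H = "A.lift T ?R"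
  interpret a: ptree "leaves T" T by (rule A.ptree[OF assms(1)])
  interpret b: ptree "leaves T'" T' by (rule B.ptree[OF assms(3)])
  have xy: "x \<noteq> y" "x \<in> leaves T" "y \<in> leaves T" using assms(2) by (simp_all add: cherry_def)
  have xz: "x \<noteq> z" "x \<in> leaves T'" "z \<in> leaves T'" using assms(4) by (simp_all add: cherry_def)
  have X: "x \<in> X" "y \<in> X" "z \<in> X" using leafA[OF assms(1)] leafB[OF assms(3)] xy xz by auto
  have fx: "\<phi> T x = x" "\<phi> T y = y" "\<phi>' T' x = x" "\<phi>' T' z = z"
    using A.fix_leaf[OF assms(1)] B.fix_leaf[OF assms(3)] xy xz by auto
  have fc: "forest_cherry F x y" "forest_cherry F' x z"
    using assms(1-4) unfolding forest_cherry_def by blast+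
  then have yz: "y \<noteq> z" using no_common by blast
  note cp = B.cherry_path[OF assms(3,4)]
  note cq = A.cherry_path[OF assms(1,2)]
  have cnt: "card {k \<in> ?H. b \<in> k} = 2" "b \<notin> leaves T" "card (inc ?R (\<phi> T b)) = 2"
    if "b \<in> verts T" "b \<noteq> x" "b \<noteq> z" "h \<in> ?H" "b \<in> h" for b h
    using A.lift_count[OF QA cp(2) X(1,3) assms(1) that] by auto
  have leafH: "b = x \<or> b = z" if "b \<in> leaves T" "h \<in> ?H" "b \<in> h" for b h
    using cnt(2)[of b h] that a.Y_verts by blast
  have xH: "h \<in> ?H" if "h \<in> edges T" "x \<in> h" for h
    using A.lift_leaf[OF QA cp(2) X(1,3) assms(1) xy(2) that] .
  have yH: "h \<notin> ?H" if "y \<in> h" for h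
    using leafH[OF xy(3) _ that] xy(1) yz by blast
  obtain v where v: "{v, x} \<in> edges T" "{v, y} \<in> edges T" "v \<notin> leaves T"
    using assms(2)
  proof (cases rule: a.cherry_cases)
    case pair
    then show ?thesis using xH[of "{x, y}"] yH[of "{x, y}"] by blast
  qed blast
  have zT: "z \<in> leaves T" using A.lift_reach(1)[OF QA cp(2) X(1,3) assms(1) xy(2)] .
  have vv: "v \<in> verts T" "v \<noteq> x" "v \<noteq> z" using a.edge[OF v(1)] v(3) zT by auto
  obtain s1 s2 where s12: "s1 \<noteq> s2" "s1 \<noteq> x" "s2 \<noteq> x" "{e \<in> edges T. v \<in> e} = {{v, x}, {v, s1}, {v, s2}}"
    using a.inner_star[OF v(3,1)] .
  obtain a where a: "a \<noteq> x" "a \<noteq> y" "{e \<in> edges T. v \<in> e} = {{v, x}, {v, y}, {v, a}}"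
  proof -
    have "{v, y} \<in> {e \<in> edges T. v \<in> e}" using v(2) by simp
    then have "{v, y} \<in> {{v, x}, {v, s1}, {v, s2}}" by (simp only: s12(4))
    then have "y = s1 \<or> y = s2" using xy(1) by (auto simp: doubleton_eq_iff)
    then show ?thesis
    proof
      assume "y = s1"
      then have "{e \<in> edges T. v \<in> e} = {{v, x}, {v, y}, {v, s2}}" using s12(4) by simp
      then show ?thesis using that[of s2] s12(1,3) \<open>y = s1\<close> by simp
    next
      assume "y = s2"
      then have "{e \<in> edges T. v \<in> e} = {{v, x}, {v, y}, {v, s1}}"
        using s12(4) insert_commute[of "{v, s1}" "{v, s2}"] by simp
      then show ?thesis using that[of s1] s12(1,2) \<open>y = s2\<close> by simp
    qed
  qed
  have va: "{v, a} \<in> edges T" using a(3) by blast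
  have vc: "card {k \<in> ?H. v \<in> k} = 2" "card (inc ?R (\<phi> T v)) = 2"
    using cnt[OF vv xH[OF v(1)]] by auto
  have aH: "{v, a} \<in> ?H"
  proof (rule ccontr)
    assume n: "{v, a} \<notin> ?H"
    have "{k \<in> ?H. v \<in> k} \<subseteq> {{v, x}}"
    proof
      fix k assume k: "k \<in> {k \<in> ?H. v \<in> k}"
      then have "k \<in> {{v, x}, {v, y}, {v, a}}" using a(3) by (auto simp: A.lift_def)
      then show "k \<in> {{v, x}}" using k n yH[of k] by blast
    qed
    then have "card {k \<in> ?H. v \<in> k} \<le> card {{v, x}}" by (intro card_mono) auto
    then show False using vc(1) by simp
  qed
  have al: "a \<notin> leaves T"
  proof
    assume "a \<in> leaves T"
    then have "a = z" using leafH[OF _ aH] a(1) by blast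
    then have "cherry T x z" using a.cherryI[OF xz(1) xy(2) _ v(1)] va \<open>a \<in> leaves T\<close> by blast
    then have "forest_cherry F x z" using assms(1) unfolding forest_cherry_def by blast
    then show False using fc(2) no_common by blast
  qed
  obtain w where w: "\<phi> T v = \<phi>' T' w" "{w, x} \<in> edges T'" "{w, z} \<in> edges T'"
  proof -
    obtain g1 where g1: "g1 \<in> P T {v, x}" "\<phi> T v \<in> g1" using A.end_edge[OF assms(1) v(1), of v] by blast
    obtain g2 where g2: "g2 \<in> P T {v, y}" "\<phi> T v \<in> g2" using A.end_edge[OF assms(1) v(2), of v] by blast
    obtain g3 where g3: "g3 \<in> P T {v, a}" "\<phi> T v \<in> g3" using A.end_edge[OF assms(1) va, of v] by blast
    have n: "{v, x} \<noteq> {v, y}" "{v, x} \<noteq> {v, a}" "{v, y} \<noteq> {v, a}"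
      using xy(1) a by (auto simp: doubleton_eq_iff)
    note d = embD(3)[OF A.emb[OF assms(1)]]
    have ne: "g1 \<noteq> g2" "g1 \<noteq> g3" "g2 \<noteq> g3"
      using d[OF v(1,2) n(1)] d[OF v(1) va n(2)] d[OF v(2) va n(3)] g1(1) g2(1) g3(1) by blast+
    have "P T {v, x} \<subseteq> ?Q" "P T {v, y} \<subseteq> ?Q" using v(1,2) by (auto simp: A.cpath_def)
    then have "g1 \<in> B.E" "g2 \<in> B.E" using g1 g2 QB by blast+
    moreover have "g3 \<in> B.E" using g3(1) aH cp(1) by (auto simp: A.lift_def)
    ultimately have "{g1, g2, g3} \<subseteq> inc B.E (\<phi> T v)" using g1 g2 g3 by (auto simp: inc_def)
    then have "card {g1, g2, g3} \<le> card (inc B.E (\<phi> T v))"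
      using B.finE by (intro card_mono finite_inc)
    moreover have "card {g1, g2, g3} = 3" using ne by simp
    ultimately have "B.is_img (\<phi> T v)" using B.card_inc_nonimg[of "\<phi> T v"] by linarith
    then obtain T2 w where w: "T2 \<in> F'" "w \<in> verts T2" "\<phi> T v = \<phi>' T2 w" by (auto simp: B.is_img_def)
    have "inc ?R (\<phi>' T2 w) \<noteq> {}" using vc(2) w(3) by auto
    from cp(3)[OF w(1,2) this]
    have o: "T2 = T'" "w = x \<or> w = z \<or> ({w, x} \<in> edges T' \<and> {w, z} \<in> edges T')" by blast+
    have "card (inc ?R x) = 1" "card (inc ?R z) = 1" using cp(2) by (auto simp: pathlike_def)
    then have "\<phi>' T' w \<noteq> x" "\<phi>' T' w \<noteq> z" using vc(2) w(3) o(1) by auto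
    then have "w \<noteq> x" "w \<noteq> z" using fx by auto
    then show ?thesis using that[of w] o w(3) by blast
  qed
  have nonimg: "\<not> B.is_img (\<phi> T b)"
    if b: "b \<in> verts T" "b \<noteq> v" "b \<notin> leaves T" "inc ?R (\<phi> T b) \<noteq> {}" for b
  proof
    assume "B.is_img (\<phi> T b)"
    then obtain T2 t where t: "T2 \<in> F'" "t \<in> verts T2" "\<phi> T b = \<phi>' T2 t" by (auto simp: B.is_img_def)
    have "inc ?R (\<phi>' T2 t) \<noteq> {}" using b(4) t(3) by simp
    from cp(3)[OF t(1,2) this]
    have o: "T2 = T'" "t = x \<or> t = z \<or> ({t, x} \<in> edges T' \<and> {t, z} \<in> edges T')" by blast+
    have "\<phi> T b \<noteq> x" "\<phi> T b \<noteq> z"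
      using A.leaf_img[OF X(1) assms(1) b(1)] A.leaf_img[OF X(3) assms(1) b(1)] b(3) by metis+
    then have "t \<noteq> x" "t \<noteq> z" using t(3) o(1) fx by auto
    then have "{t, x} \<in> edges T'" using o(2) by blast
    then have "{t, x} = {w, x}" using b.leaf_edge_unique[OF xz(2) _ w(2)] by blast
    then have "t = w" by (auto simp: doubleton_eq_iff)
    then have "\<phi> T b = \<phi> T v" using t(3) o(1) w(1) by simp
    then show False using A.\<phi>_inj(2)[OF assms(1,1) b(1) vv(1)] b(2) by blast
  qed
  have inner: "b \<noteq> x" "b \<noteq> z" if "b \<notin> leaves T" "b \<in> h" "h \<in> ?H" for b h
    using that xy(2) zT by blast+
  show ?thesis
  proof (rule that[OF v(1,2) va a(1,2) v(3) al aH])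
    fix b h assume b: "b \<in> verts T" "b \<noteq> v" "b \<notin> leaves T" "h \<in> ?H" "b \<in> h"
    have bi: "b \<noteq> x" "b \<noteq> z" using inner[OF b(3,5,4)] by auto
    show "card {k \<in> ?H. b \<in> k} = 2" using cnt(1)[OF b(1) bi b(4,5)] .
    fix h' assume h': "h' \<in> edges T" "b \<in> h'" "h' \<notin> ?H"
    have c2: "card (inc ?R (\<phi> T b)) = 2" using cnt(3)[OF b(1) bi b(4,5)] .
    then have "inc ?R (\<phi> T b) \<noteq> {}" by auto
    note ni = nonimg[OF b(1-3) this]
    obtain g where "g \<in> P T h'" "\<phi> T b \<in> g" "g \<notin> B.E"
      using off_path_edge_exclusive[OF B.emb_forest_axioms A.emb_forest_axioms cp(1) QA cp(2) X(1,3)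
        assms(1) c2 ni h'] .
    then show "\<exists>g\<in>P T h'. \<phi> T b \<in> g \<and> g \<notin> B.E" by blast
  next
    fix b h assume "b \<in> leaves T" "h \<in> ?H" "b \<in> h"
    then show "b = x \<or> b = z" by (rule leafH)
  qed
qed

end

lemma (in ptree) cherry_three_leaves:
  assumes "cherry T x z" "y \<in> Y" "y \<noteq> x" "y \<noteq> z" "Y \<subseteq> {x, y, z}"
  shows "cherry T x y"
proof -
  have xz: "x \<noteq> z" "x \<in> Y" "z \<in> Y" using assms(1) by (simp_all add: cherry_def leaves)
  show ?thesis using assms(1)
  proof (cases rule: cherry_cases)
    case pair
    then have "verts T = {x, z}" using adjacent_leaves(1)[OF _ xz(2,3)] by blast
    then show ?thesis using Y_verts[OF assms(2)] assms(3,4) by blast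
  next
    case (inner w)
    obtain s1 s2 where s: "s1 \<noteq> s2" "s1 \<noteq> x" "s2 \<noteq> x" "{e \<in> edges T. w \<in> e} = {{w, x}, {w, s1}, {w, s2}}"
      using inner_star[OF inner(3,1)] .
    have se: "{w, s1} \<in> edges T" "{w, s2} \<in> edges T" using s(4) by blast+
    obtain b where b: "b \<noteq> x" "b \<noteq> z" "{w, b} \<in> edges T"
    proof (cases "s1 = z")
      case True
      then show ?thesis using that[of s2] s se by blast
    next
      case False
      then show ?thesis using that[of s1] s se by blast
    qed
    have bw: "{b, w} \<in> edges T" using b(3) by (simp add: insert_commute)
    show ?thesis
    proof (cases "b \<in> Y")
      case True
      then have "b = y" using assms(5) b(1,2) by blast
      then show ?thesis using cherryI[OF _ xz(2) assms(2) inner(1)] b(3) assms(3) by simp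
    next
      case False
      from deep_cherry[OF bw False] obtain v p q where "cherry_below w b v p q" by blast
      then have pq: "p \<noteq> q" "p \<in> Y" "q \<in> Y" "p \<in> side T w b" "q \<in> side T w b"
        by (simp_all add: cherry_below_def)
      have "x \<in> side T b w"
        by (rule side_step[OF inner(1) _ side_self]) (use b in \<open>auto simp: doubleton_eq_iff\<close>)
      moreover have "z \<in> side T b w"
        by (rule side_step[OF inner(2) _ side_self]) (use b in \<open>auto simp: doubleton_eq_iff\<close>)
      ultimately have "x \<notin> side T w b" "z \<notin> side T w b" using side_disjoint[OF bw] by blast+
      then have "p = y" "q = y" using pq assms(5) by blast+
      then show ?thesis using pq(1) by simp
    qed
  qed
qed

context emb_pair
begin

context
  fixes T s t
  assumes T: "T \<in> F" and st: "{s, t} \<in> edges T" "s \<notin> leaves T"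
    and sW: "\<And>n. n \<in> side T t s \<Longrightarrow> \<phi> T n \<in> W"
    and e0P: "\<And>h. h \<in> edges T \<Longrightarrow> e0 \<in> P T h \<Longrightarrow> h = {s, t}"
    and top: "t \<in> leaves T \<or> e0 \<in> P T {s, t}"
    and bad: "e0 \<in> P T {s, t} \<Longrightarrow> X \<inter> W \<subseteq> leaves T \<inter> side T t s"
begin

interpretation a: ptree "leaves T" T
  by (rule A.ptree[OF T])

lemma e0_side: "h \<in> edges T \<Longrightarrow> h \<subseteq> side T t s \<Longrightarrow> e0 \<notin> P T h"
  using e0P[of h] a.side_not[OF st(1)] by blast

lemma uncle_step:
  assumes cb: "a.cherry_below t s v x y"
    and up: "v = s \<or> (\<exists>a c d. a.uncle_below t s v x y a c d)"
    and T': "T' \<in> F'" "cherry T' x z" "A.cpath T x y \<subseteq> B.E" "B.cpath T' x z \<subseteq> A.E"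
  shows good_step
proof -
  let ?H = "A.lift T (B.cpath T' x z)"
  have xy: "x \<noteq> y" "x \<in> leaves T" "y \<in> leaves T" "{v, x} \<in> edges T" "{v, y} \<in> edges T"
    "v \<in> side T t s" "x \<in> side T t s" "y \<in> side T t s" "x \<noteq> t" "y \<noteq> t"
    using cb by (simp_all add: a.cherry_below_def)
  have ch: "cherry T x y" using a.cherryI[OF xy(1-5)] .
  show ?thesis
  proof (rule common_cherry_paths[OF T ch T'])
    fix v' a0
    assume va: "{v', x} \<in> edges T" "{v', y} \<in> edges T" "{v', a0} \<in> edges T" "a0 \<noteq> x" "a0 \<noteq> y"
      "v' \<notin> leaves T" "a0 \<notin> leaves T" "{v', a0} \<in> ?H"
      and cnt: "\<And>b h. b \<in> verts T \<Longrightarrow> b \<noteq> v' \<Longrightarrow> b \<notin> leaves T \<Longrightarrow> h \<in> ?H \<Longrightarrow> b \<in> h \<Longrightarrow> card {k \<in> ?H. b \<in> k} = 2"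
      and excl: "\<And>b h h'. b \<in> verts T \<Longrightarrow> b \<noteq> v' \<Longrightarrow> b \<notin> leaves T \<Longrightarrow> h \<in> ?H \<Longrightarrow> b \<in> h \<Longrightarrow>
         h' \<in> edges T \<Longrightarrow> b \<in> h' \<Longrightarrow> h' \<notin> ?H \<Longrightarrow> \<exists>g\<in>P T h'. \<phi> T b \<in> g \<and> g \<notin> B.E"
      and lf: "\<And>b h. b \<in> leaves T \<Longrightarrow> h \<in> ?H \<Longrightarrow> b \<in> h \<Longrightarrow> b = x \<or> b = z"
    have "{v', x} = {v, x}" using a.leaf_edge_unique[OF xy(2) va(1) xy(4)] by blast
    then have vv: "v' = v" by (auto simp: doubleton_eq_iff)
    have star: "{e \<in> edges T. v \<in> e} = {{v, x}, {v, y}, {v, a0}}"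
      using a.inner_star3[of v x y a0] va xy(1) vv by auto
    have third: "a = a0" if a: "{v, a} \<in> edges T" "a \<noteq> x" "a \<noteq> y" for a
    proof -
      have "{v, a} \<in> {e \<in> edges T. v \<in> e}" using a(1) by simp
      then have "{v, a} \<in> {{v, x}, {v, y}, {v, a0}}" by (simp only: star)
      then show ?thesis using a(2,3) by (auto simp: doubleton_eq_iff)
    qed
    have X: "x \<in> X" using leafA[OF T xy(2)] .
    have fc: "forest_cherry F x y" "forest_cherry F' x z"
      using T ch T'(1,2) unfolding forest_cherry_def by blast+
    then have "z \<noteq> y" using no_common by blast
    then have C2a_pre: "\<exists>z. z \<noteq> y \<and> forest_cherry F' x z" using fc(2) by blast
    have C2o: "C2_oriented x F F' G F'" if "C2a x y F F' G F'" for G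
      unfolding C2_oriented_def using fc(1) that by blast
    show ?thesis
      using up
    proof
      assume "v = s"
      then have "t = a0" using third[of t] st(1) xy(9,10) by simp
      then have "e0 \<in> P T {v, a0}" using top va(7) \<open>v = s\<close> by blast
      moreover have "P T {v, a0} \<subseteq> B.E"
        using va(8) vv B.cherry_path(1)[OF T'(1,2)] by (auto simp: A.lift_def)
      ultimately show ?thesis using e0 by blast
    next
      assume "\<exists>a c d. a.uncle_below t s v x y a c d"
      then obtain a c d where u: "a.uncle_below t s v x y a c d" by blast
      have a: "{a, v} \<in> edges T" "{a, c} \<in> edges T" "{a, d} \<in> edges T"
        "v \<noteq> c" "v \<noteq> d" "c \<noteq> d" "a \<noteq> x" "a \<noteq> y" and aside: "a \<in> side T t s" "c \<in> side T t s"
        using u by (simp_all add: a.uncle_below_def)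
      have cpq: "c \<in> leaves T \<or> (\<exists>p q. p \<noteq> q \<and> p \<in> leaves T \<and> q \<in> leaves T \<and> p \<noteq> a \<and> q \<noteq> a \<and>
          {p, q} \<subseteq> side T t s \<and> {c, p} \<in> edges T \<and> {c, q} \<in> edges T)"
        using u unfolding a.uncle_below_def by (elim conjE)
      have ad: "a = s \<and> d = t \<or> {a, d} \<noteq> {s, t}"
        using u unfolding a.uncle_below_def by (elim conjE)
      note base = xy(1-5) a
      have "a = a0" using third[of a] a(1,7,8) by (simp add: insert_commute)
      then have avH: "{a, v} \<in> ?H" using va(8) vv by (simp add: insert_commute)
      have al: "a \<notin> leaves T" "a \<noteq> v" "a \<in> verts T"
        using va(7) \<open>a = a0\<close> a.edge[OF a(1)] by auto
      note excl_a = excl[OF al(3) _ al(1) avH, unfolded vv, OF al(2)]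
      show ?thesis
      proof (cases "{a, c} \<in> ?H")
        case False
        then obtain g where g: "g \<in> P T {a, c}" "\<phi> T a \<in> g" "g \<notin> B.E"
          using excl_a[of "{a, c}"] a(2) by auto
        have gW: "g \<inter> W \<noteq> {}" using g(2) sW[OF aside(1)] by blast
        have "e0 \<notin> P T {a, c}" using e0_side[OF a(2)] aside by blast
        then have ge: "g \<noteq> e0" using g(1) by blast
        have "C2a x y F F' (forest_minus_edge F T {a, c}) F'"
          using cpq
        proof
          assume c: "c \<in> leaves T"
          have "cuts_leaf_edge F c (forest_minus_edge F T {a, c})"
            unfolding cuts_leaf_edge_def using T a(2) c by blast
          then show ?thesis
            unfolding C2a_def using C2a_pre T a.pendant3_uncle[OF base c] by blast
        next
          assume "\<exists>p q. p \<noteq> q \<and> p \<in> leaves T \<and> q \<in> leaves T \<and> p \<noteq> a \<and> q \<noteq> a \<and>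
            {p, q} \<subseteq> side T t s \<and> {c, p} \<in> edges T \<and> {c, q} \<in> edges T"
          then obtain p q where pq: "p \<noteq> q" "p \<in> leaves T" "q \<in> leaves T" "p \<noteq> a" "q \<noteq> a"
            "{c, p} \<in> edges T" "{c, q} \<in> edges T" by blast
          show ?thesis
            unfolding C2a_def
            using C2a_pre T a.pendant4_uncle[OF base pq] a.pendant2_uncle[OF base pq] by blast
        qed
        from good_stepA[OF C2o[OF this] X T a(2) g(1,3) gW ge] show ?thesis .
      next
        case True
        have adH: "{a, d} \<notin> ?H"
        proof
          assume "{a, d} \<in> ?H"
          then have "{{a, v}, {a, c}, {a, d}} \<subseteq> {k \<in> ?H. a \<in> k}" using avH True by auto
          moreover have "finite {k \<in> ?H. a \<in> k}" using a.finite_edges by (simp add: A.lift_def)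
          ultimately have "card {{a, v}, {a, c}, {a, d}} \<le> card {k \<in> ?H. a \<in> k}" by (intro card_mono)
          moreover have "card {{a, v}, {a, c}, {a, d}} = 3" using a(4-6) by (simp add: doubleton_eq_iff)
          moreover have "card {k \<in> ?H. a \<in> k} = 2" using cnt[OF al(3) _ al(1) avH] al(2) vv by blast
          ultimately show False by simp
        qed
        show ?thesis
          using cpq
        proof
          assume c: "c \<in> leaves T"
          have "c \<noteq> x" "c \<noteq> y" using a.leaf_ne[OF base c a(2) al(2)] by auto
          then have cz: "c = z" using lf[OF c True] by blast
          obtain g where g: "g \<in> P T {a, d}" "\<phi> T a \<in> g" "g \<notin> B.E"
            using excl_a[of "{a, d}"] a(3) adH by auto
          have gW: "g \<inter> W \<noteq> {}" using g(2) sW[OF aside(1)] by blast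
          show ?thesis
          proof (cases "e0 \<in> P T {a, d}")
            case False
            then have ge: "g \<noteq> e0" using g(1) by blast
            have "C2a x y F F' (forest_minus_edge F T {a, d}) F'"
              unfolding C2a_def using C2a_pre T a.pendant3_uncle[OF base c] by blast
            from good_stepA[OF C2o[OF this] X T a(3) g(1,3) gW ge] show ?thesis .
          next
            case e: True
            then have "{a, d} = {s, t}" using e0P[OF a(3)] by blast
            then have as: "a = s" "d = t" using ad by auto
            have "X \<inter> W \<subseteq> leaves T \<inter> {a, v, c, x, y}"
              using bad e a.side_leaf_uncle[OF base c] as by auto
            then have XW: "X \<inter> W \<subseteq> {x, y, z}" using al(1) va(6) vv cz by blast
            interpret b: ptree "leaves T'" T' by (rule B.ptree[OF T'(1)])
            have xT': "x \<in> leaves T'" using T'(2) by (simp add: cherry_def)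
            have "\<phi>' T' x \<in> W"
              using B.fix_leaf[OF T'(1) xT'] sW[OF xy(7)] A.fix_leaf[OF T xy(2)] by simp
            then have "leaves T' \<subseteq> W"
              using B.tree_in_closed_set[OF B_closed T'(1) B_e0[OF T'(1)] b.Y_verts[OF xT']]
                b.Y_verts B.fix_leaf[OF T'(1)] by (metis subsetI)
            then have l: "leaves T' \<subseteq> {x, y, z}" using XW leafB[OF T'(1)] by blast
            have "y \<in> leaves T'"
              using B.lift_reach(1)[OF T'(3) A.cherry_path(2)[OF T ch] X leafA[OF T xy(3)] T'(1) xT'] .
            then have "cherry T' x y"
              using b.cherry_three_leaves[OF T'(2)] xy(1) \<open>z \<noteq> y\<close> l by blast
            then have "forest_cherry F' x y" using T'(1) unfolding forest_cherry_def by blast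
            then show ?thesis using fc(1) no_common by blast
          qed
        next
          assume "\<exists>p q. p \<noteq> q \<and> p \<in> leaves T \<and> q \<in> leaves T \<and> p \<noteq> a \<and> q \<noteq> a \<and>
            {p, q} \<subseteq> side T t s \<and> {c, p} \<in> edges T \<and> {c, q} \<in> edges T"
          then obtain p q where pq: "p \<noteq> q" "p \<in> leaves T" "q \<in> leaves T" "p \<noteq> a" "q \<noteq> a"
            "{c, p} \<in> edges T" "{c, q} \<in> edges T" and pqs: "{p, q} \<subseteq> side T t s" by blast
          have cl: "c \<notin> leaves T" "c \<in> verts T"
            using a.two_edges_inner[OF pq(6,7,1)] a.edge[OF a(2)] by auto
          have "\<not> ({c, p} \<in> ?H \<and> {c, q} \<in> ?H)"
          proof
            assume "{c, p} \<in> ?H \<and> {c, q} \<in> ?H"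
            then have "{{a, c}, {c, p}, {c, q}} \<subseteq> {k \<in> ?H. c \<in> k}" using True by auto
            moreover have "finite {k \<in> ?H. c \<in> k}" using a.finite_edges by (simp add: A.lift_def)
            ultimately have "card {{a, c}, {c, p}, {c, q}} \<le> card {k \<in> ?H. c \<in> k}" by (intro card_mono)
            moreover have "{a, c} \<noteq> {c, p}" "{a, c} \<noteq> {c, q}" "{c, p} \<noteq> {c, q}"
              using pq(1,4,5) a.edge(3)[OF a(2)] by (auto simp: doubleton_eq_iff)
            then have "card {{a, c}, {c, p}, {c, q}} = 3" by simp
            moreover have "card {k \<in> ?H. c \<in> k} = 2" using cnt[OF cl(2) _ cl(1) True] a(4) vv by blast
            ultimately show False by simp
          qed
          then obtain r where r: "r = p \<or> r = q" "{c, r} \<notin> ?H" by blast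
          have re: "{c, r} \<in> edges T" "r \<in> leaves T" "r \<in> side T t s" using r(1) pq pqs by auto
          obtain g where g: "g \<in> P T {c, r}" "\<phi> T c \<in> g" "g \<notin> B.E"
            using excl[OF cl(2) _ cl(1) True _ re(1) _ r(2)] a(4) vv by auto
          have gW: "g \<inter> W \<noteq> {}" using g(2) sW[OF aside(2)] by blast
          have "e0 \<notin> P T {c, r}" using e0_side[OF re(1)] aside re(3) by blast
          then have ge: "g \<noteq> e0" using g(1) by blast
          have "cuts_leaf_edge F r (forest_minus_edge F T {c, r})"
            unfolding cuts_leaf_edge_def using T re by blast
          then have "cuts_leaf_edge F p (forest_minus_edge F T {c, r}) \<or>
            cuts_leaf_edge F q (forest_minus_edge F T {c, r})" using r(1) by auto
          then have "C2a x y F F' (forest_minus_edge F T {c, r}) F'"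
            unfolding C2a_def using C2a_pre T a.pendant4_uncle[OF base pq] by blast
          from good_stepA[OF C2o[OF this] X T re(1) g(1,3) gW ge] show ?thesis .
        qed
      qed
    qed
  qed
qed

lemma deep_step: good_step
proof -
  obtain v x y where cb: "a.cherry_below t s v x y"
    and up: "v = s \<or> (\<exists>a c d. a.uncle_below t s v x y a c d)"
    using a.deep_cherry[OF st] by blast
  have xy: "x \<noteq> y" "x \<in> leaves T" "y \<in> leaves T" "{v, x} \<in> edges T" "{v, y} \<in> edges T"
    "v \<in> side T t s" "x \<in> side T t s" "y \<in> side T t s" "x \<noteq> t" "y \<noteq> t"
    using cb by (simp_all add: a.cherry_below_def)
  have ch: "cherry T x y" using a.cherryI[OF xy(1-5)] .
  have W: "x \<in> W" "y \<in> W" using sW[OF xy(7)] sW[OF xy(8)] A.fix_leaf[OF T] xy(2,3) by auto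
  have e: "e0 \<notin> P T h" if h: "h \<in> edges T" "x \<in> h \<or> y \<in> h" for h
  proof -
    have "h = {v, x} \<or> h = {v, y}"
      using h a.leaf_edge_unique[OF xy(2) _ xy(4)] a.leaf_edge_unique[OF xy(3) _ xy(5)] by blast
    then have "h \<subseteq> side T t s" using xy(6-8) by auto
    then show ?thesis using e0_side[OF h(1)] by blast
  qed
  show ?thesis
    using T ch W e
  proof (rule cherry_step)
    fix x1 y1 z T'
    assume o: "x1 = x \<and> y1 = y \<or> x1 = y \<and> y1 = x" "T' \<in> F'" "cherry T' x1 z"
      "A.cpath T x1 y1 \<subseteq> B.E" "B.cpath T' x1 z \<subseteq> A.E"
    have "a.cherry_below t s v x1 y1" using o(1) cb by (auto simp: a.cherry_below_def)
    moreover have "v = s \<or> (\<exists>a c d. a.uncle_below t s v x1 y1 a c d)"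
    proof -
      have "a.uncle_below t s v x y a c d \<Longrightarrow> a.uncle_below t s v y x a c d" for a c d
        unfolding a.uncle_below_def by (elim conjE, intro conjI)
      then show ?thesis using up o(1) by blast
    qed
    ultimately show good_step using o(2-5) by (rule uncle_step)
  qed
qed

end

lemma tree_step:
  assumes "T \<in> F" "w \<in> leaves T" "w \<in> W" "\<And>h. h \<in> edges T \<Longrightarrow> e0 \<notin> P T h"
  shows good_step
proof -
  interpret a: ptree "leaves T" T by (rule A.ptree[OF assms(1)])
  have inW: "\<phi> T n \<in> W" if "n \<in> verts T" for n
    using A.tree_in_closed_set[OF A_closed assms(1,4) a.Y_verts[OF assms(2)] _ that]
      A.fix_leaf[OF assms(1,2)] assms(3) by simp
  obtain s where s: "{w, s} \<in> edges T" using a.leaf_edge_ex[OF assms(2) A.not_single[OF assms(1)]] .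
  then have sw: "{s, w} \<in> edges T" by (simp add: insert_commute)
  show ?thesis
  proof (cases "s \<in> leaves T")
    case True
    have ch: "cherry T w s" using a.adjacent_leaves(3)[OF s assms(2) True] .
    have sW: "s \<in> W" using inW[OF a.Y_verts[OF True]] A.fix_leaf[OF assms(1) True] by simp
    show ?thesis
      using assms(1) ch assms(3) sW assms(4)
    proof (rule cherry_step)
      fix x1 y1 z T'
      assume o: "x1 = w \<and> y1 = s \<or> x1 = s \<and> y1 = w" "T' \<in> F'" "cherry T' x1 z"
        "A.cpath T x1 y1 \<subseteq> B.E" "B.cpath T' x1 z \<subseteq> A.E"
      have c1: "cherry T x1 y1" using o(1) ch cherry_sym[OF ch] by auto
      obtain v where v: "{v, x1} \<in> edges T" "v \<notin> leaves T"
        by (rule common_cherry_paths[OF assms(1) c1 o(2-5)]) (rule that)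
      have "edges T = {{w, s}}" using a.adjacent_leaves(2)[OF s assms(2) True] .
      then have "v \<in> {w, s}" using v(1) by auto
      then show good_step using v(2) True assms(2) by blast
    qed
  next
    case False
    show ?thesis
    proof (rule deep_step[OF assms(1) sw False])
      show "\<phi> T n \<in> W" if "n \<in> side T w s" for n
        using inW a.side_subset a.edge(1)[OF sw] that by blast
    qed (use assms sw in auto)
  qed
qed

lemma bridge_step:
  assumes "e0 \<in> A.E" "e0 = {u0, v0}" "u0 \<in> W" "v0 \<notin> W"
  shows good_step
proof -
  obtain T h where T: "T \<in> F" "h \<in> edges T" "e0 \<in> P T h" using assms(1) by (auto simp: A.E_def)
  obtain s t where st: "h = {s, t}" "\<phi> T s \<in> W" "\<phi> T t \<notin> W"
    using A.bridge_ends[OF A_closed T assms(2-4)] .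
  interpret a: ptree "leaves T" T by (rule A.ptree[OF T(1)])
  have ste: "{s, t} \<in> edges T" using st(1) T(2) by simp
  have e0P: "k = {s, t}" if "k \<in> edges T" "e0 \<in> P T k" for k
    using embD(3)[OF A.emb[OF T(1)] that(1) ste] that(2) T(3) st(1) by blast
  have sW: "\<phi> T n \<in> W" if "n \<in> side T t s" for n
    by (rule A.side_in_closed_set[OF A_closed T(1) _ st(2) that]) (auto dest: e0P)
  have tW: "\<phi> T n \<notin> W" if "n \<in> side T s t" for n
  proof -
    have "\<phi> T n \<in> - W"
    proof (rule A.side_in_closed_set[OF _ T(1) _ _ that])
      fix g assume "g \<in> A.E" "g \<noteq> e0" "g \<inter> - W \<noteq> {}"
      then show "g \<subseteq> - W" using A_closed[of g] by blast
    next
      fix k assume "k \<in> edges T" "k \<noteq> {t, s}"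
      then show "e0 \<notin> P T k" using e0P[of k] by (auto simp: insert_commute)
    qed (use st(3) in simp)
    then show ?thesis by simp
  qed
  show ?thesis
  proof (cases "\<exists>T2\<in>F. T2 \<noteq> T \<and> leaves T2 \<inter> W \<noteq> {}")
    case True
    then obtain T2 w where T2: "T2 \<in> F" "T2 \<noteq> T" "w \<in> leaves T2" "w \<in> W" by blast
    have "e0 \<notin> P T2 k" if "k \<in> edges T2" for k
      using A.same_tree[OF T2(1) T(1) that _ _ T(2,3), of e0 u0] T2(2) assms(2) by blast
    then show ?thesis using tree_step[OF T2(1,3,4)] by blast
  next
    case False
    have XW: "X \<inter> W \<subseteq> leaves T \<inter> side T t s"
    proof
      fix n assume n: "n \<in> X \<inter> W"
      then obtain T2 where T2: "T2 \<in> F" "n \<in> leaves T2" using phylo_forest_ex[OF A.F] by blast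
      have "leaves T2 \<inter> W \<noteq> {}" using T2(2) n by blast
      then have "T2 = T" using False T2(1) by metis
      then have nT: "n \<in> leaves T" using T2(2) by simp
      then have "n \<notin> side T s t" using tW[of n] A.fix_leaf[OF T(1)] n by auto
      then show "n \<in> leaves T \<inter> side T t s" using a.side_union[OF ste] a.Y_verts[OF nT] nT by blast
    qed
    show ?thesis
    proof (cases "s \<in> leaves T")
      case False
      show ?thesis
        by (rule deep_step[OF T(1) ste False sW e0P]) (use T(3) st(1) XW in auto)
    next
      case s: True
      have ts: "{t, s} \<in> edges T" using ste by (simp add: insert_commute)
      have "side T s t = verts T - {s}" using a.delete_leaf_suppress(2)[OF ts s] .
      then have "side T t s \<subseteq> {s}"
        using a.side_disjoint[OF ste] a.side_subset[OF a.edge(1)[OF ste]] by blast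
      then have XW': "X \<inter> W \<subseteq> {s}" using XW by blast
      obtain T' where T': "T' \<in> F'" "s \<in> leaves T'" using phylo_forest_ex[OF B.F leafA[OF T(1) s]] .
      interpret b: ptree "leaves T'" T' by (rule B.ptree[OF T'(1)])
      have "\<phi>' T' s \<in> W" using B.fix_leaf[OF T'] A.fix_leaf[OF T(1) s] st(2) by simp
      then have "leaves T' \<subseteq> W"
        using B.tree_in_closed_set[OF B_closed T'(1) B_e0[OF T'(1)] b.Y_verts[OF T'(2)]]
          b.Y_verts B.fix_leaf[OF T'(1)] by (metis subsetI)
      then have l: "leaves T' \<subseteq> {s}" using XW' leafB[OF T'(1)] by blast
      obtain r where r: "{s, r} \<in> edges T'" using b.leaf_edge_ex[OF T'(2) B.not_single[OF T'(1)]] .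
      then have "{r, s} \<in> edges T'" by (simp add: insert_commute)
      from b.side_has_leaf[OF this] b.side_not[OF this] l show ?thesis by blast
    qed
  qed
qed

end

section \<open>Exclusive bridges\<close>

lemma nonbridge_pair: "nonbridge G {u, v} \<longleftrightarrow> reach (G - {{u, v}}) u v"
  unfolding nonbridge_def using reach_sym by (auto simp: doubleton_eq_iff insert_commute)

text \<open>\<open>W\<close> is a side of minimal size among all sides of bridges outside \<open>K\<close>.\<close>

lemma minimal_bridge_side:
  assumes "finite V" and G': "\<forall>g\<in>G. \<exists>a\<in>V. \<exists>b\<in>V. a \<noteq> b \<and> g = {a, b}"
    and ex: "\<exists>g\<in>G - K. \<not> nonbridge G g"
  obtains u v W where "{u, v} \<in> G - K" "u \<in> W" "v \<notin> W"
    "\<forall>g\<in>G. g \<noteq> {u, v} \<longrightarrow> g \<inter> W \<noteq> {} \<longrightarrow> g \<subseteq> W \<and> (g \<in> K \<or> nonbridge G g)"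
proof -
  note G = bspec[OF G']
  define S where "S p = {n. reach (G - {{fst p, snd p}}) (fst p) n}" for p
  define B where "B p \<longleftrightarrow> {fst p, snd p} \<in> G - K \<and> \<not> nonbridge G {fst p, snd p}" for p
  obtain g where g: "g \<in> G - K" "\<not> nonbridge G g" using ex by blast
  obtain a b where "g = {a, b}" using G g(1) by blast
  then have "B (a, b)" using g by (simp add: B_def)
  from ex_has_least_nat[of B "(a, b)" "\<lambda>p. card (S p)", OF this]
  obtain p where p: "B p" "\<And>q. B q \<Longrightarrow> card (S p) \<le> card (S q)" by blast
  define u where "u = fst p"
  define v where "v = snd p"
  have uv: "{u, v} \<in> G" "{u, v} \<notin> K" "\<not> reach (G - {{u, v}}) u v"
    using p(1) unfolding B_def u_def v_def nonbridge_pair by auto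
  have Sp: "S p = {n. reach (G - {{u, v}}) u n}" by (simp add: S_def u_def v_def)
  have fin: "finite (S (c, d))" if c: "c \<in> V" for c d
  proof -
    have "S (c, d) \<subseteq> V"
    proof
      fix n assume "n \<in> S (c, d)"
      then have "reach (G - {{c, d}}) c n" by (simp add: S_def)
      then show "n \<in> V" using c by (rule reach_closed) (use G in fastforce)
    qed
    then show ?thesis using assms(1) finite_subset by blast
  qed
  have uV: "u \<in> V" using G[OF uv(1)] by (auto simp: doubleton_eq_iff)
  have finp: "finite (S p)" using fin[OF uV, of v] by (simp add: u_def v_def)
  have closed: "g \<subseteq> S p" if gG: "g \<in> G" and gn: "g \<noteq> {u, v}" and gS: "g \<inter> S p \<noteq> {}" for g
  proof -
    obtain a b where ab: "g = {a, b}" using G[OF gG] by blast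
    have "{a, b} \<in> G - {{u, v}}" "{b, a} \<in> G - {{u, v}}" using gG gn ab by (auto simp: insert_commute)
    then have "a \<in> S p \<Longrightarrow> b \<in> S p" "b \<in> S p \<Longrightarrow> a \<in> S p"
      unfolding Sp by (auto intro: reach_step)
    then show ?thesis using gS ab by auto
  qed
  have nb: "g \<in> K \<or> nonbridge G g" if gG: "g \<in> G" and gn: "g \<noteq> {u, v}" and gS: "g \<inter> S p \<noteq> {}" for g
  proof (rule ccontr)
    assume n: "\<not> (g \<in> K \<or> nonbridge G g)"
    obtain c d where cd: "g = {c, d}" "c \<in> V" "d \<in> V" using G[OF gG] by blast
    have br: "\<not> reach (G - {g}) c d" using n nonbridge_pair[of G c d] unfolding cd(1) by simp
    obtain r r' where r: "g = {r, r'}" "r \<in> V" "\<not> reach (G - {g}) u r"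
    proof (cases "reach (G - {g}) u c")
      case True
      then have "\<not> reach (G - {g}) u d" using br reach_sym reach_trans by metis
      then show ?thesis using that[of d c] cd by (simp add: insert_commute)
    next
      case False
      then show ?thesis using that[of c d] cd by blast
    qed
    have "B (r, r')" using n gG r(1) by (simp add: B_def)
    have rS: "S (r, r') = {n. reach (G - {g}) r n}" using r(1) by (simp add: S_def)
    have un: "u \<notin> S (r, r')" unfolding rS using r(3) by (auto dest: reach_sym)
    have "n \<in> S p \<and> reach (G - {g}) r n" if "reach (G - {g}) r n" for n
      using that
    proof (induction rule: reach_induct)
      case base
      have "r \<in> g" using r(1) by simp
      then show ?case using closed[OF gG gn gS] by auto
    next
      case (step m n)
      have rn: "reach (G - {g}) r n" using step reach_step by metis
      have "{m, n} \<noteq> {u, v}"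
      proof
        assume "{m, n} = {u, v}"
        then have "m = u \<or> m = v" by (auto simp: doubleton_eq_iff)
        moreover have "m \<noteq> u" using step.hyps(1) un rS by blast
        moreover have "m \<noteq> v" using step.IH uv(3) Sp by blast
        ultimately show False by blast
      qed
      then have "{m, n} \<subseteq> S p" using closed[of "{m, n}"] step by blast
      then show ?case using rn by blast
    qed
    then have "S (r, r') \<subseteq> S p" unfolding rS by blast
    moreover have "u \<in> S p" unfolding Sp by simp
    ultimately have "S (r, r') \<subset> S p" using un by blast
    then have "card (S (r, r')) < card (S p)" using finp by (rule psubset_card_mono[rotated])
    then show False using p(2)[OF \<open>B (r, r')\<close>] by simp
  qed
  show ?thesis
  proof (rule that[of u v "S p"])
    show "{u, v} \<in> G - K" "u \<in> S p" "v \<notin> S p" using uv unfolding Sp by auto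
    show "\<forall>g\<in>G. g \<noteq> {u, v} \<longrightarrow> g \<inter> S p \<noteq> {} \<longrightarrow> g \<subseteq> S p \<and> (g \<in> K \<or> nonbridge G g)"
      using closed nb by blast
  qed
qed

lemma C2_sym: "C2 x F F' G G' \<longleftrightarrow> C2 x F' F G' G"
  unfolding C2_def by blast

lemma ex_C2_step:
  assumes FA: "emb_forest X F \<phi> P" and FB: "emb_forest X F' \<phi>' P'"
    and nc: "\<And>x y. \<not> (forest_cherry F x y \<and> forest_cherry F' x y)"
    and V: "finite V" "\<forall>g\<in>emb_forest.E F P \<union> emb_forest.E F' P'. \<exists>a\<in>V. \<exists>b\<in>V. a \<noteq> b \<and> g = {a, b}"
  shows "\<exists>x\<in>X. \<exists>G G'. C2 x F F' G G' \<and>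
     (G' = F' \<and> (\<exists>T\<in>F. \<exists>h\<in>edges T. \<exists>g\<in>P T h. g \<notin> emb_forest.E F' P' \<and>
        nonbridge (emb_forest.E F P \<union> emb_forest.E F' P') g \<and> G = forest_minus_edge F T h) \<or>
      G = F \<and> (\<exists>T\<in>F'. \<exists>h\<in>edges T. \<exists>g\<in>P' T h. g \<notin> emb_forest.E F P \<and>
        nonbridge (emb_forest.E F P \<union> emb_forest.E F' P') g \<and> G' = forest_minus_edge F' T h))"
proof -
  interpret A: emb_forest X F \<phi> P by (rule FA)
  interpret B: emb_forest X F' \<phi>' P' by (rule FB)
  let ?G = "A.E \<union> B.E" and ?K = "A.E \<inter> B.E"
  show ?thesis
  proof (cases "\<exists>g\<in>?G - ?K. \<not> nonbridge ?G g")
    case False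
    interpret emb_pair X F F' \<phi> \<phi>' P P' UNIV "{}"
      by unfold_locales (use nc False B.edge_nonempty in auto)
    obtain x where "x \<in> X" using A.F by (auto simp: phylo_forest_def)
    then obtain T where T: "T \<in> F" "x \<in> leaves T" using phylo_forest_ex[OF A.F] by blast
    have "{} \<notin> P T h" if "h \<in> edges T" for h
      using A.P_E[OF T(1) that] A.edge_nonempty by blast
    then have good_step using tree_step[OF T] by blast
    then show ?thesis unfolding good_step_def .
  next
    case True
    obtain u v W where W: "{u, v} \<in> ?G - ?K" "u \<in> W" "v \<notin> W"
      "\<forall>g\<in>?G. g \<noteq> {u, v} \<longrightarrow> g \<inter> W \<noteq> {} \<longrightarrow> g \<subseteq> W \<and> (g \<in> ?K \<or> nonbridge ?G g)"
      using minimal_bridge_side[OF V(1) V(2) True] .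
    show ?thesis
    proof (cases "{u, v} \<in> B.E")
      case False
      interpret emb_pair X F F' \<phi> \<phi>' P P' W "{u, v}"
        by unfold_locales (use nc False W in blast)+
      have good_step by (rule bridge_step) (use W False in auto)
      then show ?thesis unfolding good_step_def .
    next
      case True
      have comm: "B.E \<union> A.E = ?G" "B.E \<inter> A.E = ?K" by blast+
      interpret C: emb_pair X F' F \<phi>' \<phi> P' P W "{u, v}"
        by unfold_locales (use nc True W comm in \<open>auto simp: Un_commute\<close>)
      have C.good_step by (rule C.bridge_step) (use W True in auto)
      then show ?thesis unfolding C.good_step_def comm(1) C2_sym[of _ F' F] by blast
    qed
  qed
qed

section \<open>Assembling the sequence\<close>

lemma phylo_forest_singleton:
  assumes "phylo_forest {x} F"
  shows "F = {single_vertex x}"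
proof -
  have "T = single_vertex x" if T: "T \<in> F" for T
  proof (rule ccontr)
    assume n: "T \<noteq> single_vertex x"
    interpret ptree "leaves T" T by (rule phylo_forest_ptree[OF assms T])
    have l: "leaves T = {x}" using phylo_forest_tree(2)[OF assms T] Y_ne by blast
    then obtain s where "{x, s} \<in> edges T" using leaf_edge_ex[OF _ n] by blast
    then have s: "{s, x} \<in> edges T" by (simp add: insert_commute)
    show False using side_has_leaf[OF s] side_not[OF s] l by simp
  qed
  moreover have "F \<noteq> {}" using assms by (auto simp: phylo_forest_def)
  ultimately show ?thesis by blast
qed

lemma phylo_forest_ground_set: "phylo_forest X F \<Longrightarrow> phylo_forest Y F \<Longrightarrow> X = Y"
  by (simp add: phylo_forest_def)

lemma C2_keeps_a_forest: "C2 x F F' G G' \<Longrightarrow> G = F \<or> G' = F'"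
  unfolding C2_def C2_oriented_def C2a_def C2b_def C2c_def by blast

lemma cherry_not_single:
  assumes "phylo_forest X F" "forest_cherry F x y"
  shows "single_vertex x \<notin> F"
proof
  assume s: "single_vertex x \<in> F"
  obtain T where T: "T \<in> F" "cherry T x y" using assms(2) unfolding forest_cherry_def by blast
  then have xy: "x \<noteq> y" "x \<in> leaves T" "y \<in> leaves T" by (simp_all add: cherry_def)
  have "T = single_vertex x"
    using phylo_forest_unique[OF assms(1) T(1) s xy(2)] by (simp add: leaves_single_vertex)
  then show False using xy by (simp add: leaves_single_vertex)
qed

lemma cherry_picking_sequence_Cons:
  assumes step: "picking_step x F F' G G'" and s: "cherry_picking_sequence X' G G' \<sigma> Fs Fs'"
    and X: "x \<in> X" "X' \<subseteq> X" "card X \<le> card X' + 1"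
    and F: "phylo_forest X F" "phylo_forest X F'"
  shows "\<exists>Hs Hs'. cherry_picking_sequence X F F' (x # \<sigma>) Hs Hs' \<and>
    weight (x # \<sigma>) Hs Hs' = step_cost x F F' G G' + weight \<sigma> Fs Fs'"
proof -
  define Hs where "Hs = case_nat F Fs"
  define Hs' where "Hs' = case_nat F' Fs'"
  have H: "Hs 0 = F" "Hs' 0 = F'" "Hs (Suc i) = Fs i" "Hs' (Suc i) = Fs' i" for i
    by (simp_all add: Hs_def Hs'_def)
  note d = s[unfolded cherry_picking_sequence_def]
  have ne: "length \<sigma> > 0" using d by linarith
  have F0: "Fs 0 = G" "Fs' 0 = G'" using d by blast+
  have finX: "finite X" "X \<noteq> {}" using F(1) by (simp_all add: phylo_forest_def)
  have "cherry_picking_sequence X F F' (x # \<sigma>) Hs Hs'"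
    unfolding cherry_picking_sequence_def
  proof (intro conjI allI impI)
    show "set (x # \<sigma>) \<subseteq> X" using d X by auto
    show "card X \<le> length (x # \<sigma>)" using d X(3) by auto
    show "1 \<le> card X" using finX by (simp add: Suc_leI card_gt_0_iff)
    show "Hs 0 = F" "Hs' 0 = F'" by (simp_all add: H)
    have len: "length (x # \<sigma>) - 1 = Suc (length \<sigma> - 1)" using ne by simp
    have lst: "last (x # \<sigma>) = last \<sigma>" using ne by auto
    show "Hs (length (x # \<sigma>) - 1) = {single_vertex (last (x # \<sigma>))}"
      "Hs' (length (x # \<sigma>) - 1) = {single_vertex (last (x # \<sigma>))}"
      unfolding len lst H using d by blast+
    fix i
    show "\<exists>Y. phylo_forest Y (Hs i)" "\<exists>Y. phylo_forest Y (Hs' i)" if i: "i < length (x # \<sigma>)"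
      using d F i by (cases i; auto simp: H)+
    show "picking_step ((x # \<sigma>) ! i) (Hs i) (Hs' i) (Hs (Suc i)) (Hs' (Suc i))"
      if i: "i < length (x # \<sigma>) - 1"
    proof (cases i)
      case 0
      then show ?thesis using step F0 by (simp add: H)
    next
      case (Suc j)
      then have "j < length \<sigma> - 1" using i by simp
      then show ?thesis using d Suc by (simp add: H)
    qed
  qed
  moreover have "weight (x # \<sigma>) Hs Hs' = step_cost x F F' G G' + weight \<sigma> Fs Fs'"
  proof -
    have "length (x # \<sigma>) - 1 = Suc (length \<sigma> - 1)" using ne by simp
    then show ?thesis
      unfolding weight_def by (simp only: sum.lessThan_Suc_shift) (simp add: H F0)
  qed
  ultimately show ?thesis by blast
qed

lemma fembeds_emb_forest:
  assumes "phylo_forest X F" "fembeds F I" "\<And>x. single_vertex x \<notin> F"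
    and "finite (\<Union>(I ` F))" "\<And>g. g \<in> \<Union>(I ` F) \<Longrightarrow> card g = 2"
  obtains \<phi> P where "emb_forest X F \<phi> P" "\<And>T. T \<in> F \<Longrightarrow> I T = \<Union>(P T ` edges T)"
    "emb_forest.E F P = \<Union>(I ` F)"
proof -
  have "\<forall>T\<in>F. \<exists>q. emb T (fst q) (snd q) \<and> (\<forall>x\<in>leaves T. fst q x = x) \<and> I T = \<Union>(snd q ` edges T)"
    using assms(2) unfolding fembeds_def embeds_def by simp
  then obtain f where f: "\<forall>T\<in>F. emb T (fst (f T)) (snd (f T)) \<and> (\<forall>x\<in>leaves T. fst (f T) x = x) \<and>
      I T = \<Union>(snd (f T) ` edges T)"
    by (rule bchoice[THEN exE])
  define \<phi> where "\<phi> T = fst (f T)" for T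
  define P where "P T = snd (f T)" for T
  have I: "I T = \<Union>(P T ` edges T)" if "T \<in> F" for T using f that by (simp add: P_def)
  have U: "(\<Union>T\<in>F. \<Union>(P T ` edges T)) = \<Union>(I ` F)" using I by simp
  have e: "emb_forest X F \<phi> P"
  proof
    show "emb T (\<phi> T) (P T)" if "T \<in> F" for T using f that by (simp add: \<phi>_def P_def)
    show "\<phi> T x = x" if "T \<in> F" "x \<in> leaves T" for T x using f that by (simp add: \<phi>_def)
    show "\<Union>(\<Union>(P T ` edges T)) \<inter> \<Union>(\<Union>(P T' ` edges T')) = {}" if "T \<in> F" "T' \<in> F" "T \<noteq> T'" for T T'
      using assms(2) that I[OF that(1)] I[OF that(2)] unfolding fembeds_def by metis
    show "card g = 2" if "g \<in> (\<Union>T\<in>F. \<Union>(P T ` edges T))" for g using assms(5) that U by simp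
    show "finite (\<Union>T\<in>F. \<Union>(P T ` edges T))" using assms(4) U by simp
  qed (use assms in auto)
  show ?thesis
    using that[OF e I] emb_forest.E_def[OF e] U by simp
qed

lemma cut_lowers_nullity:
  assumes F: "phylo_forest X F" "fembeds F I" "T \<in> F" "h \<in> edges T"
    and P: "emb T \<phi> P" "\<forall>x\<in>leaves T. \<phi> x = x" "I T = \<Union>(P ` edges T)"
    and V: "finite V" "\<forall>g\<in>\<Union>(I ` F) \<union> K. \<exists>a\<in>V. \<exists>b\<in>V. a \<noteq> b \<and> g = {a, b}" "finite (\<Union>(I ` F) \<union> K)"
    and g: "g \<in> P h" "g \<notin> K" "nonbridge (\<Union>(I ` F) \<union> K) g"
  shows "phylo_forest X (forest_minus_edge F T h) \<and> (\<exists>J. fembeds (forest_minus_edge F T h) J \<and>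
     \<Union>(J ` forest_minus_edge F T h) \<subset> \<Union>(I ` F) \<and>
     nullity V (\<Union>(J ` forest_minus_edge F T h) \<union> K) + 1 \<le> nullity V (\<Union>(I ` F) \<union> K))"
proof -
  interpret ptree "leaves T" T by (rule phylo_forest_ptree[OF F(1,3)])
  obtain s t where st: "h = {s, t}" using edgeE[OF F(4)] by blast
  interpret c: cut_forest X F T s t by unfold_locales (use F st in auto)
  have "{} \<notin> I T"
  proof
    assume "{} \<in> I T"
    then have "{} \<in> \<Union>(I ` F) \<union> K" using F(3) by blast
    from bspec[OF V(2) this] show False by auto
  qed
  from c.minus_edge_embeds[OF F(2) P this]
  obtain J where J: "fembeds (forest_minus_edge F T h) J"
    "\<Union>(J ` forest_minus_edge F T h) \<subseteq> \<Union>(I ` F) - P h" unfolding st by blast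
  let ?G = "\<Union>(I ` F) \<union> K" and ?G' = "\<Union>(J ` forest_minus_edge F T h) \<union> K"
  have gI: "g \<in> \<Union>(I ` F)" using g(1) P(3) F(3,4) by blast
  then have "\<Union>(J ` forest_minus_edge F T h) \<subset> \<Union>(I ` F)" using J(2) g(1) by blast
  moreover have "nullity V ?G' + 1 \<le> nullity V ?G"
  proof -
    obtain u v where uv: "g = {u, v}" "reach (?G - {g}) u v" using g(3) unfolding nonbridge_def by blast
    have "nullity V (?G - {g}) + 1 = nullity V ?G"
      using nullity_remove_cyclic_edge[OF V(3), of u v V] gI uv by simp
    moreover have "nullity V ?G' \<le> nullity V (?G - {g})"
    proof (rule nullity_mono[OF V(1)])
      show "finite (?G - {g})" using V(3) by simp
      show "?G' \<subseteq> ?G - {g}" using J(2) g(1,2) by blast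
      show "\<exists>a\<in>V. \<exists>b\<in>V. e = {a, b}" if "e \<in> ?G - {g}" for e using bspec[OF V(2), of e] that by blast
    qed
    ultimately show ?thesis by simp
  qed
  moreover have "phylo_forest X (forest_minus_edge F T h)" using c.minus_edge_phylo st by simp
  ultimately show ?thesis using J(1) by (intro conjI exI[of _ J])
qed

lemma ex_sequence:
  assumes "finite V"
  shows "phylo_forest X F \<Longrightarrow> phylo_forest X F' \<Longrightarrow> fembeds F I \<Longrightarrow> fembeds F' I' \<Longrightarrow>
    (\<And>g. g \<in> \<Union>(I ` F) \<union> \<Union>(I' ` F') \<Longrightarrow> \<exists>a\<in>V. \<exists>b\<in>V. a \<noteq> b \<and> g = {a, b}) \<Longrightarrow>
    \<exists>\<sigma> Fs Fs'. cherry_picking_sequence X F F' \<sigma> Fs Fs' \<and>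
      int (weight \<sigma> Fs Fs') \<le> nullity V (\<Union>(I ` F) \<union> \<Union>(I' ` F'))"
proof (induction "card X + card (\<Union>(I ` F)) + card (\<Union>(I' ` F'))" arbitrary: X F F' I I' rule: less_induct)
  case less
  note F = less.prems(1) and F' = less.prems(2) and I = less.prems(3) and I' = less.prems(4)
    and V = less.prems(5)
  let ?E = "\<Union>(I ` F)" and ?E' = "\<Union>(I' ` F')"
  have finX: "finite X" "X \<noteq> {}" using F by (simp_all add: phylo_forest_def)
  have finE: "finite (?E \<union> ?E')"
  proof (rule finite_subset)
    show "?E \<union> ?E' \<subseteq> Pow V" using V by blast
  qed (use assms in simp)
  have V2: "\<exists>a\<in>V. \<exists>b\<in>V. g = {a, b}" if "g \<in> ?E \<union> ?E'" for g using V[OF that] by blast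
  have Vb: "\<forall>g\<in>?E \<union> ?E'. \<exists>a\<in>V. \<exists>b\<in>V. a \<noteq> b \<and> g = {a, b}" using V by (rule ballI)
  have card2: "card g = 2" if "g \<in> ?E \<union> ?E'" for g using V[OF that] by auto
  have extend: "\<exists>\<sigma> Fs Fs'. cherry_picking_sequence X F F' \<sigma> Fs Fs' \<and>
      int (weight \<sigma> Fs Fs') \<le> nullity V (?E \<union> ?E')"
    if st: "picking_step x F F' G G'" "x \<in> X"
      and X': "X' \<subseteq> X" "card X \<le> card X' + 1"
      and G: "phylo_forest X' G" "phylo_forest X' G'" "fembeds G J" "fembeds G' J'"
      and J: "\<Union>(J ` G) \<subseteq> ?E" "\<Union>(J' ` G') \<subseteq> ?E'"
      and m: "card X' + card (\<Union>(J ` G)) + card (\<Union>(J' ` G')) < card X + card ?E + card ?E'"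
      and n: "nullity V (\<Union>(J ` G) \<union> \<Union>(J' ` G')) + int (step_cost x F F' G G') \<le> nullity V (?E \<union> ?E')"
    for x G G' X' J J'
  proof -
    have "\<exists>a\<in>V. \<exists>b\<in>V. a \<noteq> b \<and> g = {a, b}" if g: "g \<in> \<Union>(J ` G) \<union> \<Union>(J' ` G')" for g
    proof (rule V)
      show "g \<in> ?E \<union> ?E'" using subsetD[OF Un_mono[OF J] g] .
    qed
    from less.hyps[OF m G this] obtain \<sigma> Fs Fs' where
      s: "cherry_picking_sequence X' G G' \<sigma> Fs Fs'"
      "int (weight \<sigma> Fs Fs') \<le> nullity V (\<Union>(J ` G) \<union> \<Union>(J' ` G'))" by blast
    from cherry_picking_sequence_Cons[OF st(1) s(1) st(2) X' F F']
    obtain Hs Hs' where "cherry_picking_sequence X F F' (x # \<sigma>) Hs Hs'"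
      "weight (x # \<sigma>) Hs Hs' = step_cost x F F' G G' + weight \<sigma> Fs Fs'" by blast
    then show ?thesis using s(2) n by (intro exI[of _ "x # \<sigma>"] exI[of _ Hs] exI[of _ Hs']) simp
  qed
  show ?case
  proof (cases "card X = 1")
    case True
    then obtain x where X: "X = {x}" by (auto simp: card_1_singleton_iff)
    have "F = {single_vertex x}" "F' = {single_vertex x}"
      using phylo_forest_singleton[of x F] phylo_forest_singleton[of x F'] F F' X by simp_all
    then have "cherry_picking_sequence X F F' [x] (\<lambda>_. F) (\<lambda>_. F')"
      using F F' X unfolding cherry_picking_sequence_def by auto
    moreover have "weight [x] (\<lambda>_. F) (\<lambda>_. F') = 0" by (simp add: weight_def)
    moreover have "nullity V (?E \<union> ?E') \<ge> 0" using nullity_nonneg[OF assms finE V2] .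
    ultimately show ?thesis by (metis of_nat_0)
  next
    case False
    then have X1: "X \<noteq> {x}" for x by auto
    have free: ?thesis if x: "x \<in> X" and st: "picking_step x F F' (forest_minus_leaf F x) (forest_minus_leaf F' x)"
      and cost: "step_cost x F F' (forest_minus_leaf F x) (forest_minus_leaf F' x) = 0" for x
    proof -
      note m = minus_leaf[OF F x X1 I] and m' = minus_leaf[OF F' x X1 I']
      obtain J where J: "fembeds (forest_minus_leaf F x) J" "\<Union>(J ` forest_minus_leaf F x) \<subseteq> ?E"
        using m(2) by blast
      obtain J' where J': "fembeds (forest_minus_leaf F' x) J'" "\<Union>(J' ` forest_minus_leaf F' x) \<subseteq> ?E'"
        using m'(2) by blast
      have "card (X - {x}) < card X" using x finX by (meson card_Diff1_less)
      moreover have "card (\<Union>(J ` forest_minus_leaf F x)) \<le> card ?E"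
        "card (\<Union>(J' ` forest_minus_leaf F' x)) \<le> card ?E'"
        using J(2) J'(2) finE by (auto intro: card_mono)
      ultimately have "card (X - {x}) + card (\<Union>(J ` forest_minus_leaf F x)) +
        card (\<Union>(J' ` forest_minus_leaf F' x)) < card X + card ?E + card ?E'" by linarith
      moreover have "nullity V (\<Union>(J ` forest_minus_leaf F x) \<union> \<Union>(J' ` forest_minus_leaf F' x)) \<le>
        nullity V (?E \<union> ?E')"
        by (rule nullity_mono[OF assms finE Un_mono[OF J(2) J'(2)] V2])
      moreover have "X - {x} \<subseteq> X" "card X \<le> card (X - {x}) + 1" using x finX by auto
      ultimately show ?thesis
        using extend[OF st x _ _ m(1) m'(1) J(1) J'(1) J(2) J'(2)] cost by simp
    qed
    have noC2: "\<not> C2 x F F' (forest_minus_leaf F x) (forest_minus_leaf F' x)" if x: "x \<in> X" for x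
    proof
      assume "C2 x F F' (forest_minus_leaf F x) (forest_minus_leaf F' x)"
      then have "forest_minus_leaf F x = F \<or> forest_minus_leaf F' x = F'" by (rule C2_keeps_a_forest)
      then have "phylo_forest (X - {x}) F \<or> phylo_forest (X - {x}) F'"
        using minus_leaf(1)[OF F x X1 I] minus_leaf(1)[OF F' x X1 I'] by metis
      then have "X - {x} = X" using phylo_forest_ground_set F F' by blast
      then show False using x by blast
    qed
    show ?thesis
    proof (cases "\<exists>x. single_vertex x \<in> F \<or> single_vertex x \<in> F'")
      case True
      then obtain x where s: "single_vertex x \<in> F \<or> single_vertex x \<in> F'" by blast
      then have x: "x \<in> X"
        using phylo_forest_tree(2)[OF F, of "single_vertex x"] phylo_forest_tree(2)[OF F', of "single_vertex x"]
        by (auto simp: leaves_single_vertex)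
      let ?G = "forest_minus_leaf F x" and ?G' = "forest_minus_leaf F' x"
      have c3: "C3 x F F' ?G ?G'" using s by (simp add: C3_def)
      moreover have "\<not> C1 x F F' ?G ?G'"
        using s cherry_not_single[OF F] cherry_not_single[OF F'] unfolding C1_def by blast
      ultimately have "picking_step x F F' ?G ?G'" using noC2[OF x] unfolding picking_step_def by blast
      moreover have "step_cost x F F' ?G ?G' = 0" using c3 by (simp add: step_cost_def)
      ultimately show ?thesis by (rule free[OF x])
    next
      case ns: False
      then have nos: "single_vertex x \<notin> F" "single_vertex x \<notin> F'" for x by blast+
      show ?thesis
      proof (cases "\<exists>x y. forest_cherry F x y \<and> forest_cherry F' x y")
        case True
        then obtain x y where c: "forest_cherry F x y" "forest_cherry F' x y" by blast
        then obtain T where "T \<in> F" "x \<in> leaves T" unfolding forest_cherry_def cherry_def by blast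
        then have x: "x \<in> X" using phylo_forest_tree(2)[OF F] by blast
        let ?G = "forest_minus_leaf F x" and ?G' = "forest_minus_leaf F' x"
        have c1: "C1 x F F' ?G ?G'" using c unfolding C1_def by blast
        moreover have "\<not> C3 x F F' ?G ?G'" using nos unfolding C3_def by blast
        ultimately have "picking_step x F F' ?G ?G'" using noC2[OF x] unfolding picking_step_def by blast
        moreover have "step_cost x F F' ?G ?G' = 0" using c1 by (simp add: step_cost_def)
        ultimately show ?thesis by (rule free[OF x])
      next
        case False
        then have nc: "\<not> (forest_cherry F x y \<and> forest_cherry F' x y)" for x y by blast
        obtain \<phi> P where P: "emb_forest X F \<phi> P" "\<And>T. T \<in> F \<Longrightarrow> I T = \<Union>(P T ` edges T)"
          "emb_forest.E F P = ?E"
          by (rule fembeds_emb_forest[OF F I nos(1)]) (use finE card2 in auto)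
        obtain \<phi>' P' where P': "emb_forest X F' \<phi>' P'" "\<And>T. T \<in> F' \<Longrightarrow> I' T = \<Union>(P' T ` edges T)"
          "emb_forest.E F' P' = ?E'"
          by (rule fembeds_emb_forest[OF F' I' nos(2)]) (use finE card2 in auto)
        interpret A: emb_forest X F \<phi> P by (rule P(1))
        interpret B: emb_forest X F' \<phi>' P' by (rule P'(1))
        have "\<forall>g\<in>A.E \<union> B.E. \<exists>a\<in>V. \<exists>b\<in>V. a \<noteq> b \<and> g = {a, b}"
          unfolding P(3) P'(3) by (rule Vb)
        from ex_C2_step[OF P(1) P'(1) nc assms this, unfolded P(3) P'(3)]
        obtain x G G' where x: "x \<in> X" and c2: "C2 x F F' G G'" and
          alt: "G' = F' \<and> (\<exists>T\<in>F. \<exists>h\<in>edges T. \<exists>g\<in>P T h. g \<notin> ?E' \<and> nonbridge (?E \<union> ?E') g \<and>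
              G = forest_minus_edge F T h) \<or>
            G = F \<and> (\<exists>T\<in>F'. \<exists>h\<in>edges T. \<exists>g\<in>P' T h. g \<notin> ?E \<and> nonbridge (?E \<union> ?E') g \<and>
              G' = forest_minus_edge F' T h)"
          by (elim bexE exE conjE) (rule that)
        have st: "picking_step x F F' G G'"
          using c2 nc nos unfolding picking_step_def C1_def C3_def by blast
        have cost: "int (step_cost x F F' G G') \<le> 1" by (simp add: step_cost_def)
        from alt show ?thesis
        proof
          assume "G' = F' \<and> (\<exists>T\<in>F. \<exists>h\<in>edges T. \<exists>g\<in>P T h. g \<notin> ?E' \<and> nonbridge (?E \<union> ?E') g \<and>
              G = forest_minus_edge F T h)"
          then obtain T h g where T: "T \<in> F" "h \<in> edges T" "g \<in> P T h" "g \<notin> ?E'"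
            "nonbridge (?E \<union> ?E') g" and G: "G' = F'" "G = forest_minus_edge F T h" by blast
          have fx: "\<forall>x\<in>leaves T. \<phi> T x = x" using A.fix_leaf[OF T(1)] by blast
          from cut_lowers_nullity[OF F I T(1,2) A.emb[OF T(1)] fx P(2)[OF T(1)] assms Vb finE T(3-5), folded G(2)]
          obtain J where J: "phylo_forest X G" "fembeds G J" "\<Union>(J ` G) \<subset> ?E"
            "nullity V (\<Union>(J ` G) \<union> ?E') + 1 \<le> nullity V (?E \<union> ?E')"
            by (elim conjE exE) (rule that)
          have "card (\<Union>(J ` G)) < card ?E" using J(3) finE by (intro psubset_card_mono) auto
          then show ?thesis
            using extend[OF st x order_refl _ J(1) _ J(2), of I'] F' I' J(3,4) cost G(1) by auto
        next
          assume "G = F \<and> (\<exists>T\<in>F'. \<exists>h\<in>edges T. \<exists>g\<in>P' T h. g \<notin> ?E \<and> nonbridge (?E \<union> ?E') g \<and>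
              G' = forest_minus_edge F' T h)"
          then obtain T h g where T: "T \<in> F'" "h \<in> edges T" "g \<in> P' T h" "g \<notin> ?E"
            "nonbridge (?E \<union> ?E') g" and G: "G = F" "G' = forest_minus_edge F' T h" by blast
          have fx: "\<forall>x\<in>leaves T. \<phi>' T x = x" using B.fix_leaf[OF T(1)] by blast
          have comm: "?E' \<union> ?E = ?E \<union> ?E'" by blast
          from cut_lowers_nullity[OF F' I' T(1,2) B.emb[OF T(1)] fx P'(2)[OF T(1)] assms, of ?E g,
            unfolded comm, OF Vb finE T(3-5), folded G(2)]
          obtain J where J: "phylo_forest X G'" "fembeds G' J" "\<Union>(J ` G') \<subset> ?E'"
            "nullity V (\<Union>(J ` G') \<union> ?E) + 1 \<le> nullity V (?E \<union> ?E')"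
            by (elim conjE exE) (rule that)
          have "card (\<Union>(J ` G')) < card ?E'" using J(3) finE by (intro psubset_card_mono) auto
          moreover have "\<Union>(J ` G') \<union> ?E = ?E \<union> \<Union>(J ` G')" by blast
          ultimately show ?thesis
            using extend[OF st x order_refl _ _ J(1) _ J(2), of I] F I J(3,4) cost G(1) by auto
        qed
      qed
    qed
  qed
qed

lemma displays_forest_fembeds:
  assumes "displays_forest N F" "phylo_forest X F"
  shows "\<exists>I. fembeds F I \<and> \<Union>(I ` F) \<subseteq> edges N"
proof -
  obtain S where S: "\<forall>T\<in>F. displays_via N (S T) T"
    "pairwise (\<lambda>T T'. disjnt (verts (S T)) (verts (S T'))) F"
    using assms(1) unfolding displays_forest_def by blast
  have sub: "subtree_of (S T) N" if "T \<in> F" for T using S(1) that by (simp add: displays_via_def)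
  have v: "\<Union>(edges (S T)) \<subseteq> verts (S T)" if "T \<in> F" for T
    using sub[OF that] by (auto simp: subtree_of_def tree_graph_def simple_graph_def)
  have "fembeds F (\<lambda>T. edges (S T))"
    unfolding fembeds_def
  proof (intro conjI ballI impI)
    fix T assume "T \<in> F"
    then show "embeds T (edges (S T))"
      using displays_via_embeds phylo_forest_tree(1)[OF assms(2)] S(1) by blast
  next
    fix T T' assume "T \<in> F" "T' \<in> F" "T \<noteq> T'"
    then show "\<Union>(edges (S T)) \<inter> \<Union>(edges (S T')) = {}"
      using S(2) v[of T] v[of T'] unfolding pairwise_def disjnt_def by blast
  qed
  moreover have "\<Union>((\<lambda>T. edges (S T)) ` F) \<subseteq> edges N" using sub unfolding subtree_of_def by blast
  ultimately show ?thesis by blast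
qed

theorem theorem6p1:
  fixes X :: "'v set" and N :: "'v graph" and F F' :: "'v graph set"
  assumes "finite X" and "X \<noteq> {}"
    and "phylo_network X N"
    and "phylo_forest X F" and "phylo_forest X F'"
    and "displays_forest N F" and "displays_forest N F'"
  shows "\<exists>\<sigma> Fs Fs'. cherry_picking_sequence X F F' \<sigma> Fs Fs' \<and>
           reticulation_number N \<ge> int (weight \<sigma> Fs Fs')"
proof -
  obtain I where I: "fembeds F I" "\<Union>(I ` F) \<subseteq> edges N"
    using displays_forest_fembeds[OF assms(6,4)] by blast
  obtain I' where I': "fembeds F' I'" "\<Union>(I' ` F') \<subseteq> edges N"
    using displays_forest_fembeds[OF assms(7,5)] by blast
  have N: "simple_graph N" "connected_graph N" using assms(3) by (simp_all add: phylo_network_def)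
  have fin: "finite (verts N)" using N(1) by (simp add: simple_graph_def)
  have e: "\<exists>a\<in>verts N. \<exists>b\<in>verts N. a \<noteq> b \<and> g = {a, b}" if "g \<in> edges N" for g
    using simple_graph_edgeE[OF N(1) that] by metis
  have "\<exists>a\<in>verts N. \<exists>b\<in>verts N. a \<noteq> b \<and> g = {a, b}" if "g \<in> \<Union>(I ` F) \<union> \<Union>(I' ` F')" for g
    using e[of g] that I(2) I'(2) by blast
  from ex_sequence[OF fin assms(4,5) I(1) I'(1) this]
  obtain \<sigma> Fs Fs' where s: "cherry_picking_sequence X F F' \<sigma> Fs Fs'"
    "int (weight \<sigma> Fs Fs') \<le> nullity (verts N) (\<Union>(I ` F) \<union> \<Union>(I' ` F'))" by blast
  have "nullity (verts N) (\<Union>(I ` F) \<union> \<Union>(I' ` F')) \<le> nullity (verts N) (edges N)"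
  proof (rule nullity_mono[OF fin simple_graph_finite_edges[OF N(1)]])
    show "\<Union>(I ` F) \<union> \<Union>(I' ` F') \<subseteq> edges N" using I(2) I'(2) by blast
    show "\<exists>a\<in>verts N. \<exists>b\<in>verts N. g = {a, b}" if "g \<in> edges N" for g using e[OF that] by blast
  qed
  also have "nullity (verts N) (edges N) = reticulation_number N"
    using N(2) unfolding connected_graph_iff[OF N(1)] reticulation_number_def
    by (intro nullity_connected) auto
  finally show ?thesis using s by (intro exI[of _ \<sigma>] exI[of _ Fs] exI[of _ Fs']) simp
qed

end
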